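(* Let $\mathfrak{g}=\mathfrak{gl}_n(\mathbb{C})$ and fix a factorizable quantum group $\mathrm{U}_\hbar(\mathfrak{g},r)$. Let $O_\lambda$ be the orbit of $\lambda=\mathrm{diag}(\Lambda_1,\dots,\Lambda_l)$, with scalar blocks $\Lambda_i$ of size $n_i$ and pairwise distinct eigenvalues $\lambda_1,\dots,\lambda_l$, $l\ge 2$, and let $O_\mu$ be a symmetric orbit of $\mu=\mathrm{diag}(\mathrm{M}_1,\mathrm{M}_2)$ with eigenvalues $\mu_1\neq\mu_2$ of multiplicities $n_1$ and $n'=n_2+\dots+n_l$. Let $$P(x)=(\mu_1-\mu_2)\prod_{i=2}^l\frac{x-\lambda_i}{\lambda_1-\lambda_i}+\mu_2,$$ so that $P(\lambda_1)=\mu_1$, $P(\lambda_2)=\dots=P(\lambda_l)=\mu_2$, and $X\mapsto P(X)$ is a $GL_n(\mathbb{C})$-equivariant map $O_\lambda\to O_\mu$ with $P(\lambda)=\mu$; let $O_\lambda$ and $O_\mu$ carry the Poisson structures defined by $s^0_\lambda-2\lambda_1\kappa_\lambda$ and $s^0_\mu-2\mu_1\kappa_\mu$. Let $\mathbb{C}_\hbar[O_\lambda]$, with matrix of generators $L_\lambda$, and $\mathbb{C}_\hbar[O_\mu]$, with matrix of generators $L_\mu$, be the quantizations described in the context. Then the assignment $L_\mu\mapsto P(L_\lambda)$ is a $\mathrm{U}_\hbar(\mathfrak{g},r)$-equivariant quantization of the orbit bundle $O_\lambda\to O_\mu$, $X\mapsto P(X)$; that is, it defines a $\mathrm{U}_\hbar(\mathfrak{g},r)$-equivariant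 homomorphism of $\mathbb{C}[\![\hbar]\!]$-algebras $\mathbb{C}_\hbar[O_\mu]\to\mathbb{C}_\hbar[O_\lambda]$ which modulo $\hbar$ is the homomorphism $P^*\colon\mathbb{C}[O_\mu]\to\mathbb{C}[O_\lambda]$, $f\mapsto f\circ P$.
   Context: Here $\mathrm{U}_\hbar(\mathfrak{g},r)$ is a quasitriangular quantization of $\mathrm{U}(\mathfrak{g})$ along a factorizable Lie bialgebra structure with classical r-matrix $r\in\wedge^2\mathfrak{g}$ (the trace form identifies $\mathfrak{g}^*\cong\mathfrak{g}$, coadjoint with adjoint orbits). Put $q=e^\hbar$, $\omega=1-q^{-2}$, $\hat m=\frac{1-q^{-2m}}{1-q^{-2}}$. **Poisson structures.** $G=GL_n(\mathbb{C})$ acts on the right by $X\cdot g=g^{-1}Xg$; $G^\lambda$ is the stabilizer of $\lambda$ and $\mathfrak{g}^\lambda$ its Lie algebra. With $I_i$ the index set of the $i$-th block, $\xi_{ij}=\sum_{s\in I_i,t\in I_j}E_{st}\wedge E_{ts}$ mod $\mathfrak{g}\wedge\mathfrak{g}^\lambda$, $\kappa_\lambda=\sum_{i<j}\frac{1}{\lambda_i-\lambda_j}\xi_{ij}$, $s^0_\lambda=\sum_{i<j}\frac{\lambda_i+\lambda_j}{\lambda_i-\lambda_j}\xi_{ij}$. The Poisson structure on $O_\lambda\cong G^\lambda\backslash G$ defined by $s$ is $\overleftarrow{r}+\overrightarrow{s}$, where $\overrightarrow{s}$ is the $G$-invariant bivector field with value $s$ at $\lambda$, and $\overleftarrow{r}$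 is the bivector field generated by $r$ via the $G$-action. Similarly for $\mu$. **Quantized orbits.** Let $\rho$ be the basic representation in $\mathbb{C}^n[\![\hbar]\!]$, $R$ the image of the universal R-matrix in $\mathrm{End}(\mathbb{C}^n\otimes\mathbb{C}^n)[\![\hbar]\!]$, $S=\sigma R$ with $\sigma$ the flip, normalized so that $S^2=(q-q^{-1})S+1$. Let $R^*=\bigl((R^{t_1})^{-1}\bigr)^{t_1}=R_1^*\otimes R_2^*$ ($t_1$ = transposition in the first tensor factor) and $D=\nu R_1^*R_2^*$, where the scalar $\nu$ is such that $\mathrm{Tr}(D)=\frac{1-q^{-2n}}{1-q^{-2}}$; put $\mathrm{Tr}_q(X)=\mathrm{Tr}(DX)$. The algebra $\mathbb{C}_\hbar[O_\lambda]$ is the unital associative $\mathbb{C}[\![\hbar]\!]$-algebra generated by the entries of the $n\times n$ matrix $L=L_\lambda$ subject to $$[SL_2S,L_2]=-qt[S,L_2]\ \ (L_2=1\otimes L),\qquad (L-\lambda_1)\cdots(L-\lambda_l)=0,$$ $$\mathrm{Tr}_q(L^k)=\sum_{i=1}^l\lambda_i^k\,\hat n_i\prod_{j\neq i}\Bigl(1+\frac{\hat n_j(\omega\lambda_j+t)}{\lambda_i-\lambda_j}\Bigr),\quad k=1,\dots,l-1,$$ with $t=\lambda_1(e^{-2\hbar}-1)$. The algebra $\mathbb{C}_\hbar[O_\mu]$ is defined in the same way from $(\mu_1,\mu_2)$ with multiplicities $(n_1,n')$, in place of $(\lambda_1,\dots,\lambda_l)$ with multiplicities $(n_1,\dots,n_l)$,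 and with $t=\mu_1(e^{-2\hbar}-1)$. Both are $\mathrm{U}_\hbar(\mathfrak{g},r)$-module algebras with action $x\triangleright L=\rho(\gamma(x^{(1)}))L\rho(x^{(2)})$ ($\gamma$ the antipode), and are quantizations of the function algebras of the orbits with the Poisson structures above. **Quantization of a map.** Given quantizations $A_\hbar,B_\hbar$ of function algebras $A,B$ and a homomorphism $f\colon B\to A$, a quantization of $f$ is a homomorphism $f_\hbar\colon B_\hbar\to A_\hbar$ of $\mathbb{C}[\![\hbar]\!]$-algebras whose induced map $B_\hbar/\hbar B_\hbar\to A_\hbar/\hbar A_\hbar$ is $f$. *)

theory Defs
  imports
    "HOL-Analysis.Analysis"
    "HOL-Computational_Algebra.Computational_Algebra"
    "HOL-Library.Poly_Mapping"
    "HOL-Algebra.Algebraic_Closure_Type"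
begin

section \<open>Topologically free modules over formal power series\<close>

text \<open>
  The ground ring is \<^typ>\<open>complex fps\<close>, with formal parameter \<^term>\<open>fps_X :: complex fps\<close>.
  Every topologically free module over it is isomorphic to V[[h]] for a complex vector space V;
  choosing a basis of V indexed by the type \<open>'b\<close>, the elements of V[[h]] become the families of
  power series that are nonzero modulo each power of the parameter at finitely many indices only.
  In this model the completed tensor product over the ground ring is the module on the product
  of the index types.
\<close>

definition tsupp :: "nat \<Rightarrow> ('b \<Rightarrow> complex fps) \<Rightarrow> 'b set" where
  "tsupp N f = {b. \<exists>k\<le>N. fps_nth (f b) k \<noteq> 0}"

typedef 'b tfree = "{f :: 'b \<Rightarrow> complex fps. \<forall>N. finite (tsupp N f)}"
  morphisms coord Abs_tfree
  by (rule exI[of _ "\<lambda>_. 0"]) (simp add: tsupp_def)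

setup_lifting type_definition_tfree

lemma finite_tsupp_coord: "finite (tsupp N (coord x))"
  using coord[of x] by simp

lemma tsupp_mono: "k \<le> N \<Longrightarrow> tsupp k f \<subseteq> tsupp N f"
  unfolding tsupp_def using order_trans by blast

lemma tsupp_mult:
  fixes x y :: "complex fps"
  assumes "fps_nth (x * y) k \<noteq> 0" "k \<le> N"
  shows "\<exists>i\<le>N. fps_nth x i \<noteq> 0" "\<exists>i\<le>N. fps_nth y i \<noteq> 0"
proof -
  have "(\<Sum>i=0..k. fps_nth x i * fps_nth y (k - i)) \<noteq> 0"
    using assms(1) by (simp add: fps_mult_nth)
  then obtain i where "i \<in> {0..k}" "fps_nth x i * fps_nth y (k - i) \<noteq> 0"
    by (rule sum.not_neutral_contains_not_neutral)
  then have "i \<le> N" "k - i \<le> N" "fps_nth x i \<noteq> 0" "fps_nth y (k - i) \<noteq> 0"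
    using assms(2) by auto
  then show "\<exists>i\<le>N. fps_nth x i \<noteq> 0" "\<exists>i\<le>N. fps_nth y i \<noteq> 0" by blast+
qed

lemma finite_tsupp_add:
  assumes "\<forall>N. finite (tsupp N f)" "\<forall>N. finite (tsupp N g)"
  shows "\<forall>N. finite (tsupp N (\<lambda>b. f b + g b))"
proof
  fix N
  have "tsupp N (\<lambda>b. f b + g b) \<subseteq> tsupp N f \<union> tsupp N g"
    by (auto simp: tsupp_def)
  then show "finite (tsupp N (\<lambda>b. f b + g b))"
    using assms by (meson finite_UnI finite_subset)
qed

lemma finite_tsupp_diff:
  assumes "\<forall>N. finite (tsupp N f)" "\<forall>N. finite (tsupp N g)"
  shows "\<forall>N. finite (tsupp N (\<lambda>b. f b - g b))"
proof
  fix N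
  have "tsupp N (\<lambda>b. f b - g b) \<subseteq> tsupp N f \<union> tsupp N g"
    by (auto simp: tsupp_def)
  then show "finite (tsupp N (\<lambda>b. f b - g b))"
    using assms by (meson finite_UnI finite_subset)
qed

lemma finite_tsupp_scale:
  assumes "\<forall>N. finite (tsupp N f)"
  shows "\<forall>N. finite (tsupp N (\<lambda>b. c * f b))"
proof
  fix N
  have "tsupp N (\<lambda>b. c * f b) \<subseteq> tsupp N f"
    by (auto simp: tsupp_def dest: tsupp_mult)
  then show "finite (tsupp N (\<lambda>b. c * f b))"
    using assms finite_subset by blast
qed

lemma finite_tsupp_basis: "\<forall>N. finite (tsupp N (\<lambda>b. if b = a then 1 else 0))"
proof
  fix N
  have "tsupp N (\<lambda>b. if b = a then 1 else 0) \<subseteq> {a}"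
    by (auto simp: tsupp_def)
  then show "finite (tsupp N (\<lambda>b. if b = a then 1 else 0))"
    using finite_subset by blast
qed

lemma finite_tsupp_tens:
  assumes "\<forall>N. finite (tsupp N f)" "\<forall>N. finite (tsupp N g)"
  shows "\<forall>N. finite (tsupp N (\<lambda>p. f (fst p) * g (snd p)))"
proof
  fix N
  have "fst p \<in> tsupp N f \<and> snd p \<in> tsupp N g" if "p \<in> tsupp N (\<lambda>p. f (fst p) * g (snd p))" for p
    using that by (auto simp: tsupp_def dest: tsupp_mult)
  then have "tsupp N (\<lambda>p. f (fst p) * g (snd p)) \<subseteq> tsupp N f \<times> tsupp N g"
    by (auto simp: mem_Times_iff)
  then show "finite (tsupp N (\<lambda>p. f (fst p) * g (snd p)))"
    using assms by (meson finite_SigmaI finite_subset)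
qed

instantiation tfree :: (type) ab_group_add
begin

lift_definition zero_tfree :: "'a tfree" is "\<lambda>_. 0"
  by (simp add: tsupp_def)

lift_definition plus_tfree :: "'a tfree \<Rightarrow> 'a tfree \<Rightarrow> 'a tfree" is "\<lambda>f g b. f b + g b"
  by (rule finite_tsupp_add[rule_format])

lift_definition uminus_tfree :: "'a tfree \<Rightarrow> 'a tfree" is "\<lambda>f b. - f b"
  by (simp add: tsupp_def)

lift_definition minus_tfree :: "'a tfree \<Rightarrow> 'a tfree \<Rightarrow> 'a tfree" is "\<lambda>f g b. f b - g b"
  by (rule finite_tsupp_diff[rule_format])

instance
  by standard (transfer; simp add: algebra_simps)+

end

lift_definition tscale :: "complex fps \<Rightarrow> 'b tfree \<Rightarrow> 'b tfree" is "\<lambda>c f b. c * f b"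
  by (rule finite_tsupp_scale[rule_format])

lift_definition tbasis :: "'b \<Rightarrow> 'b tfree" is "\<lambda>a b. if b = a then 1 else 0"
  by (rule finite_tsupp_basis[rule_format])

lift_definition tens :: "'b tfree \<Rightarrow> 'c tfree \<Rightarrow> ('b \<times> 'c) tfree"
  is "\<lambda>f g p. f (fst p) * g (snd p)"
  by (rule finite_tsupp_tens[rule_format])

text \<open>
  \<open>tsum x f\<close> is the sum of \<open>coord x b * f b\<close> over all \<open>b\<close>, which converges in the topology given by
  the powers of the parameter: its coefficient at order N only involves the finite set
  \<open>tsupp N (coord x)\<close>.  Linear functionals and linear maps are automatically continuous, so
  \<open>\<lambda>x. tsum x f\<close> and \<open>textend f\<close> are the unique ones with values \<open>f\<close> on the basis.
\<close>

definition tsum :: "'b tfree \<Rightarrow> ('b \<Rightarrow> complex fps) \<Rightarrow> complex fps" where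
  "tsum x f = Abs_fps (\<lambda>N. \<Sum>b\<in>tsupp N (coord x). fps_nth (coord x b * f b) N)"

lemma finite_tsupp_tsum: "\<forall>N. finite (tsupp N (\<lambda>c. tsum x (\<lambda>b. coord (F b) c)))"
proof
  fix N
  have "c \<in> (\<Union>b\<in>tsupp N (coord x). tsupp N (coord (F b)))"
    if c: "c \<in> tsupp N (\<lambda>c. tsum x (\<lambda>b. coord (F b) c))" for c
  proof -
    obtain k where k: "k \<le> N" "fps_nth (tsum x (\<lambda>b. coord (F b) c)) k \<noteq> 0"
      using c by (auto simp: tsupp_def)
    then obtain b where b: "b \<in> tsupp k (coord x)" "fps_nth (coord x b * coord (F b) c) k \<noteq> 0"
      by (auto simp: tsum_def elim: sum.not_neutral_contains_not_neutral)
    have "c \<in> tsupp N (coord (F b))"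
      using tsupp_mult(2)[OF b(2) k(1)] by (simp add: tsupp_def)
    moreover have "b \<in> tsupp N (coord x)" by (rule subsetD[OF tsupp_mono[OF k(1)] b(1)])
    ultimately show ?thesis by blast
  qed
  then have "tsupp N (\<lambda>c. tsum x (\<lambda>b. coord (F b) c)) \<subseteq>
      (\<Union>b\<in>tsupp N (coord x). tsupp N (coord (F b)))" by blast
  moreover have "finite (\<Union>b\<in>tsupp N (coord x). tsupp N (coord (F b)))"
    by (simp add: finite_tsupp_coord)
  ultimately show "finite (tsupp N (\<lambda>c. tsum x (\<lambda>b. coord (F b) c)))"
    using finite_subset by blast
qed

definition textend :: "('b \<Rightarrow> 'c tfree) \<Rightarrow> 'b tfree \<Rightarrow> 'c tfree" where
  "textend F x = Abs_tfree (\<lambda>c. tsum x (\<lambda>b. coord (F b) c))"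

lemma coord_textend: "coord (textend F x) c = tsum x (\<lambda>b. coord (F b) c)"
  using finite_tsupp_tsum[of x F] by (simp add: textend_def Abs_tfree_inverse)

definition tmap :: "('b tfree \<Rightarrow> 'd tfree) \<Rightarrow> ('c tfree \<Rightarrow> 'e tfree) \<Rightarrow>
    ('b \<times> 'c) tfree \<Rightarrow> ('d \<times> 'e) tfree" where
  "tmap f g = textend (\<lambda>(b, c). tens (f (tbasis b)) (g (tbasis c)))"

definition tflip :: "('b \<times> 'c) tfree \<Rightarrow> ('c \<times> 'b) tfree" where
  "tflip = textend (\<lambda>(b, c). tens (tbasis c) (tbasis b))"

definition tmult :: "('b tfree \<Rightarrow> 'b tfree \<Rightarrow> 'b tfree) \<Rightarrow> ('c tfree \<Rightarrow> 'c tfree \<Rightarrow> 'c tfree) \<Rightarrow>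
    ('b \<times> 'c) tfree \<Rightarrow> ('b \<times> 'c) tfree \<Rightarrow> ('b \<times> 'c) tfree" where
  "tmult m m' z w =
     textend (\<lambda>(b, c). textend (\<lambda>(b', c').
       tens (m (tbasis b) (tbasis b')) (m' (tbasis c) (tbasis c'))) w) z"

definition tcong :: "nat \<Rightarrow> 'b tfree \<Rightarrow> 'b tfree \<Rightarrow> bool" where
  \<comment> \<open>congruence modulo the \<open>N\<close>-th power of the parameter\<close>
  "tcong N x y \<longleftrightarrow> (\<forall>b. \<forall>k<N. fps_nth (coord x b) k = fps_nth (coord y b) k)"


section \<open>Quasitriangular topological Hopf algebras\<close>

record 'b hopf =
  hmult :: "'b tfree \<Rightarrow> 'b tfree \<Rightarrow> 'b tfree"
  hunit :: "'b tfree"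
  comult :: "'b tfree \<Rightarrow> ('b \<times> 'b) tfree"
  counit :: "'b tfree \<Rightarrow> complex fps"
  antipode :: "'b tfree \<Rightarrow> 'b tfree"
  rmatrix :: "('b \<times> 'b) tfree"

abbreviation hmult2 :: "'b hopf \<Rightarrow> ('b \<times> 'b) tfree \<Rightarrow> ('b \<times> 'b) tfree \<Rightarrow> ('b \<times> 'b) tfree" where
  "hmult2 H \<equiv> tmult (hmult H) (hmult H)"

definition topological_hopf_algebra :: "'b hopf \<Rightarrow> bool" where
  "topological_hopf_algebra H \<longleftrightarrow>
     (\<forall>y. module_hom tscale tscale (\<lambda>x. hmult H x y)) \<and>
     (\<forall>x. module_hom tscale tscale (hmult H x)) \<and>
     (\<forall>x y z. hmult H (hmult H x y) z = hmult H x (hmult H y z)) \<and>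
     (\<forall>x. hmult H (hunit H) x = x \<and> hmult H x (hunit H) = x) \<and>
     module_hom tscale tscale (comult H) \<and>
     (\<forall>x a b c. coord (tmap (comult H) id (comult H x)) ((a, b), c) =
                coord (tmap id (comult H) (comult H x)) (a, (b, c))) \<and>
     module_hom tscale (*) (counit H) \<and>
     (\<forall>x. textend (\<lambda>(b, c). tscale (counit H (tbasis b)) (tbasis c)) (comult H x) = x) \<and>
     (\<forall>x. textend (\<lambda>(b, c). tscale (counit H (tbasis c)) (tbasis b)) (comult H x) = x) \<and>
     (\<forall>x y. comult H (hmult H x y) = hmult2 H (comult H x) (comult H y)) \<and>
     comult H (hunit H) = tens (hunit H) (hunit H) \<and>
     (\<forall>x y. counit H (hmult H x y) = counit H x * counit H y) \<and>
     counit H (hunit H) = 1 \<and>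
     module_hom tscale tscale (antipode H) \<and>
     (\<forall>x. textend (\<lambda>(b, c). hmult H (antipode H (tbasis b)) (tbasis c)) (comult H x) =
            tscale (counit H x) (hunit H)) \<and>
     (\<forall>x. textend (\<lambda>(b, c). hmult H (tbasis b) (antipode H (tbasis c))) (comult H x) =
            tscale (counit H x) (hunit H))"

definition quasitriangular :: "'b hopf \<Rightarrow> bool" where
  "quasitriangular H \<longleftrightarrow>
     topological_hopf_algebra H \<and>
     (\<exists>Rinv. hmult2 H (rmatrix H) Rinv = tens (hunit H) (hunit H) \<and>
             hmult2 H Rinv (rmatrix H) = tens (hunit H) (hunit H)) \<and>
     (\<forall>x. hmult2 H (tflip (comult H x)) (rmatrix H) = hmult2 H (rmatrix H) (comult H x)) \<and>
     (let mult3 = tmult (hmult H) (hmult2 H);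
          R12 = textend (\<lambda>(b, c). tens (tbasis b) (tens (tbasis c) (hunit H))) (rmatrix H);
          R13 = textend (\<lambda>(b, c). tens (tbasis b) (tens (hunit H) (tbasis c))) (rmatrix H);
          R23 = tens (hunit H) (rmatrix H)
      in (\<forall>a b c. coord (tmap (comult H) id (rmatrix H)) ((a, b), c) =
                  coord (mult3 R13 R23) (a, (b, c))) \<and>
         tmap id (comult H) (rmatrix H) = mult3 R13 R12)"


section \<open>Matrices\<close>

text \<open>
  The index type \<open>'n\<close> has n elements.  An element of the tensor square of the n by n matrices is a
  matrix indexed by pairs: the coefficient of the tensor product of the matrix units
  \<open>E i j\<close> and \<open>E k l\<close> is the entry in row \<open>(i, k)\<close> and column \<open>(j, l)\<close>.
\<close>

definition mtens :: "'a::semiring_1^'n^'n \<Rightarrow> 'a^'n^'n \<Rightarrow> 'a^('n \<times> 'n)^('n \<times> 'n)" where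
  "mtens A B = (\<chi> p q. A $ fst p $ fst q * B $ snd p $ snd q)"

definition munit :: "'n \<Rightarrow> 'n \<Rightarrow> 'a::semiring_1^'n^'n" where
  "munit i j = (\<chi> a b. if a = i \<and> b = j then 1 else 0)"

text \<open>The flip is also the split Casimir element of the trace form.\<close>

definition mflip :: "'a::semiring_1^('n::finite \<times> 'n)^('n \<times> 'n)" where
  "mflip = (\<chi> p q. if fst p = snd q \<and> snd p = fst q then 1 else 0)"

definition transpose1 :: "'a^('n::finite \<times> 'n)^('n \<times> 'n) \<Rightarrow> 'a^('n \<times> 'n)^('n \<times> 'n)" where
  "transpose1 M = (\<chi> p q. M $ (fst q, snd p) $ (fst p, snd q))"

primrec mpower :: "'a::semiring_1^'n^'n \<Rightarrow> nat \<Rightarrow> 'a^'n^'n" where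
  "mpower A 0 = mat 1"
| "mpower A (Suc k) = A ** mpower A k"

definition mpoly_eval :: "('c::zero \<Rightarrow> 'a::semiring_1) \<Rightarrow> 'c poly \<Rightarrow> 'a^'n^'n \<Rightarrow> 'a^'n^'n" where
  \<comment> \<open>the first argument embeds the coefficients into the ring of matrix entries\<close>
  "mpoly_eval \<iota> p A =
     (\<Sum>k\<le>Polynomial.degree p. mat (\<iota> (Polynomial.coeff p k)) ** mpower A k)"


section \<open>Factorizable quantum groups of the general linear Lie algebra\<close>

text \<open>Words form a monoid, so polynomial mappings on words are free associative algebras.\<close>

instantiation list :: (type) monoid_add
begin

definition zero_list :: "'a list" where "zero_list = []"

definition plus_list :: "'a list \<Rightarrow> 'a list \<Rightarrow> 'a list" where "plus_list = (@)"

instance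
  by standard (simp_all add: zero_list_def plus_list_def)

end

type_synonym ('x, 'k) free_algebra = "'x list \<Rightarrow>\<^sub>0 'k"

abbreviation gen :: "'x \<Rightarrow> ('x, 'k::semiring_1) free_algebra" where
  "gen x \<equiv> Poly_Mapping.single [x] 1"

abbreviation scalar :: "'k \<Rightarrow> ('x, 'k::semiring_1) free_algebra" where
  "scalar c \<equiv> Poly_Mapping.single [] c"

text \<open>The kernel of the map from the tensor algebra to the universal enveloping algebra.\<close>

definition enveloping_ideal :: "('n \<times> 'n, complex) free_algebra set" where
  "enveloping_ideal = Idl\<^bsub>ring_of_type_algebra\<^esub>
     {gen (i, j) * gen (k, l) - gen (k, l) * gen (i, j)
        - ((if j = k then gen (i, l) else 0) - (if l = i then gen (k, j) else 0)) | i j k l. True}"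

definition hword :: "'b hopf \<Rightarrow> ('x \<Rightarrow> 'b tfree) \<Rightarrow> 'x list \<Rightarrow> 'b tfree" where
  "hword H e w = foldr (\<lambda>x h. hmult H (e x) h) w (hunit H)"

definition heval :: "'b hopf \<Rightarrow> ('x \<Rightarrow> 'b tfree) \<Rightarrow> ('x, complex) free_algebra \<Rightarrow> 'b tfree" where
  "heval H e p =
     (\<Sum>w\<in>Poly_Mapping.keys p. tscale (fps_const (Poly_Mapping.lookup p w)) (hword H e w))"

text \<open>
  The elements \<open>e (i, j)\<close> are lifts of the matrix units.  The first three conditions say that
  modulo the parameter they induce an isomorphism from the universal enveloping algebra, as a
  bialgebra and hence as a Hopf algebra.
\<close>

definition quantizes_enveloping_algebra :: "'b hopf \<Rightarrow> ('n::finite \<times> 'n \<Rightarrow> 'b tfree) \<Rightarrow> bool" where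
  "quantizes_enveloping_algebra H e \<longleftrightarrow>
     (\<forall>h. \<exists>p. tcong 1 h (heval H e p)) \<and>
     (\<forall>p. tcong 1 (heval H e p) 0 \<longleftrightarrow> p \<in> enveloping_ideal) \<and>
     (\<forall>x. tcong 1 (comult H (e x)) (tens (e x) (hunit H) + tens (hunit H) (e x)))"

definition leg12 :: "'a::semiring_1^('n::finite \<times> 'n)^('n \<times> 'n) \<Rightarrow> 'a^('n \<times> 'n \<times> 'n)^('n \<times> 'n \<times> 'n)" where
  "leg12 z = (\<chi> p q. case p of (i, j, k) \<Rightarrow> case q of (i', j', k') \<Rightarrow>
     if k = k' then z $ (i, j) $ (i', j') else 0)"

definition leg13 :: "'a::semiring_1^('n::finite \<times> 'n)^('n \<times> 'n) \<Rightarrow> 'a^('n \<times> 'n \<times> 'n)^('n \<times> 'n \<times> 'n)" where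
  "leg13 z = (\<chi> p q. case p of (i, j, k) \<Rightarrow> case q of (i', j', k') \<Rightarrow>
     if j = j' then z $ (i, k) $ (i', k') else 0)"

definition leg23 :: "'a::semiring_1^('n::finite \<times> 'n)^('n \<times> 'n) \<Rightarrow> 'a^('n \<times> 'n \<times> 'n)^('n \<times> 'n \<times> 'n)" where
  "leg23 z = (\<chi> p q. case p of (i, j, k) \<Rightarrow> case q of (i', j', k') \<Rightarrow>
     if i = i' then z $ (j, k) $ (j', k') else 0)"

definition mcomm :: "'a::ring_1^'m^'m \<Rightarrow> 'a^'m^'m \<Rightarrow> 'a^'m^'m" where
  "mcomm A B = A ** B - B ** A"

text \<open>
  A skew-symmetric \<open>r\<close> such that \<open>r\<close> plus the split Casimir element solves the classical
  Yang-Baxter equation; the symmetric part is nondegenerate, whence factorizability.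
\<close>

definition factorizable_r_matrix :: "complex^('n::finite \<times> 'n)^('n \<times> 'n) \<Rightarrow> bool" where
  "factorizable_r_matrix r \<longleftrightarrow>
     mflip ** r ** mflip = - r \<and>
     (let z = r + mflip in
        mcomm (leg12 z) (leg13 z) + mcomm (leg12 z) (leg23 z) + mcomm (leg13 z) (leg23 z) = 0)"

text \<open>
  The first order term of the universal R-matrix fixes the Lie bialgebra structure being quantized:
  since the R-matrix intertwines the coproduct with its opposite, the cobracket is the coboundary
  of \<open>r\<close>.
\<close>

definition factorizable_quantum_group ::
    "'b hopf \<Rightarrow> ('n::finite \<times> 'n \<Rightarrow> 'b tfree) \<Rightarrow> complex^('n \<times> 'n)^('n \<times> 'n) \<Rightarrow> bool" where
  "factorizable_quantum_group H e r \<longleftrightarrow>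
     quasitriangular H \<and> quantizes_enveloping_algebra H e \<and> factorizable_r_matrix r \<and>
     tcong 2 (rmatrix H)
       (tens (hunit H) (hunit H) +
        tscale fps_X (\<Sum>i\<in>UNIV. \<Sum>j\<in>UNIV. \<Sum>k\<in>UNIV. \<Sum>l\<in>UNIV.
          tscale (fps_const ((r + mflip) $ (i, k) $ (j, l))) (tens (e (i, j)) (e (k, l)))))"

definition basic_representation ::
    "'b hopf \<Rightarrow> ('n::finite \<times> 'n \<Rightarrow> 'b tfree) \<Rightarrow> ('b tfree \<Rightarrow> complex fps^'n^'n) \<Rightarrow> bool" where
  "basic_representation H e \<rho> \<longleftrightarrow>
     module_hom tscale (\<lambda>c. map_matrix ((*) c)) \<rho> \<and>
     \<rho> (hunit H) = mat 1 \<and>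
     (\<forall>x y. \<rho> (hmult H x y) = \<rho> x ** \<rho> y) \<and>
     (\<forall>i j. map_matrix (\<lambda>c. fps_nth c 0) (\<rho> (e (i, j))) = munit i j)"

definition rep2 ::
    "('b tfree \<Rightarrow> complex fps^'n^'n) \<Rightarrow> ('b \<times> 'b) tfree \<Rightarrow> complex fps^('n::finite \<times> 'n)^('n \<times> 'n)" where
  "rep2 \<rho> z = (\<chi> p q. tsum z (\<lambda>(b, c). mtens (\<rho> (tbasis b)) (\<rho> (tbasis c)) $ p $ q))"


section \<open>Quantized orbits\<close>

definition qpar :: "complex fps" where "qpar = fps_exp 1"

definition omega :: "complex fps" where "omega = 1 - inverse qpar ^ 2"

definition qint :: "nat \<Rightarrow> complex fps" where
  "qint m = (1 - inverse qpar ^ (2 * m)) / (1 - inverse qpar ^ 2)"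

text \<open>\<open>R\<close> is the normalized image of the universal R-matrix, and \<open>S\<close> its composition with the flip.\<close>

definition braid :: "complex fps^('n::finite \<times> 'n)^('n \<times> 'n) \<Rightarrow> complex fps^('n \<times> 'n)^('n \<times> 'n)" where
  "braid R = mflip ** R"

definition hecke :: "complex fps^('n::finite \<times> 'n)^('n \<times> 'n) \<Rightarrow> bool" where
  "hecke S \<longleftrightarrow> S ** S = map_matrix ((*) (qpar - inverse qpar)) S + mat 1"

definition rstar :: "complex fps^('n::finite \<times> 'n)^('n \<times> 'n) \<Rightarrow> complex fps^('n \<times> 'n)^('n \<times> 'n)" where
  "rstar R = transpose1 (matrix_inv (transpose1 R))"

text \<open>The scalar \<open>\<nu>\<close> times the product of the two tensor factors of \<open>rstar R\<close>.\<close>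

definition dmatrix ::
    "complex fps \<Rightarrow> complex fps^('n::finite \<times> 'n)^('n \<times> 'n) \<Rightarrow> complex fps^'n^'n" where
  "dmatrix \<nu> R = (\<chi> i j. \<nu> * (\<Sum>k\<in>UNIV. rstar R $ (i, k) $ (k, j)))"

type_synonym 'n qmat = "('n \<times> 'n, complex fps) free_algebra"

definition genmat :: "'n qmat^'n^'n" where
  "genmat = (\<chi> i j. gen (i, j))"

definition qtrace :: "complex fps^'n^'n \<Rightarrow> 'n qmat^'n^'n \<Rightarrow> 'n::finite qmat" where
  "qtrace D M = trace (map_matrix scalar D ** M)"

definition blocksize :: "('n::finite \<Rightarrow> nat) \<Rightarrow> nat \<Rightarrow> nat" where
  "blocksize blk i = card {a. blk a = i}"

text \<open>
  Orbit data: \<open>l\<close> blocks, the eigenvalue \<open>ev i\<close> of the i-th block (\<open>1 \<le> i \<le> l\<close>), and the map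
  \<open>blk\<close> sending a row index to the number of the block containing it.
\<close>

definition reflection_defect ::
    "complex fps^('n::finite \<times> 'n)^('n \<times> 'n) \<Rightarrow> complex fps \<Rightarrow> 'n qmat^('n \<times> 'n)^('n \<times> 'n)" where
  "reflection_defect S t =
     (let S' = map_matrix scalar S; L2 = mtens (mat 1) genmat
      in mcomm (S' ** L2 ** S') L2 - mat (scalar (- qpar * t)) ** mcomm S' L2)"

definition qtrace_value ::
    "complex fps \<Rightarrow> nat \<Rightarrow> (nat \<Rightarrow> complex) \<Rightarrow> ('n::finite \<Rightarrow> nat) \<Rightarrow> nat \<Rightarrow> complex fps" where
  "qtrace_value t l ev blk k =
     (\<Sum>i\<in>{1..l}. fps_const (ev i ^ k) * qint (blocksize blk i) *
        (\<Prod>j\<in>{1..l} - {i}. 1 + qint (blocksize blk j) * (omega * fps_const (ev j) + t) /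
           fps_const (ev i - ev j)))"

definition orbit_ideal ::
    "complex fps^('n::finite \<times> 'n)^('n \<times> 'n) \<Rightarrow> complex fps^'n^'n \<Rightarrow>
     nat \<Rightarrow> (nat \<Rightarrow> complex) \<Rightarrow> ('n \<Rightarrow> nat) \<Rightarrow> 'n qmat set" where
  "orbit_ideal S D l ev blk =
     (let t = fps_const (ev 1) * (fps_exp (-2) - 1)
      in Idl\<^bsub>ring_of_type_algebra\<^esub>
        ({reflection_defect S t $ p $ q | p q. True} \<union>
         {foldr (\<lambda>i M. (genmat - mat (scalar (fps_const (ev i)))) ** M) [1..<Suc l] (mat 1) $ a $ b
            | a b. True} \<union>
         {qtrace D (mpower genmat k) - scalar (qtrace_value t l ev blk k) | k. k \<in> {1..l - 1}}))"

abbreviation qalg :: "'n qmat set \<Rightarrow> 'n qmat set ring" where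
  "qalg I \<equiv> ring_of_type_algebra Quot I"

abbreviation qclass :: "'n qmat set \<Rightarrow> 'n qmat \<Rightarrow> 'n qmat set" where
  "qclass I a \<equiv> I +>\<^bsub>ring_of_type_algebra\<^esub> a"


subsection \<open>The action of the quantum group\<close>

text \<open>
  \<open>act_gen H \<rho> (i, j) (k, m) x\<close> is the coefficient of the generator \<open>(k, m)\<close> in the entry
  \<open>(i, j)\<close> of the matrix obtained by letting \<open>x\<close> act on the matrix of generators.
  \<open>act_word\<close> extends this to words by means of the coproduct, as in any module algebra;
  note that the action preserves the length of words.
\<close>

definition act_gen ::
    "'b hopf \<Rightarrow> ('b tfree \<Rightarrow> complex fps^'n^'n) \<Rightarrow> 'n::finite \<times> 'n \<Rightarrow> 'n \<times> 'n \<Rightarrow> 'b tfree \<Rightarrow> complex fps" where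
  "act_gen H \<rho> x y h =
     tsum (comult H h) (\<lambda>(b, c).
       \<rho> (antipode H (tbasis b)) $ fst x $ fst y * \<rho> (tbasis c) $ snd y $ snd x)"

fun act_word ::
    "'b hopf \<Rightarrow> ('b tfree \<Rightarrow> complex fps^'n^'n) \<Rightarrow> ('n::finite \<times> 'n) list \<Rightarrow> ('n \<times> 'n) list \<Rightarrow>
     'b tfree \<Rightarrow> complex fps" where
  "act_word H \<rho> [] [] h = counit H h"
| "act_word H \<rho> (x # u) (y # v) h =
     tsum (comult H h) (\<lambda>(b, c). act_gen H \<rho> x y (tbasis b) * act_word H \<rho> u v (tbasis c))"
| "act_word H \<rho> u v h = 0"

definition act ::
    "'b hopf \<Rightarrow> ('b tfree \<Rightarrow> complex fps^'n^'n) \<Rightarrow> 'b tfree \<Rightarrow> 'n::finite qmat \<Rightarrow> 'n qmat" where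
  "act H \<rho> h p =
     (\<Sum>u\<in>Poly_Mapping.keys p. \<Sum>v\<in>{v. length v = length u}.
        Poly_Mapping.single v (Poly_Mapping.lookup p u * act_word H \<rho> u v h))"

definition qact ::
    "'b hopf \<Rightarrow> ('b tfree \<Rightarrow> complex fps^'n^'n) \<Rightarrow> 'n qmat set \<Rightarrow> 'b tfree \<Rightarrow>
     'n::finite qmat set \<Rightarrow> 'n qmat set" where
  \<comment> \<open>the action induced on cosets of the ideal \<open>I\<close>\<close>
  "qact H \<rho> I h C = (\<Union>a\<in>C. qclass I (act H \<rho> h a))"


section \<open>Classical orbits and their Poisson structures\<close>

definition diagmat :: "(nat \<Rightarrow> complex) \<Rightarrow> ('n \<Rightarrow> nat) \<Rightarrow> complex^'n^'n" where
  "diagmat ev blk = (\<chi> a b. if a = b then ev (blk a) else 0)"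

definition gconj :: "complex^'n^'n \<Rightarrow> complex^'n^'n \<Rightarrow> complex^'n^'n" where
  "gconj x g = matrix_inv g ** x ** g"

definition orbit :: "complex^'n^'n \<Rightarrow> (complex^'n^'n) set" where
  "orbit x = {gconj x g | g. invertible g}"

text \<open>
  The value at a point of an element of the free algebra, modulo the parameter.  Since
  semisimple orbits are closed, their regular functions are restrictions of polynomials
  in the matrix entries.
\<close>

definition classical_value :: "'n qmat \<Rightarrow> complex^'n^'n \<Rightarrow> complex" where
  "classical_value p x =
     (\<Sum>w\<in>Poly_Mapping.keys p. fps_nth (Poly_Mapping.lookup p w) 0 *
        prod_list (map (\<lambda>(i, j). x $ i $ j) w))"

definition coordinate_ring :: "(complex^'n^'n) set \<Rightarrow> (complex^'n^'n \<Rightarrow> complex) ring" where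
  "coordinate_ring Z =
     \<lparr>carrier = {restrict (classical_value p) Z | p. True},
      monoid.mult = (\<lambda>f g. \<lambda>x\<in>Z. f x * g x), one = (\<lambda>x\<in>Z. 1),
      ring.zero = (\<lambda>x\<in>Z. 0), add = (\<lambda>f g. \<lambda>x\<in>Z. f x + g x)\<rparr>"

definition classical_limit :: "(complex^'n^'n) set \<Rightarrow> 'n qmat set \<Rightarrow> complex^'n^'n \<Rightarrow> complex" where
  "classical_limit Z C = (\<lambda>x\<in>Z. classical_value (SOME p. p \<in> C) x)"

text \<open>
  Derivative of a function on the orbit along the vector field generated by \<open>\<xi>\<close>; the path
  1 + z \<open>\<xi>\<close> has the same tangent vector at the identity as exp (z \<open>\<xi>\<close>) and stays in the group
  for small z.
\<close>

definition lie_deriv ::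
    "complex^'n^'n \<Rightarrow> (complex^'n^'n \<Rightarrow> complex) \<Rightarrow> complex^'n^'n \<Rightarrow> complex" where
  "lie_deriv \<xi> f x = deriv (\<lambda>z. f (gconj x (mat 1 + map_matrix ((*) z) \<xi>))) 0"

definition bivector ::
    "complex^('n::finite \<times> 'n)^('n \<times> 'n) \<Rightarrow> (complex^'n^'n \<Rightarrow> complex) \<Rightarrow>
     (complex^'n^'n \<Rightarrow> complex) \<Rightarrow> complex^'n^'n \<Rightarrow> complex" where
  "bivector b f1 f2 x =
     (\<Sum>i\<in>UNIV. \<Sum>j\<in>UNIV. \<Sum>k\<in>UNIV. \<Sum>l\<in>UNIV.
        b $ (i, k) $ (j, l) * lie_deriv (munit i j) f1 x * lie_deriv (munit k l) f2 x)"

definition wedge :: "complex^'n^'n \<Rightarrow> complex^'n^'n \<Rightarrow> complex^('n::finite \<times> 'n)^('n \<times> 'n)" where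
  "wedge A B = mtens A B - mtens B A"

definition xi :: "('n::finite \<Rightarrow> nat) \<Rightarrow> nat \<Rightarrow> nat \<Rightarrow> complex^('n \<times> 'n)^('n \<times> 'n)" where
  "xi blk i j = (\<Sum>s\<in>{s. blk s = i}. \<Sum>t\<in>{t. blk t = j}. wedge (munit s t) (munit t s))"

definition kappa ::
    "nat \<Rightarrow> (nat \<Rightarrow> complex) \<Rightarrow> ('n::finite \<Rightarrow> nat) \<Rightarrow> complex^('n \<times> 'n)^('n \<times> 'n)" where
  "kappa l ev blk =
     (\<Sum>(i, j)\<in>{(i, j). 1 \<le> i \<and> i < j \<and> j \<le> l}.
        map_matrix ((*) (1 / (ev i - ev j))) (xi blk i j))"

definition s0 ::
    "nat \<Rightarrow> (nat \<Rightarrow> complex) \<Rightarrow> ('n::finite \<Rightarrow> nat) \<Rightarrow> complex^('n \<times> 'n)^('n \<times> 'n)" where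
  "s0 l ev blk =
     (\<Sum>(i, j)\<in>{(i, j). 1 \<le> i \<and> i < j \<and> j \<le> l}.
        map_matrix ((*) ((ev i + ev j) / (ev i - ev j))) (xi blk i j))"

text \<open>
  The bracket of the bivector field generated by \<open>r\<close> plus the invariant one with value \<open>s\<close> at the
  base point \<open>X0\<close> (\<open>s\<close> matters only modulo the stabilizer of \<open>X0\<close>); the latter is
  evaluated at \<open>gconj X0 g\<close> by pulling functions back along \<open>g\<close>.
\<close>

definition orbit_bracket ::
    "complex^('n::finite \<times> 'n)^('n \<times> 'n) \<Rightarrow> complex^('n \<times> 'n)^('n \<times> 'n) \<Rightarrow> complex^'n^'n \<Rightarrow>
     (complex^'n^'n \<Rightarrow> complex) \<Rightarrow> (complex^'n^'n \<Rightarrow> complex) \<Rightarrow> complex^'n^'n \<Rightarrow> complex" where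
  "orbit_bracket r s X0 f1 f2 =
     (\<lambda>x\<in>orbit X0. let g = (SOME g. invertible g \<and> gconj X0 g = x) in
        bivector r f1 f2 x +
        bivector s (\<lambda>Y. f1 (gconj Y g)) (\<lambda>Y. f2 (gconj Y g)) X0)"


definition orbit_poisson ::
    "complex^('n::finite \<times> 'n)^('n \<times> 'n) \<Rightarrow> nat \<Rightarrow> (nat \<Rightarrow> complex) \<Rightarrow> ('n \<Rightarrow> nat) \<Rightarrow>
     (complex^'n^'n \<Rightarrow> complex) \<Rightarrow> (complex^'n^'n \<Rightarrow> complex) \<Rightarrow> complex^'n^'n \<Rightarrow> complex" where
  "orbit_poisson r l ev blk =
     orbit_bracket r (s0 l ev blk - map_matrix ((*) (2 * ev 1)) (kappa l ev blk)) (diagmat ev blk)"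


section \<open>Quantizations of orbits and of maps between them\<close>

definition hbar_ideal :: "'n qmat set \<Rightarrow> 'n qmat set set" where
  "hbar_ideal I = {qclass I (scalar fps_X) \<otimes>\<^bsub>qalg I\<^esub> C | C. C \<in> carrier (qalg I)}"

definition residue_class :: "'n qmat set \<Rightarrow> 'n qmat set \<Rightarrow> 'n qmat set set" where
  "residue_class I C = hbar_ideal I +>\<^bsub>qalg I\<^esub> C"

definition residue_limit ::
    "(complex^'n^'n) set \<Rightarrow> 'n qmat set set \<Rightarrow> complex^'n^'n \<Rightarrow> complex" where
  "residue_limit Z B = classical_limit Z (SOME C. C \<in> B)"

text \<open>
  \<open>hbar_ideal I\<close> is the multiple of the algebra by the parameter; \<open>residue_limit\<close> sends the residue
  class of a generator to the corresponding matrix entry on the orbit.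
\<close>

definition orbit_quantization ::
    "'n qmat set \<Rightarrow> (complex^'n^'n) set \<Rightarrow>
     ((complex^'n^'n \<Rightarrow> complex) \<Rightarrow> (complex^'n^'n \<Rightarrow> complex) \<Rightarrow> complex^'n^'n \<Rightarrow> complex) \<Rightarrow> bool" where
  "orbit_quantization I Z br \<longleftrightarrow>
     (\<forall>C\<in>carrier (qalg I).
        qclass I (scalar fps_X) \<otimes>\<^bsub>qalg I\<^esub> C = \<zero>\<^bsub>qalg I\<^esub> \<longrightarrow> C = \<zero>\<^bsub>qalg I\<^esub>) \<and>
     residue_limit Z \<in> ring_iso (qalg I Quot hbar_ideal I) (coordinate_ring Z) \<and>
     (\<forall>A\<in>carrier (qalg I). \<forall>B\<in>carrier (qalg I). \<forall>C\<in>carrier (qalg I).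
        A \<otimes>\<^bsub>qalg I\<^esub> B \<ominus>\<^bsub>qalg I\<^esub> B \<otimes>\<^bsub>qalg I\<^esub> A = qclass I (scalar fps_X) \<otimes>\<^bsub>qalg I\<^esub> C \<longrightarrow>
        classical_limit Z C = br (classical_limit Z A) (classical_limit Z B))"

definition algebra_hom :: "'n qmat set \<Rightarrow> 'n qmat set \<Rightarrow> ('n qmat set \<Rightarrow> 'n qmat set) \<Rightarrow> bool" where
  "algebra_hom I J \<Phi> \<longleftrightarrow>
     \<Phi> \<in> ring_hom (qalg I) (qalg J) \<and> (\<forall>c. \<Phi> (qclass I (scalar c)) = qclass J (scalar c))"

definition equivariant ::
    "'b hopf \<Rightarrow> ('b tfree \<Rightarrow> complex fps^'n^'n) \<Rightarrow> 'n::finite qmat set \<Rightarrow> 'n qmat set \<Rightarrow>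
     ('n qmat set \<Rightarrow> 'n qmat set) \<Rightarrow> bool" where
  "equivariant H \<rho> I J \<Phi> \<longleftrightarrow>
     (\<forall>h. \<forall>C\<in>carrier (qalg I). \<Phi> (qact H \<rho> I h C) = qact H \<rho> J h (\<Phi> C))"

definition pullback ::
    "(complex^'n^'n) set \<Rightarrow> (complex^'n^'n \<Rightarrow> complex^'n^'n) \<Rightarrow> (complex^'n^'n \<Rightarrow> complex) \<Rightarrow>
     complex^'n^'n \<Rightarrow> complex" where
  "pullback Z F f = (\<lambda>x\<in>Z. f (F x))"

text \<open>
  The map induced by \<open>\<Phi>\<close> modulo the parameter equals \<open>f\<close>, once both residue algebras are identified
  with the coordinate rings.
\<close>

definition quantizes_map ::
    "'n qmat set \<Rightarrow> (complex^'n^'n) set \<Rightarrow> 'n qmat set \<Rightarrow> (complex^'n^'n) set \<Rightarrow>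
     ((complex^'n^'n \<Rightarrow> complex) \<Rightarrow> complex^'n^'n \<Rightarrow> complex) \<Rightarrow> ('n qmat set \<Rightarrow> 'n qmat set) \<Rightarrow> bool" where
  "quantizes_map I Z J W f \<Phi> \<longleftrightarrow>
     algebra_hom I J \<Phi> \<and>
     (\<forall>C\<in>carrier (qalg I). residue_class J (\<Phi> C) =
        inv_into (carrier (qalg J Quot hbar_ideal J)) (residue_limit W)
          (f (residue_limit Z (residue_class I C))))"

end

theory Submission
  imports Defs
begin

text \<open>
  Since \<open>t = \<lambda>\<^sub>1 (q\<^sup>-\<^sup>2 - 1)\<close>, the matrix \<open>K = L - \<lambda>\<^sub>1\<close> satisfies the homogeneous reflection equation: it
  commutes with \<open>S K S\<close>.  The polynomial \<open>P(L)\<close> equals \<open>\<mu>\<^sub>1 - (\<mu>\<^sub>1 - \<mu>\<^sub>2) F\<close>, where \<open>F\<close> is a polynomial in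
  \<open>K\<close> without constant term and \<open>K F = K\<close>.  The Hecke relation writes \<open>S F S\<close> as \<open>a + b C S\<close> with
  \<open>C = K S K S\<close> and \<open>a\<close>, \<open>b\<close> commuting with \<open>K\<close>; as \<open>C\<close> commutes with \<open>S\<close> and \<open>C F = C\<close>, \<open>F\<close> again
  satisfies the homogeneous equation, so that \<open>P(L)\<close> satisfies the one with \<open>\<mu>\<^sub>1\<close>.  The trace condition
  reduces to the value of the quantum trace formula at exponent 0, a partial fraction identity.

  For equivariance the action is encoded by a coaction \<open>L \<mapsto> T\<^sup>-\<^sup>1 L T\<close>, where the entries of \<open>T\<close> are the
  matrix coefficients of the basic representation, which commute with those of \<open>L\<close>.  Conjugation by \<open>T\<close>
  commutes with evaluating polynomials and, by the relation \<open>S T\<^sub>1 T\<^sub>2 = T\<^sub>1 T\<^sub>2 S\<close>, preserves the defining ideals.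
\<close>

text \<open>The value of \<open>t\<close> shapes everything. It makes the linear term of the
  reflection equation \<open>lam 1\<close> times q - q^-1, which is the defect that a central shift
  by \<open>lam 1\<close> produces through the Hecke relation. It also turns every numerator of the
  trace formula into a difference with \<open>lam 1\<close>, so that the coefficient of the first
  eigenvalue sees only the size of its block and the sum of the other sizes, and survives merging
  the other blocks.

  The obstacle is that the relations hold only in quotients of free algebras. The checks on defining
  ideals are reduced to one criterion: a homomorphism maps such an ideal into a given ideal if and
  only if the image of the generating matrix satisfies the three families of relations modulo the
  latter. Substitution of \<open>P\<close>, coaction and evaluation at a classical point are all
  treated this way. For the coaction the coefficients are endomorphisms of the Hopf algebra, an
  honest ring in which matrix coefficients multiply by convolution; membership in the ideal with
  enlarged coefficients is tested by linear functionals.\<close>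

no_notation fps_nth (infixl \<open>$\<close> 75)
  \<comment> \<open>otherwise the overloading with vector components makes parsing exponential\<close>

section \<open>Reflection equation in rings\<close>

definition rhom :: "('a::ring_1 \<Rightarrow> 'b::ring_1) \<Rightarrow> bool" where
  "rhom f \<longleftrightarrow> f 1 = 1 \<and> (\<forall>x y. f (x + y) = f x + f y) \<and> (\<forall>x y. f (x * y) = f x * f y)"

lemma rhomI:
  assumes "f 1 = 1" "\<And>x y. f (x + y) = f x + f y" "\<And>x y. f (x * y) = f x * f y"
  shows "rhom f"
  using assms by (simp add: rhom_def)

lemma rhom_1: "rhom f \<Longrightarrow> f 1 = 1"
  and rhom_add: "rhom f \<Longrightarrow> f (x + y) = f x + f y"
  and rhom_mult: "rhom f \<Longrightarrow> f (x * y) = f x * f y"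
  by (auto simp: rhom_def)

lemma rhom_0: "rhom f \<Longrightarrow> f 0 = 0"
  using rhom_add[of f 0 0] by simp

lemma rhom_minus: "rhom f \<Longrightarrow> f (- x) = - f x"
  using rhom_add[of f x "- x"] rhom_0[of f] by (simp add: eq_neg_iff_add_eq_0 add.commute)

lemma rhom_diff: "rhom f \<Longrightarrow> f (x - y) = f x - f y"
  using rhom_add[of f x "- y"] rhom_minus[of f y] by simp

lemma rhom_sum: "rhom f \<Longrightarrow> f (sum g A) = (\<Sum>x\<in>A. f (g x))"
  by (induction A rule: infinite_finite_induct) (auto simp: rhom_0 rhom_add)

lemma rhom_power: "rhom f \<Longrightarrow> f (x ^ k) = f x ^ k"
  by (induction k) (auto simp: rhom_1 rhom_mult)

lemma rhom_prod_list: "rhom f \<Longrightarrow> f (prod_list xs) = prod_list (map f xs)"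
  by (induction xs) (auto simp: rhom_1 rhom_mult)

lemma rhom_comp: "rhom f \<Longrightarrow> rhom g \<Longrightarrow> rhom (\<lambda>x. f (g x))"
  by (simp add: rhom_def)

lemmas rhom_simps = rhom_0 rhom_1 rhom_add rhom_mult rhom_minus rhom_diff rhom_sum rhom_power

definition central :: "'a::ring_1 \<Rightarrow> bool" where
  "central z \<longleftrightarrow> (\<forall>x. z * x = x * z)"

lemma centralD: "central z \<Longrightarrow> z * x = x * z"
  by (simp add: central_def)

definition two_sided :: "'a::ring_1 set \<Rightarrow> bool" where
  "two_sided J \<longleftrightarrow> 0 \<in> J \<and> (\<forall>x\<in>J. \<forall>y\<in>J. x + y \<in> J) \<and> (\<forall>x\<in>J. \<forall>a. a * x \<in> J \<and> x * a \<in> J)"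

lemma two_sided_0: "two_sided J \<Longrightarrow> 0 \<in> J"
  and two_sided_add: "two_sided J \<Longrightarrow> x \<in> J \<Longrightarrow> y \<in> J \<Longrightarrow> x + y \<in> J"
  and two_sided_lmult: "two_sided J \<Longrightarrow> x \<in> J \<Longrightarrow> a * x \<in> J"
  and two_sided_rmult: "two_sided J \<Longrightarrow> x \<in> J \<Longrightarrow> x * a \<in> J"
  by (auto simp: two_sided_def)

lemma two_sided_minus: "two_sided J \<Longrightarrow> x \<in> J \<Longrightarrow> - x \<in> J"
  using two_sided_lmult[of J x "- 1"] by simp

lemma two_sided_diff: "two_sided J \<Longrightarrow> x \<in> J \<Longrightarrow> y \<in> J \<Longrightarrow> x - y \<in> J"
  using two_sided_add[of J x "- y"] two_sided_minus[of J y] by simp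

lemma two_sided_sum: "two_sided J \<Longrightarrow> (\<And>i. i \<in> A \<Longrightarrow> g i \<in> J) \<Longrightarrow> sum g A \<in> J"
  by (induction A rule: infinite_finite_induct) (auto simp: two_sided_0 two_sided_add)

definition icong :: "'a::ring_1 set \<Rightarrow> 'a \<Rightarrow> 'a \<Rightarrow> bool" where
  "icong J x y \<longleftrightarrow> x - y \<in> J"

lemma icong_refl: "two_sided J \<Longrightarrow> icong J x x"
  by (simp add: icong_def two_sided_0)

lemma icong_sym: "two_sided J \<Longrightarrow> icong J x y \<Longrightarrow> icong J y x"
  using two_sided_minus[of J "x - y"] by (simp add: icong_def)

lemma icong_trans: "two_sided J \<Longrightarrow> icong J x y \<Longrightarrow> icong J y z \<Longrightarrow> icong J x z"
  using two_sided_add[of J "x - y" "y - z"] by (simp add: icong_def)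

lemma icong_add: "two_sided J \<Longrightarrow> icong J x y \<Longrightarrow> icong J x' y' \<Longrightarrow> icong J (x + x') (y + y')"
  using two_sided_add[of J "x - y" "x' - y'"] by (simp add: icong_def algebra_simps)

lemma icong_diff: "two_sided J \<Longrightarrow> icong J x y \<Longrightarrow> icong J x' y' \<Longrightarrow> icong J (x - x') (y - y')"
  using two_sided_diff[of J "x - y" "x' - y'"] by (simp add: icong_def algebra_simps)

lemma icong_lmult: "two_sided J \<Longrightarrow> icong J x y \<Longrightarrow> icong J (a * x) (a * y)"
  using two_sided_lmult[of J "x - y" a] by (simp add: icong_def algebra_simps)

lemma icong_rmult: "two_sided J \<Longrightarrow> icong J x y \<Longrightarrow> icong J (x * a) (y * a)"
  using two_sided_rmult[of J "x - y" a] by (simp add: icong_def algebra_simps)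

section \<open>Evaluation of polynomials with central coefficients\<close>

definition ring_eval :: "('c::zero \<Rightarrow> 'a::semiring_1) \<Rightarrow> 'c poly \<Rightarrow> 'a \<Rightarrow> 'a" where
  "ring_eval \<iota> p x = (\<Sum>k\<le>Polynomial.degree p. \<iota> (Polynomial.coeff p k) * x ^ k)"

lemma ring_eval_bound:
  assumes "\<iota> 0 = 0" "Polynomial.degree p \<le> N"
  shows "ring_eval \<iota> p x = (\<Sum>k\<le>N. \<iota> (Polynomial.coeff p k) * x ^ k)"
  unfolding ring_eval_def
  by (rule sum.mono_neutral_left) (use assms in \<open>auto simp: coeff_eq_0\<close>)

lemma ring_eval_pCons:
  assumes "rhom \<iota>" "\<And>c. central (\<iota> c)"
  shows "ring_eval \<iota> (pCons a p) x = \<iota> a + x * ring_eval \<iota> p x"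
proof -
  have "ring_eval \<iota> (pCons a p) x =
      (\<Sum>k\<le>Suc (Polynomial.degree p). \<iota> (Polynomial.coeff (pCons a p) k) * x ^ k)"
    by (rule ring_eval_bound) (use assms in \<open>auto simp: rhom_0 degree_pCons_le\<close>)
  also have "\<dots> = \<iota> a + (\<Sum>k\<le>Polynomial.degree p. \<iota> (Polynomial.coeff p k) * x ^ Suc k)"
    by (subst sum.atMost_Suc_shift) simp
  also have "(\<Sum>k\<le>Polynomial.degree p. \<iota> (Polynomial.coeff p k) * x ^ Suc k) = x * ring_eval \<iota> p x"
    unfolding ring_eval_def sum_distrib_left
    by (intro sum.cong refl) (metis assms(2) central_def mult.assoc power_Suc)
  finally show ?thesis .
qed

lemma ring_eval_0: "rhom \<iota> \<Longrightarrow> ring_eval \<iota> 0 x = 0"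
  by (simp add: ring_eval_def rhom_0)

lemma ring_eval_add:
  assumes "rhom \<iota>"
  shows "ring_eval \<iota> (p + q) x = ring_eval \<iota> p x + ring_eval \<iota> q x"
proof -
  define N where "N = max (Polynomial.degree p) (Polynomial.degree q)"
  have b: "Polynomial.degree (p + q) \<le> N" "Polynomial.degree p \<le> N" "Polynomial.degree q \<le> N"
    by (auto simp: N_def degree_add_le_max)
  show ?thesis
    using assms by (simp add: ring_eval_bound[OF _ b(1)] ring_eval_bound[OF _ b(2)] ring_eval_bound[OF _ b(3)]
        rhom_simps distrib_right sum.distrib)
qed

lemma ring_eval_smult:
  assumes "rhom \<iota>"
  shows "ring_eval \<iota> (Polynomial.smult c p) x = \<iota> c * ring_eval \<iota> p x"
  using assms
  by (simp add: ring_eval_bound[OF _ degree_smult_le] rhom_simps)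
     (simp add: ring_eval_def sum_distrib_left mult.assoc)

lemma ring_eval_mult:
  assumes "rhom \<iota>" "\<And>c. central (\<iota> c)"
  shows "ring_eval \<iota> (p * q) x = ring_eval \<iota> p x * ring_eval \<iota> q x"
proof (induction p)
  case 0
  then show ?case using assms by (simp add: ring_eval_0)
next
  case (pCons a p)
  have "ring_eval \<iota> (pCons a p * q) x =
      ring_eval \<iota> (Polynomial.smult a q) x + ring_eval \<iota> (pCons 0 (p * q)) x"
    using assms by (simp add: ring_eval_add)
  then show ?case
    using assms pCons.IH by (simp add: ring_eval_smult ring_eval_pCons rhom_0 algebra_simps)
qed

lemma ring_eval_1: "rhom \<iota> \<Longrightarrow> ring_eval \<iota> 1 x = 1"
  by (simp add: ring_eval_def rhom_1)

lemma ring_eval_rhom: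
  assumes "rhom f"
  shows "f (ring_eval \<iota> p x) = ring_eval (\<lambda>c. f (\<iota> c)) p (f x)"
  using assms by (simp add: ring_eval_def rhom_simps)

text \<open>
  For a solution \<open>K\<close> of the reflection equation, \<open>K\<close> and \<open>Y = S K S\<close> commute and their product
  commutes with \<open>S\<close>.  The predicate describes \<open>S (K M) S\<close> up to terms commuting with \<open>K\<close>; it
  holds for all polynomials \<open>M\<close> in \<open>K\<close> and makes the reflection equation for \<open>K M\<close> a multiple
  of \<open>K Y (S K M - K M S)\<close>.
\<close>

definition re_poly :: "'a::ring_1 set \<Rightarrow> 'a \<Rightarrow> 'a \<Rightarrow> 'a \<Rightarrow> bool" where
  "re_poly J S K M \<longleftrightarrow> M * K = K * M \<and> (\<forall>u. icong J (u * K) (K * u) \<longrightarrow> icong J (u * M) (M * u)) \<and>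
     (\<exists>a b. icong J (a * K) (K * a) \<and> icong J (b * K) (K * b) \<and>
        icong J (S * (K * M) * S) (a + b * (K * (S * K * S)) * S))"

lemma re_polyD:
  assumes "re_poly J S K M"
  shows "M * K = K * M" "icong J (u * K) (K * u) \<Longrightarrow> icong J (u * M) (M * u)"
  using assms unfolding re_poly_def by blast+

lemma re_polyE:
  assumes "re_poly J S K M"
  obtains a b where "icong J (a * K) (K * a)" "icong J (b * K) (K * b)"
    "icong J (S * (K * M) * S) (a + b * (K * (S * K * S)) * S)"
  using assms unfolding re_poly_def by blast

context
  fixes J :: "'a::ring_1 set" and S K w :: 'a
  assumes J: "two_sided J" and w: "central w" and SS: "S * S = w * S + 1"
    and re: "icong J (K * (S * K * S)) (S * K * S * K)"
begin

lemma re_poly_1: "re_poly J S K 1"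
  unfolding re_poly_def
  \<comment> \<open>Here \<open>a = S K S\<close> and \<open>b = 0\<close>; that \<open>a\<close>
    commutes with \<open>K\<close> is the reflection equation itself.\<close>
  by (intro conjI allI impI exI[of _ "S * K * S"] exI[of _ 0])
     (use J re in \<open>simp_all add: icong_refl icong_sym\<close>)

lemma re_poly_add:
  assumes "re_poly J S K M" "re_poly J S K N"
  shows "re_poly J S K (M + N)"
proof -
  obtain a b where M: "icong J (a * K) (K * a)" "icong J (b * K) (K * b)"
     "icong J (S * (K * M) * S) (a + b * (K * (S * K * S)) * S)"
    by (rule re_polyE[OF assms(1)])
  obtain a' b' where N: "icong J (a' * K) (K * a')" "icong J (b' * K) (K * b')"
     "icong J (S * (K * N) * S) (a' + b' * (K * (S * K * S)) * S)"
    by (rule re_polyE[OF assms(2)])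
  show ?thesis
    unfolding re_poly_def
  proof (intro conjI exI allI impI)
    show "(M + N) * K = K * (M + N)"
      using re_polyD(1)[OF assms(1)] re_polyD(1)[OF assms(2)] by (simp add: algebra_simps)
    show "icong J (u * (M + N)) ((M + N) * u)" if "icong J (u * K) (K * u)" for u
      using icong_add[OF J re_polyD(2)[OF assms(1) that] re_polyD(2)[OF assms(2) that]]
      by (simp add: distrib_left distrib_right)
    show "icong J ((a + a') * K) (K * (a + a'))" "icong J ((b + b') * K) (K * (b + b'))"
      using M N icong_add[OF J] by (simp_all add: distrib_left distrib_right)
    show "icong J (S * (K * (M + N)) * S) (a + a' + (b + b') * (K * (S * K * S)) * S)"
      using icong_add[OF J M(3) N(3)] by (simp add: algebra_simps)
  qed
qed

lemma re_poly_central: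
  assumes "re_poly J S K M" "central z"
  shows "re_poly J S K (z * M)"
proof -
  obtain a b where M: "icong J (a * K) (K * a)" "icong J (b * K) (K * b)"
     "icong J (S * (K * M) * S) (a + b * (K * (S * K * S)) * S)"
    by (rule re_polyE[OF assms(1)])
  have z: "u * (z * v) = z * (u * v)" for u v
    using assms(2) by (metis central_def mult.assoc)
  have zl: "icong J (u * v) (v * u) \<Longrightarrow> icong J ((z * u) * v) (v * (z * u))" for u v
    using icong_lmult[OF J, of "u * v" "v * u" z] by (simp add: z mult.assoc)
  show ?thesis
    unfolding re_poly_def
  proof (intro conjI exI allI impI)
    show "z * M * K = K * (z * M)"
      using re_polyD(1)[OF assms(1)] by (simp add: z mult.assoc)
    show "icong J (u * (z * M)) (z * M * u)" if "icong J (u * K) (K * u)" for u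
      by (rule icong_sym[OF J zl[OF icong_sym[OF J re_polyD(2)[OF assms(1) that]]]])
    show "icong J ((z * a) * K) (K * (z * a))" "icong J ((z * b) * K) (K * (z * b))"
      using M by (auto intro: zl)
    show "icong J (S * (K * (z * M)) * S) (z * a + (z * b) * (K * (S * K * S)) * S)"
      using icong_lmult[OF J M(3), of z] by (simp add: z mult.assoc distrib_left)
  qed
qed

lemma icong_commute_mult:
  assumes "icong J (u * v) (v * u)" "icong J (u * v') (v' * u)"
  shows "icong J (u * (v * v')) (v * v' * u)"
  using icong_trans[OF J icong_rmult[OF J assms(1), of v'], of "v * v' * u"] icong_lmult[OF J assms(2), of v]
  by (simp add: mult.assoc)

text \<open>Write 1 as \<open>S S - w S\<close> between the two factors \<open>K\<close> of
  \<open>S K K M S\<close>. This splits off \<open>Y = S K S\<close> and gives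
  \<open>Y (S K M S) - w Y M K S\<close>. Inserting the known form of \<open>S K M S\<close> and
  moving \<open>Y\<close> past \<open>M\<close> and \<open>K\<close> yields the new pair
  \<open>Y a\<close> and \<open>Y b - w M\<close>.\<close>

lemma re_poly_mult:
  assumes "re_poly J S K M"
  shows "re_poly J S K (K * M)"
proof -
  define Y where "Y = S * K * S"
  obtain a b where M: "icong J (a * K) (K * a)" "icong J (b * K) (K * b)"
     "icong J (S * (K * M) * S) (a + b * (K * Y) * S)"
    unfolding Y_def by (rule re_polyE[OF assms(1)])
  have XY: "icong J (K * Y) (Y * K)"
    using re by (simp add: Y_def)
  have comm: "M * K = K * M" "\<And>u. icong J (u * K) (K * u) \<Longrightarrow> icong J (u * M) (M * u)"
    using re_polyD[OF assms] by auto
  note YM = comm(2)[OF icong_sym[OF J XY]]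
  have w': "u * (w * v) = w * (u * v)" for u v
    using w by (metis central_def mult.assoc)
  have commX: "icong J ((Y * u) * K) (K * (Y * u))" if "icong J (u * K) (K * u)" for u
    by (rule icong_sym[OF J icong_commute_mult[OF XY icong_sym[OF J that]]])
  show ?thesis
    unfolding re_poly_def Y_def[symmetric]
  proof (intro conjI exI allI impI)
    show "K * M * K = K * (K * M)" by (simp add: comm mult.assoc)
    show "icong J (u * (K * M)) (K * M * u)" if "icong J (u * K) (K * u)" for u
      by (rule icong_commute_mult[OF that comm(2)[OF that]])
    show "icong J (Y * a * K) (K * (Y * a))" by (rule commX[OF M(1)])
    show "icong J ((Y * b - w * M) * K) (K * (Y * b - w * M))"
      using icong_diff[OF J commX[OF M(2)] icong_refl[OF J, of "w * M * K"]]
      by (simp add: left_diff_distrib right_diff_distrib w' comm mult.assoc)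
    have "S * (K * (K * M)) * S = S * K * (S * S - w * S) * K * M * S"
      by (simp add: SS mult.assoc)
    also have "\<dots> = Y * (S * (K * M) * S) - w * (Y * M) * (K * S)"
      by (simp add: Y_def algebra_simps w') (metis comm(1) mult.assoc)
    finally have 1: "S * (K * (K * M)) * S = Y * (S * (K * M) * S) - w * (Y * M) * (K * S)" .
    have "icong J (Y * (S * (K * M) * S) - w * (Y * M) * (K * S))
        (Y * (a + b * (K * Y) * S) - w * (M * Y) * (K * S))"
      by (intro icong_diff[OF J] icong_lmult[OF J M(3)] icong_rmult[OF J] icong_lmult[OF J] YM)
    moreover have "icong J (Y * (a + b * (K * Y) * S) - w * (M * Y) * (K * S))
        (Y * (a + b * (K * Y) * S) - w * M * (K * Y) * S)"
      using icong_lmult[OF J icong_rmult[OF J icong_sym[OF J XY], of S], of "w * M"]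
      by (intro icong_diff[OF J] icong_refl[OF J]) (simp add: mult.assoc)
    ultimately have "icong J (S * (K * (K * M)) * S) (Y * (a + b * (K * Y) * S) - w * M * (K * Y) * S)"
      unfolding 1 by (rule icong_trans[OF J])
    then show "icong J (S * (K * (K * M)) * S) (Y * a + (Y * b - w * M) * (K * Y) * S)"
      by (simp add: algebra_simps)
  qed
qed

text \<open>Horner's scheme at \<open>K + a\<close>: the generating matrix is \<open>K\<close> plus
  a central element, and the polynomials are given in terms of that matrix.\<close>

lemma re_poly_ring_eval:
  assumes "rhom \<iota>" "\<And>c. central (\<iota> c)" and a: "central a"
  shows "re_poly J S K (ring_eval \<iota> p (K + a))"
proof (induction p)
  case 0
  show ?case using re_poly_central[OF re_poly_1, of 0] assms by (simp add: ring_eval_0 central_def)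
next
  case (pCons c p)
  have "\<iota> c + (K + a) * ring_eval \<iota> p (K + a) =
      \<iota> c * 1 + (K * ring_eval \<iota> p (K + a) + a * ring_eval \<iota> p (K + a))"
    by (simp add: algebra_simps)
  moreover have "re_poly J S K (\<iota> c * 1 + (K * ring_eval \<iota> p (K + a) + a * ring_eval \<iota> p (K + a)))"
    using pCons assms by (intro re_poly_add re_poly_mult re_poly_central re_poly_1) auto
  ultimately show ?case
    using assms by (simp add: ring_eval_pCons)
qed

text \<open>With \<open>F = K M\<close> and \<open>C = K S K S\<close>, the element
  \<open>S F S\<close> has the form \<open>a + b C S\<close>. As \<open>a\<close> and
  \<open>b C\<close> commute with \<open>K\<close>, they commute with \<open>F\<close>, so
  everything rests on \<open>C S F = C F S\<close>. The chain is
  \<open>C S F = S C F = S C = C S = C F S\<close>, where \<open>C F = C\<close> follows from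
  \<open>K F = K\<close>; all equalities are modulo \<open>J\<close>.\<close>

lemma reflection_of_re_poly:
  assumes M: "re_poly J S K M" and XF: "icong J (K * (K * M)) K"
  shows "icong J (S * (K * M) * S * (K * M)) (K * M * (S * (K * M) * S))"
proof -
  define Y where "Y = S * K * S"
  define F where "F = K * M"
  define C where "C = K * Y"
  note Y_F_C_def = Y_def F_def C_def
  obtain a b where ab: "icong J (a * K) (K * a)" "icong J (b * K) (K * b)"
     "icong J (S * F * S) (a + b * C * S)"
    unfolding Y_F_C_def by (rule re_polyE[OF M])
  have F: "icong J (u * F) (F * u)" if "icong J (u * K) (K * u)" for u
    unfolding Y_F_C_def by (rule icong_commute_mult[OF that re_polyD(2)[OF M that]])
  have XY: "icong J (K * Y) (Y * K)"
    using re by (simp add: Y_F_C_def)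
  have "icong J (Y * K * F) (Y * K)"
    using icong_lmult[OF J XF, of Y] by (simp add: Y_F_C_def mult.assoc)
  then have CF: "icong J (C * F) C"
    unfolding Y_F_C_def(3)
    by (rule icong_trans[OF J icong_rmult[OF J XY] icong_trans[OF J _ icong_sym[OF J XY]]])
  \<comment> \<open>\<open>S C = Y K S\<close> and \<open>C S = K Y S\<close>, so this is the
    reflection equation multiplied by \<open>S\<close>.\<close>
  have SC: "icong J (S * C) (C * S)"
  proof -
    have "icong J (Y * K * S) (K * Y * S)" by (rule icong_rmult[OF J icong_sym[OF J XY]])
    then show ?thesis by (simp add: Y_F_C_def mult.assoc)
  qed
  have "icong J (C * S * F) (S * C * F)" by (rule icong_rmult[OF J icong_sym[OF J SC]])
  moreover have "icong J (S * C * F) (S * C)" using icong_lmult[OF J CF, of S] by (simp add: mult.assoc)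
  ultimately have "icong J (C * S * F) (C * S)" by (rule icong_trans[OF J _ icong_trans[OF J _ SC]])
  moreover have "icong J (C * S) (C * F * S)" by (rule icong_sym[OF J icong_rmult[OF J CF]])
  ultimately have CSF: "icong J (C * S * F) (C * F * S)" by (rule icong_trans[OF J])
  have bC: "icong J (b * C * K) (K * (b * C))"
  proof -
    have "icong J (K * C) (C * K)" unfolding Y_F_C_def(3)
      by (rule icong_commute_mult[OF icong_refl[OF J] XY])
    then show ?thesis by (rule icong_sym[OF J icong_commute_mult[OF icong_sym[OF J ab(2)]]])
  qed
  have "icong J (S * F * S * F) ((a + b * C * S) * F)"
    by (rule icong_rmult[OF J ab(3)])
  also have "icong J ((a + b * C * S) * F) (a * F + b * C * F * S)"
    using icong_add[OF J icong_refl[OF J, of "a * F"] icong_lmult[OF J CSF, of b]]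
    by (simp add: distrib_right mult.assoc)
  also (icong_trans[OF J]) have "icong J (a * F + b * C * F * S) (F * (a + b * C * S))"
    using icong_add[OF J F[OF ab(1)] icong_rmult[OF J F[OF bC], of S]]
    by (simp add: distrib_left mult.assoc)
  also (icong_trans[OF J]) have "icong J (F * (a + b * C * S)) (F * (S * F * S))"
    by (rule icong_lmult[OF J icong_sym[OF J ab(3)]])
  finally (icong_trans[OF J]) show ?thesis
    unfolding Y_F_C_def(2) .
qed

end

text \<open>In the commutator of \<open>S M S\<close> with \<open>M\<close>, the terms linear in
  \<open>N\<close> are \<open>\<alpha> \<beta>\<close> times the commutator of \<open>S S\<close>
  with \<open>N\<close>. The Hecke relation turns them into \<open>\<alpha> w (S M - M S)\<close>,
  which is the subtracted linear term; what remains is quadratic in \<open>N\<close>.\<close>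

lemma reflection_affine:
  fixes S N w \<alpha> \<beta> :: "'a::ring_1"
  assumes "central w" "central \<alpha>" "central \<beta>" "S * S = w * S + 1"
  defines "M \<equiv> \<alpha> + \<beta> * N"
  shows "S * M * S * M - M * (S * M * S) - \<alpha> * w * (S * M - M * S) =
     \<beta> * \<beta> * (S * N * S * N - N * (S * N * S))"
proof -
  have c: "u * (w * v) = w * (u * v)" "u * (\<alpha> * v) = \<alpha> * (u * v)" "u * (\<beta> * v) = \<beta> * (u * v)"
     "u * w = w * u" "u * \<alpha> = \<alpha> * u" "u * \<beta> = \<beta> * u" for u v
    using assms(1-3) by (metis central_def mult.assoc)+
  have SS: "S * (S * u) = w * (S * u) + u" for u
    using assms(4) by (metis distrib_right mult.assoc mult_1)
  have N: "N * (\<alpha> * u) = \<alpha> * (N * u)" "N * (\<beta> * u) = \<beta> * (N * u)"  "N * (w * u) = w * (N * u)"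
     "S * (\<alpha> * u) = \<alpha> * (S * u)" "S * (\<beta> * u) = \<beta> * (S * u)"  "S * (w * u) = w * (S * u)"
     "\<beta> * (\<alpha> * u) = \<alpha> * (\<beta> * u)" "w * (\<alpha> * u) = \<alpha> * (w * u)" "w * (\<beta> * u) = \<beta> * (w * u)"
     "N * \<alpha> = \<alpha> * N" "N * \<beta> = \<beta> * N" "S * \<alpha> = \<alpha> * S" "S * \<beta> = \<beta> * S" "N * w = w * N" "S * w = w * S"
     "w * \<beta> = \<beta> * w" "\<beta> * \<alpha> = \<alpha> * \<beta>" "w * \<alpha> = \<alpha> * w"
    for u by (rule c)+
  show ?thesis
    unfolding M_def
    by (simp add: distrib_left distrib_right left_diff_distrib right_diff_distrib mult.assoc N SS assms(4))
qed

definition rdefect :: "'a::ring_1 \<Rightarrow> 'a \<Rightarrow> 'a \<Rightarrow> 'a" where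
  "rdefect S c x = S * x * S * x - x * (S * x * S) - c * (S * x - x * S)"

lemma rdefect_rhom: "rhom f \<Longrightarrow> f (rdefect S c x) = rdefect (f S) (f c) (f x)"
  by (simp add: rdefect_def rhom_simps)

text \<open>
  Modulo the ideal, the polynomial is \<open>m - (m - m') F\<close> with \<open>F\<close> an idempotent divisible by \<open>x - a\<close>.
\<close>

lemma rdefect_polynomial:
  fixes \<iota> :: "complex \<Rightarrow> 'a::ring_1" and j :: "'a \<Rightarrow> 'b::ring_1"
  assumes J: "two_sided J" and j: "rhom j" "\<And>z. z \<in> J0 \<Longrightarrow> j z \<in> J" and J0: "two_sided J0"
    and \<iota>: "rhom \<iota>" "\<And>c. central (\<iota> c)" "\<And>c. central (j (\<iota> c))"
    and S: "central w" "S * S = w * S + 1"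
    and x: "rdefect S (j (\<iota> a) * w) (j x) \<in> J"
    and ann: "ring_eval \<iota> ([:-a, 1:] * Q) x \<in> J0" "poly Q a = 1"
  shows "rdefect S (j (\<iota> m) * w) (j (ring_eval \<iota> (Polynomial.smult (m - m') Q + [:m':]) x)) \<in> J"
proof -
  have "poly (1 - Q) a = 0" using ann by simp
  \<comment> \<open>\<open>1 - Q\<close> evaluates to the idempotent \<open>F\<close>; the cofactor
    \<open>G\<close> gives the element \<open>M\<close> with \<open>F = K M\<close>.\<close>
  then obtain G where G: "1 - Q = [:-a, 1:] * G"
    using poly_eq_0_iff_dvd by (metis dvdE)
  define K where "K = j (x - \<iota> a)"
  define M where "M = j (ring_eval \<iota> G x)"
  have jx: "j x = j (\<iota> a) + 1 * K" "K + j (\<iota> a) = j x"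
    using j by (simp_all add: K_def rhom_simps)
  have lin: "ring_eval \<iota> [:-a, 1:] x = x - \<iota> a"
    using \<iota> by (simp add: ring_eval_pCons ring_eval_0 rhom_simps)
  have lin_mult: "ring_eval \<iota> ([:-a, 1:] * H) x = (x - \<iota> a) * ring_eval \<iota> H x" for H
    unfolding ring_eval_mult[OF \<iota>(1,2)] lin ..
  have c1: "central (1::'b)" by (simp add: central_def)
  have re: "icong J (K * (S * K * S)) (S * K * S * K)"
    using x reflection_affine[OF S(1) \<iota>(3)[of a] c1 S(2), of K] two_sided_minus[OF J]
    unfolding rdefect_def jx(1) icong_def
    by (metis minus_diff_eq mult_1)
  have "re_poly J S K (ring_eval (\<lambda>c. j (\<iota> c)) G (K + j (\<iota> a)))"
    using re_poly_ring_eval[OF J S re rhom_comp[OF j(1) \<iota>(1)] \<iota>(3) \<iota>(3)] .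
  then have M: "re_poly J S K M"
    unfolding M_def jx(2) using j(1) by (simp add: ring_eval_rhom)
  have F: "K * M = j (ring_eval \<iota> (1 - Q) x)"
    unfolding G K_def M_def lin_mult rhom_mult[OF j(1)] ..
  \<comment> \<open>\<open>K F\<close> differs from \<open>K\<close> by the image of
    \<open>(x - a) Q(x)\<close>, which lies in the ideal by assumption.\<close>
  have "K * (K * M) = j (ring_eval \<iota> ([:-a, 1:] * (1 - Q)) x)"
    unfolding F by (simp only: K_def lin_mult rhom_mult[OF j(1)])
  also have "[:-a, 1:] * (1 - Q) = [:-a, 1:] + Polynomial.smult (-1) ([:-a, 1:] * Q)"
    unfolding right_diff_distrib smult_minus_left smult_1_left by simp
  also have "j (ring_eval \<iota> \<dots> x) = K - j (ring_eval \<iota> ([:-a, 1:] * Q) x)"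
    unfolding ring_eval_add[OF \<iota>(1)] ring_eval_smult[OF \<iota>(1)] lin K_def
    using \<iota>(1) j(1) by (simp add: rhom_simps)
  finally have KKM: "K * (K * M) = K - j (ring_eval \<iota> ([:-a, 1:] * Q) x)" .
  have "icong J (K * (K * M)) K"
    unfolding KKM icong_def using two_sided_minus[OF J j(2)[OF ann(1)]] by simp
  from reflection_of_re_poly[OF J S re M this]
  have F': "S * (K * M) * S * (K * M) - K * M * (S * (K * M) * S) \<in> J"
    by (simp add: icong_def)
  have "Polynomial.smult (m - m') Q + [:m':] = [:m:] + Polynomial.smult (m' - m) (1 - Q)"
    by (simp add: algebra_simps smult_diff_left smult_diff_right)
  then have P: "j (ring_eval \<iota> (Polynomial.smult (m - m') Q + [:m':]) x) =
      j (\<iota> m) + j (\<iota> (m' - m)) * (K * M)"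
    unfolding F using \<iota> j(1)
    by (simp add: ring_eval_add ring_eval_smult rhom_simps ring_eval_pCons[OF \<iota>(1,2), of m 0] ring_eval_0)
  show ?thesis
    unfolding P rdefect_def
    by (subst reflection_affine[OF S(1) \<iota>(3) \<iota>(3) S(2)]) (intro two_sided_lmult[OF J] F')
qed

text \<open>\<open>P - m\<close> and \<open>P - m'\<close> are multiples of \<open>1 - Q\<close> and
  \<open>Q\<close>. Since \<open>1 - Q\<close> is divisible by \<open>x - a\<close>, their product
  is a multiple of \<open>(x - a) Q\<close>, whose value at \<open>x\<close> lies in the
  ideal.\<close>

lemma annihilated_polynomial:
  fixes \<iota> :: "complex \<Rightarrow> 'a::ring_1" and m m' :: complex
  assumes J0: "two_sided J0" and \<iota>: "rhom \<iota>" "\<And>c. central (\<iota> c)"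
    and ann: "ring_eval \<iota> ([:-a, 1:] * Q) x \<in> J0" "poly Q a = 1"
  defines "P \<equiv> Polynomial.smult (m - m') Q + [:m':]"
  shows "ring_eval \<iota> ([:-m, 1:] * [:-m', 1:]) (ring_eval \<iota> P x) \<in> J0"
proof -
  have "poly (1 - Q) a = 0" using ann by simp
  then obtain G where G: "1 - Q = [:-a, 1:] * G"
    using poly_eq_0_iff_dvd by (metis dvdE)
  have "ring_eval \<iota> ([:-m, 1:] * [:-m', 1:]) (ring_eval \<iota> P x) =
      (ring_eval \<iota> P x - \<iota> m) * (ring_eval \<iota> P x - \<iota> m')"
    unfolding ring_eval_mult[OF \<iota>(1,2)]
    using \<iota> by (simp add: ring_eval_pCons ring_eval_0 rhom_simps)
  also have "\<dots> = ring_eval \<iota> ((P + [:-m:]) * (P + [:-m':])) x"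
    unfolding ring_eval_mult[OF \<iota>(1,2)] ring_eval_add[OF \<iota>(1)]
    using \<iota> by (simp add: ring_eval_pCons ring_eval_0 rhom_simps)
  also have "(P + [:-m:]) * (P + [:-m':]) = Polynomial.smult (- ((m - m') * (m - m'))) G * ([:-a, 1:] * Q)"
  proof -
    have "P + [:-m:] = Polynomial.smult (- (m - m')) (1 - Q)"
      by (simp add: P_def algebra_simps smult_diff_left smult_diff_right)
    moreover have "P + [:-m':] = Polynomial.smult (m - m') Q" by (simp add: P_def)
    ultimately show ?thesis unfolding G by (simp only: mult_smult_left mult_smult_right smult_smult)
       (simp add: power2_eq_square algebra_simps)
  qed
  finally show ?thesis
    unfolding ring_eval_mult[OF \<iota>(1,2), of "Polynomial.smult _ G"]
    by (simp only:) (rule two_sided_lmult[OF J0 ann(1)])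
qed

section \<open>Rings of square matrices\<close>

text \<open>The product of the type of vectors of vectors is componentwise; this copy has the matrix product.\<close>

typedef ('a, 'n) sq = "UNIV :: ('a^'n^'n) set"
  morphisms mx sq by simp

setup_lifting type_definition_sq

instantiation sq :: (ring_1, finite) ring_1
begin

lift_definition zero_sq :: "('a, 'b) sq" is 0 .
lift_definition one_sq :: "('a, 'b) sq" is "mat 1" .
lift_definition plus_sq :: "('a, 'b) sq \<Rightarrow> ('a, 'b) sq \<Rightarrow> ('a, 'b) sq" is "(+)" .
lift_definition minus_sq :: "('a, 'b) sq \<Rightarrow> ('a, 'b) sq \<Rightarrow> ('a, 'b) sq" is "(-)" .
lift_definition uminus_sq :: "('a, 'b) sq \<Rightarrow> ('a, 'b) sq" is "uminus" .
lift_definition times_sq :: "('a, 'b) sq \<Rightarrow> ('a, 'b) sq \<Rightarrow> ('a, 'b) sq" is "(**)" .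

instance
proof
  fix a b c :: "('a, 'b) sq"
  show "a * b * c = a * (b * c)" by transfer (simp add: matrix_mul_assoc)
  show "1 * a = a" "a * 1 = a" by (transfer, simp)+
  show "(a + b) * c = a * c + b * c"
    by transfer (simp add: vec_eq_iff matrix_matrix_mult_def sum.distrib distrib_right)
  show "a * (b + c) = a * b + a * c" by transfer (simp add: matrix_add_ldistrib)
  show "(0::('a, 'b) sq) \<noteq> 1" by transfer (auto simp: vec_eq_iff mat_def)
qed (transfer; simp)+

end

lemmas mx_simps = zero_sq.rep_eq one_sq.rep_eq plus_sq.rep_eq minus_sq.rep_eq uminus_sq.rep_eq
  times_sq.rep_eq sq_inverse[OF UNIV_I] mx_inverse

lemma sq_eqI: "(\<And>i j. mx x $ i $ j = mx y $ i $ j) \<Longrightarrow> x = y"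
  by (metis mx_inject vec_eq_iff)

lemma mx_sum: "mx (sum f A) = (\<Sum>x\<in>A. mx (f x))"
  by (induction A rule: infinite_finite_induct) (auto simp: mx_simps)

lemma mx_power: "mx (x ^ k) = mpower (mx x) k"
  by (induction k) (auto simp: mx_simps)

lemma mx_times_nth: "mx (x * y) $ i $ j = (\<Sum>k\<in>UNIV. mx x $ i $ k * mx y $ k $ j)"
  by (simp add: mx_simps matrix_matrix_mult_def)

definition scal :: "'a::ring_1 \<Rightarrow> ('a, 'n::finite) sq" where
  "scal c = sq (mat c)"

lemma mx_scal_nth: "mx (scal c) $ i $ j = (if i = j then c else 0)"
  by (simp add: scal_def mx_simps mat_def)

lemma mx_scal_times_nth: "mx (scal c * x) $ i $ j = c * mx x $ i $ j"
  by (simp add: mx_times_nth mx_scal_nth if_distrib[of "\<lambda>a. a * _"] cong: if_cong)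

lemma mx_times_scal_nth: "mx (x * scal c) $ i $ j = mx x $ i $ j * c"
  by (simp add: mx_times_nth mx_scal_nth if_distrib[of "\<lambda>a. _ * a"] cong: if_cong)

lemma rhom_scal: "rhom scal"
  by (rule rhomI; rule sq_eqI) (auto simp: mx_simps(2,3) mx_scal_nth mx_scal_times_nth mat_def)

lemma central_scal: "central c \<Longrightarrow> central (scal c)"
  unfolding central_def by (auto intro!: sq_eqI simp: mx_scal_times_nth mx_times_scal_nth)

lemma mx_ring_eval: "mx (ring_eval (\<lambda>c. scal (\<iota> c)) p x) = mpoly_eval \<iota> p (mx x)"
  by (simp add: ring_eval_def mpoly_eval_def mx_sum mx_simps mx_power scal_def)

section \<open>Entrywise maps, the two tensor legs and ideals of matrices\<close>

definition smap :: "('a \<Rightarrow> 'b) \<Rightarrow> ('a, 'n::finite) sq \<Rightarrow> ('b, 'n) sq" where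
  "smap f x = sq (map_matrix f (mx x))"

lemma mx_smap_nth: "mx (smap f x) $ i $ j = f (mx x $ i $ j)"
  by (simp add: smap_def mx_simps)

lemma rhom_smap: "rhom f \<Longrightarrow> rhom (smap f)"
  by (rule rhomI; rule sq_eqI)
    (auto simp: mx_smap_nth mx_simps matrix_matrix_mult_def rhom_simps mat_def)

lemma smap_scal: "rhom f \<Longrightarrow> smap f (scal c) = scal (f c)"
  by (rule sq_eqI) (simp add: mx_smap_nth mx_scal_nth rhom_0)

definition lleg :: "('a::ring_1, 'n::finite) sq \<Rightarrow> ('a, 'n \<times> 'n) sq" where
  "lleg x = sq (mtens (mx x) (mat 1))"

definition rleg :: "('a::ring_1, 'n::finite) sq \<Rightarrow> ('a, 'n \<times> 'n) sq" where
  "rleg x = sq (mtens (mat 1) (mx x))"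

lemma mx_lleg_nth: "mx (lleg x) $ p $ q = (if snd p = snd q then mx x $ fst p $ fst q else 0)"
  by (simp add: lleg_def mx_simps mtens_def mat_def)

lemma mx_rleg_nth: "mx (rleg x) $ p $ q = (if fst p = fst q then mx x $ snd p $ snd q else 0)"
  by (simp add: rleg_def mx_simps mtens_def mat_def)

lemma sum_UNIV_prod: "(\<Sum>p\<in>UNIV. f p) = (\<Sum>a\<in>UNIV. \<Sum>b\<in>UNIV. f (a, b))"
  by (simp add: sum.cartesian_product flip: UNIV_Times_UNIV)

lemma lleg_times_nth:
  "mx (lleg x * y) $ p $ q = (\<Sum>a\<in>UNIV. mx x $ fst p $ a * mx y $ (a, snd p) $ q)"
  by (simp add: mx_times_nth sum_UNIV_prod mx_lleg_nth if_distrib[of "\<lambda>a. a * _"] cong: if_cong)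

lemma rleg_times_nth:
  "mx (rleg x * y) $ p $ q = (\<Sum>a\<in>UNIV. mx x $ snd p $ a * mx y $ (fst p, a) $ q)"
  by (subst mx_times_nth, subst sum_UNIV_prod, subst sum.swap)
     (simp add: mx_rleg_nth if_distrib[of "\<lambda>a. a * _"] cong: if_cong)

lemma times_lleg_nth:
  "mx (y * lleg x) $ p $ q = (\<Sum>a\<in>UNIV. mx y $ p $ (a, snd q) * mx x $ a $ fst q)"
  by (simp add: mx_times_nth sum_UNIV_prod mx_lleg_nth if_distrib[of "\<lambda>a. _ * a"] cong: if_cong)

lemma times_rleg_nth:
  "mx (y * rleg x) $ p $ q = (\<Sum>a\<in>UNIV. mx y $ p $ (fst q, a) * mx x $ a $ snd q)"
  by (subst mx_times_nth, subst sum_UNIV_prod, subst sum.swap)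
     (simp add: mx_rleg_nth if_distrib[of "\<lambda>a. _ * a"] cong: if_cong)

lemma rhom_lleg: "rhom lleg"
proof (rule rhomI; rule sq_eqI)
  show "mx (lleg (x * y)) $ p $ q = mx (lleg x * lleg y) $ p $ q" for x y p q
    unfolding lleg_times_nth by (simp add: mx_lleg_nth mx_times_nth)
qed (auto simp: mx_lleg_nth mx_simps(2,3) mat_def prod_eq_iff)

lemma rhom_rleg: "rhom rleg"
proof (rule rhomI; rule sq_eqI)
  show "mx (rleg (x * y)) $ p $ q = mx (rleg x * rleg y) $ p $ q" for x y p q
    unfolding rleg_times_nth by (simp add: mx_rleg_nth mx_times_nth)
qed (auto simp: mx_rleg_nth mx_simps(2,3) mat_def prod_eq_iff)

lemma rleg_scal: "rleg (scal c) = scal c"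
  by (rule sq_eqI) (auto simp: mx_rleg_nth mx_scal_nth prod_eq_iff)

lemma smap_rleg: "rhom f \<Longrightarrow> smap f (rleg x) = rleg (smap f x)"
  by (rule sq_eqI) (auto simp: mx_rleg_nth mx_smap_nth rhom_0)

lemma smap_lleg: "rhom f \<Longrightarrow> smap f (lleg x) = lleg (smap f x)"
  by (rule sq_eqI) (auto simp: mx_lleg_nth mx_smap_nth rhom_0)

lemma lleg_rleg_nth: "mx (lleg x * rleg y) $ p $ q = mx x $ fst p $ fst q * mx y $ snd p $ snd q"
  by (simp add: lleg_times_nth mx_rleg_nth if_distrib[of "\<lambda>a. _ * a"] cong: if_cong)

lemma rleg_lleg_nth: "mx (rleg y * lleg x) $ p $ q = mx y $ snd p $ snd q * mx x $ fst p $ fst q"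
  by (simp add: rleg_times_nth mx_lleg_nth if_distrib[of "\<lambda>a. _ * a"] cong: if_cong)

lemma lleg_rleg_commute:
  assumes "\<And>i j k l. mx x $ i $ j * mx y $ k $ l = mx y $ k $ l * mx x $ i $ j"
  shows "lleg x * rleg y = rleg y * lleg x"
  by (rule sq_eqI) (simp add: lleg_rleg_nth rleg_lleg_nth assms)

text \<open>Allows a whole matrix of relations to be treated as one congruence in the matrix
  ring.\<close>

definition mideal :: "'a set \<Rightarrow> ('a, 'n::finite) sq set" where
  "mideal I = {x. \<forall>i j. mx x $ i $ j \<in> I}"

lemma two_sided_mideal:
  assumes "two_sided I"
  shows "two_sided (mideal I)"
  unfolding two_sided_def[of "mideal I"]
  by (auto simp: mideal_def mx_simps(1,3) mx_times_nth two_sided_0[OF assms]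
      intro!: two_sided_add[OF assms] two_sided_sum[OF assms] intro: two_sided_lmult[OF assms] two_sided_rmult[OF assms])

lemma rleg_mideal: "two_sided I \<Longrightarrow> x \<in> mideal I \<Longrightarrow> rleg x \<in> mideal I"
  by (simp add: mideal_def mx_rleg_nth two_sided_0)

section \<open>Quantum traces of the orbits\<close>

text \<open>Lagrange interpolation. The monic polynomials with roots \<open>u j * k j\<close> and
  with roots \<open>k j\<close> differ by a polynomial of degree below the number of nodes, so the
  difference equals its interpolation at the nodes \<open>k i\<close>. Evaluating at 0 and
  cancelling the product of all \<open>- k j\<close> gives the identity.\<close>

lemma lagrange_partial_fractions:
  fixes \<kappa> :: "'i \<Rightarrow> complex" and u :: "'i \<Rightarrow> complex fps"
  assumes A: "finite A" "A \<noteq> {}" "inj_on \<kappa> A" "\<And>i. i \<in> A \<Longrightarrow> \<kappa> i \<noteq> 0"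
  shows "(\<Sum>i\<in>A. (1 - u i) * (\<Prod>j\<in>A - {i}. (fps_const (\<kappa> i) - u j * fps_const (\<kappa> j)) *
      fps_const (1 / (\<kappa> i - \<kappa> j)))) = 1 - (\<Prod>j\<in>A. u j)"
proof -
  define k where "k i = fps_const (\<kappa> i)" for i
  define m where "m = card A"
  have m: "m > 0" using A by (simp add: m_def card_gt_0_iff)
  have kA: "inj_on k A" using A(3) by (auto simp: inj_on_def k_def)
  define c where "c i = (1 - u i) * (\<Prod>j\<in>A - {i}. (k i - u j * k j) * fps_const (1 / (\<kappa> i - \<kappa> j)))" for i
  define P1 where "P1 = (\<Prod>j\<in>A. [:- (u j * k j), 1:])"
  define P2 where "P2 = (\<Prod>j\<in>A. [:- k j, 1:])"
  define E where "E i = (\<Prod>j\<in>A - {i}. [:- k j, 1:])" for i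
  \<comment> \<open>\<open>P2\<close> vanishes at \<open>k i\<close>, while \<open>P1\<close> takes
    there the value \<open>k i (1 - u i)\<close> times the product of the remaining factors; this
    accounts for the weight \<open>c i * k i\<close>.\<close>
  define L where "L = (\<Sum>i\<in>A. Polynomial.smult (c i * k i) (E i))"
  have deg: "Polynomial.degree P1 = m" "Polynomial.degree P2 = m"
    by (simp_all add: P1_def P2_def m_def degree_prod_sum_eq)
  have lc: "Polynomial.coeff P1 (Polynomial.degree P1) = 1"
     "Polynomial.coeff P2 (Polynomial.degree P2) = 1"
    by (simp_all add: P1_def P2_def lead_coeff_prod)
  have "Polynomial.coeff (P1 - P2) m = 0" using lc deg by simp
  moreover have "Polynomial.degree (P1 - P2) \<le> m"
    using deg by (intro degree_diff_le) auto
  ultimately have d12: "Polynomial.degree (P1 - P2) < card (k ` A)"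
    using eq_zero_or_degree_less[of "P1 - P2" m] m card_image[OF kA] by (auto simp: m_def)
  have "Polynomial.degree (Polynomial.smult (c i * k i) (E i)) \<le> m - 1" if "i \<in> A" for i
  proof -
    have "Polynomial.degree (E i) = m - 1" using that A(1)
      by (simp add: E_def m_def degree_prod_sum_eq)
    then show ?thesis using degree_smult_le[of "c i * k i" "E i"] by simp
  qed
  then have "Polynomial.degree L \<le> m - 1"
    unfolding L_def using A(1) by (intro degree_sum_le) auto
  then have dL: "Polynomial.degree L < card (k ` A)"
    using m card_image[OF kA] by (simp add: m_def)
  have "P1 - P2 = L"
  proof (rule poly_eqI_degree[OF _ d12 dL])
    fix x assume "x \<in> k ` A"
    then obtain i where i: "i \<in> A" "x = k i" by auto
    have "poly P2 x = 0" using i A(1) by (auto simp: P2_def poly_prod)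
    moreover have "poly P1 x = (k i - u i * k i) * (\<Prod>j\<in>A - {i}. k i - u j * k j)"
      using i A(1) by (simp add: P1_def poly_prod prod.remove[of A i] left_diff_distrib)
    moreover have "poly L x = c i * k i * poly (E i) x"
    proof -
      have "poly L x = (\<Sum>i'\<in>A. c i' * k i' * poly (E i') x)"
        by (simp add: L_def poly_sum)
      also have "\<dots> = (\<Sum>i'\<in>{i}. c i' * k i' * poly (E i') x)"
        using i A(1) by (intro sum.mono_neutral_right) (auto simp: E_def poly_prod)
      finally show ?thesis by simp
    qed
    moreover have "c i * poly (E i) x = (1 - u i) * (\<Prod>j\<in>A - {i}. k i - u j * k j)"
    proof -
      have "(k i - u j * k j) * fps_const (1 / (\<kappa> i - \<kappa> j)) * (k i - k j) = k i - u j * k j"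
        if "j \<in> A - {i}" for j
      proof -
        have "\<kappa> i \<noteq> \<kappa> j" using that i A(3) by (auto simp: inj_on_def)
        then have "fps_const (1 / (\<kappa> i - \<kappa> j)) * (k i - k j) = 1"
          by (simp add: k_def flip: fps_const_sub)
        then show ?thesis by (simp add: mult.assoc)
      qed
      then have "(\<Prod>j\<in>A - {i}. (k i - u j * k j) * fps_const (1 / (\<kappa> i - \<kappa> j)) * (k i - k j)) =
          (\<Prod>j\<in>A - {i}. k i - u j * k j)"
        by (intro prod.cong refl)
      then show ?thesis
        by (simp only: c_def E_def poly_prod i prod.distrib mult.assoc) (simp add: mult.assoc)
    qed
    moreover have "(k i - u i * k i) * z = k i * ((1 - u i) * z)" "c i * k i * z = k i * (c i * z)" for z
      by (simp_all add: algebra_simps)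
    ultimately show "poly (P1 - P2) x = poly L x"
      by simp
  qed
  then have "poly (P1 - P2) 0 = poly L 0" by simp
  then have "(\<Prod>j\<in>A. - (u j * k j)) - (\<Prod>j\<in>A. - k j) = (\<Sum>i\<in>A. c i * (k i * (\<Prod>j\<in>A - {i}. - k j)))"
    by (simp add: P1_def P2_def L_def E_def poly_prod poly_sum mult.assoc)
  also have "\<dots> = (\<Sum>i\<in>A. - c i * (\<Prod>j\<in>A. - k j))"
    using A(1) by (intro sum.cong refl) (simp add: prod.remove)
  also have "\<dots> = - (\<Sum>i\<in>A. c i) * (\<Prod>j\<in>A. - k j)"
    by (simp add: sum_distrib_right sum_negf)
  also have "(\<Prod>j\<in>A. - (u j * k j)) = (\<Prod>j\<in>A. u j) * (\<Prod>j\<in>A. - k j)"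
    by (simp flip: prod.distrib)
  finally have "(\<Prod>j\<in>A. - k j) * (\<Sum>i\<in>A. c i) = (\<Prod>j\<in>A. - k j) * (1 - (\<Prod>j\<in>A. u j))"
    by (simp add: algebra_simps)
  moreover have "(\<Prod>j\<in>A. - k j) \<noteq> 0" using A by (simp add: k_def)
  ultimately show ?thesis by (simp add: c_def k_def)
qed

section \<open>Quantum integers and the coefficients of the trace formula\<close>

abbreviation "qinv2 \<equiv> (fps_exp (-2) :: complex fps)"

lemma inverse_qpar_sq: "inverse qpar ^ 2 = qinv2"
  by (simp add: qpar_def fps_exp_neg[symmetric] fps_exp_power_mult)

lemma inverse_qpar_pow: "inverse qpar ^ (2 * m) = qinv2 ^ m"
  by (simp add: power_mult inverse_qpar_sq)

lemma omega_alt: "omega = 1 - qinv2"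
  by (simp add: omega_def inverse_qpar_sq)

lemma omega_nz: "omega \<noteq> 0"
proof
  assume "omega = 0"
  then have "fps_nth qinv2 1 = fps_nth 1 1" by (simp add: omega_alt)
  then show False by simp
qed

lemma qint_alt: "qint m = (\<Sum>j<m. qinv2 ^ j)"
proof -
  have "qint m = (1 - qinv2 ^ m) / omega" by (simp add: qint_def inverse_qpar_pow omega_alt inverse_qpar_sq)
  also have "1 - qinv2 ^ m = omega * (\<Sum>j<m. qinv2 ^ j)" by (simp add: omega_alt one_diff_power_eq)
  finally show ?thesis using omega_nz by simp
qed

lemma omega_qint: "omega * qint m = 1 - qinv2 ^ m"
  by (simp add: qint_alt omega_alt one_diff_power_eq)

lemma qint_nth_0: "fps_nth (qint m) 0 = of_nat m"
  by (simp add: qint_alt fps_sum_nth fps_power_zeroth)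

text \<open>The quantum multiplicity of the i-th eigenvalue: \<open>qtrace_value\<close> is the sum
  of the k-th powers of the eigenvalues with these weights. When \<open>t\<close> vanishes modulo
  the parameter, the constant term of the weight is the ordinary multiplicity
  \<open>m i\<close>.\<close>

definition qcoef :: "complex fps \<Rightarrow> nat \<Rightarrow> (nat \<Rightarrow> complex) \<Rightarrow> (nat \<Rightarrow> nat) \<Rightarrow> nat \<Rightarrow> complex fps" where
  "qcoef t l ev m i = qint (m i) *
     (\<Prod>j\<in>{1..l} - {i}. 1 + qint (m j) * (omega * fps_const (ev j) + t) / fps_const (ev i - ev j))"

lemma qtrace_value_qcoef:
  "qtrace_value t l ev blk k = (\<Sum>i\<in>{1..l}. fps_const (ev i ^ k) * qcoef t l ev (blocksize blk) i)"
  by (simp add: qtrace_value_def qcoef_def mult.assoc)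

context
  fixes l :: nat and ev :: "nat \<Rightarrow> complex" and m :: "nat \<Rightarrow> nat" and t :: "complex fps"
  assumes l: "2 \<le> l" and inj: "inj_on ev {1..l}" and t: "t = fps_const (ev 1) * (fps_exp (-2) - 1)"
begin

lemma ev_neq: "i \<in> {1..l} \<Longrightarrow> j \<in> {1..l} \<Longrightarrow> i \<noteq> j \<Longrightarrow> ev i - ev j \<noteq> 0"
  using inj by (auto dest: inj_onD)

text \<open>Since \<open>t = - omega * ev 1\<close>, the bracket \<open>omega * ev j + t\<close> is
  \<open>omega * (ev j - ev 1)\<close>, and \<open>omega * qint (m j)\<close> is 1 - q^(-2 m
  j).\<close>

lemma qcoef_factor:
  assumes "i \<in> {1..l}" "j \<in> {1..l} - {i}"
  shows "1 + qint (m j) * (omega * fps_const (ev j) + t) / fps_const (ev i - ev j) =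
     (fps_const (ev i - ev 1) - qinv2 ^ m j * fps_const (ev j - ev 1)) * fps_const (1 / (ev i - ev j))"
proof -
  have ne: "ev i - ev j \<noteq> 0" using assms by (intro ev_neq) auto
  define a where "a = fps_const (ev j - ev 1)"
  define b where "b = fps_const (ev i - ev j)"
  define v where "v = fps_const (1 / (ev i - ev j))"
  have a: "fps_const (ev j) = a + fps_const (ev 1)" "fps_const (ev i - ev 1) = a + b"
    by (simp_all add: a_def b_def)
  have "omega * fps_const (ev j) + t = omega * a"
    unfolding t omega_alt a by (simp add: algebra_simps)
  then have "qint (m j) * (omega * fps_const (ev j) + t) = (1 - qinv2 ^ m j) * a"
    by (simp only: omega_qint[symmetric] mult_ac)
  moreover have "x / b = x * v" for x :: "complex fps"
    by (simp add: b_def v_def inverse_eq_divide)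
  moreover have "b * v = 1" using ne by (simp add: b_def v_def)
  then have "1 + (1 - qinv2 ^ m j) * a * v = (a + b - qinv2 ^ m j * a) * v"
    by (simp add: algebra_simps)
  ultimately show ?thesis
    by (simp only: a(2) a_def[symmetric] b_def[symmetric] v_def[symmetric])
qed

lemma qcoef_alt:
  assumes "i \<in> {1..l}"
  shows "qcoef t l ev m i = qint (m i) * (\<Prod>j\<in>{1..l} - {i}.
     (fps_const (ev i - ev 1) - qinv2 ^ m j * fps_const (ev j - ev 1)) * fps_const (1 / (ev i - ev j)))"
  unfolding qcoef_def using qcoef_factor[OF assms]
  by (intro arg_cong2[of _ _ _ _ "(*)"] prod.cong refl)

text \<open>For \<open>i = 1\<close> the first term of every numerator vanishes and the j-th factor
  collapses to q^(-2 m j). Only the total of the other multiplicities survives, which makes this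
  coefficient insensitive to merging the other blocks.\<close>

lemma qcoef_1: "qcoef t l ev m 1 = qint (m 1) * qinv2 ^ (\<Sum>j\<in>{2..l}. m j)"
proof -
  have "(fps_const (ev 1 - ev 1) - qinv2 ^ m j * fps_const (ev j - ev 1)) * fps_const (1 / (ev 1 - ev j)) = qinv2 ^ m j"
    if "j \<in> {2..l}" for j
  proof -
    have "ev 1 - ev j \<noteq> 0" using that l by (intro ev_neq) auto
    then have "fps_const (ev 1 - ev j) * fps_const (1 / (ev 1 - ev j)) = 1" by simp
    moreover have "fps_const (ev j - ev 1) = - fps_const (ev 1 - ev j)" by simp
    ultimately show ?thesis
      by (simp only: diff_self fps_const_0_eq_0) (simp only: mult.assoc minus_mult_left[symmetric]
          minus_mult_right[symmetric] diff_0 minus_minus mult_1_right)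
  qed
  moreover have "{1..l} - {1} = {2..l}" by auto
  ultimately show ?thesis using l by (simp add: qcoef_alt power_sum)
qed

text \<open>The trace formula at exponent 0. For \<open>i\<close> at least 2 the factor with
  \<open>j = 1\<close> equals 1, so these coefficients times \<open>omega\<close> are the terms of
  the partial fraction identity with nodes \<open>ev i - ev 1\<close> and \<open>u j\<close> equal
  to q^(-2 m j).\<close>

lemma sum_qcoef: "(\<Sum>i\<in>{1..l}. qcoef t l ev m i) = qint (\<Sum>i\<in>{1..l}. m i)"
proof -
  define \<kappa> where "\<kappa> i = ev i - ev 1" for i
  have \<kappa>: "inj_on \<kappa> {2..l}" "\<And>i. i \<in> {2..l} \<Longrightarrow> \<kappa> i \<noteq> 0"
  proof -
    have "inj_on ev {2..l}" using inj by (rule inj_on_subset) auto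
    then show "inj_on \<kappa> {2..l}" unfolding inj_on_def \<kappa>_def by simp
    show "\<kappa> i \<noteq> 0" if "i \<in> {2..l}" for i
      unfolding \<kappa>_def using that l by (intro ev_neq) auto
  qed
  have un: "{1..l} = insert 1 {2..l}" using l by auto
  have sp: "prod f ({1..l} - {i}) = f 1 * prod f ({2..l} - {i})" if "i \<in> {2..l}" for i and f :: "nat \<Rightarrow> complex fps"
  proof -
    have "{1..l} - {i} = insert 1 ({2..l} - {i})" using that l by auto
    then show ?thesis by simp
  qed
  have "omega * qcoef t l ev m i = (1 - qinv2 ^ m i) * (\<Prod>j\<in>{2..l} - {i}.
      (fps_const (\<kappa> i) - qinv2 ^ m j * fps_const (\<kappa> j)) * fps_const (1 / (\<kappa> i - \<kappa> j)))"
    if i: "i \<in> {2..l}" for i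
  proof -
    have "ev i - ev 1 \<noteq> 0" using i l by (intro ev_neq) auto
    then have "omega * qcoef t l ev m i = (omega * qint (m i)) * (\<Prod>j\<in>{2..l} - {i}.
        (fps_const (\<kappa> i) - qinv2 ^ m j * fps_const (\<kappa> j)) * fps_const (1 / (\<kappa> i - \<kappa> j)))"
      using i unfolding \<kappa>_def by (subst qcoef_alt, simp, subst sp[OF i]) (simp add: mult.assoc)
    then show ?thesis by (simp only: omega_qint)
  qed
  then have "(\<Sum>i\<in>{2..l}. omega * qcoef t l ev m i) = (\<Sum>i\<in>{2..l}. (1 - qinv2 ^ m i) * (\<Prod>j\<in>{2..l} - {i}.
      (fps_const (\<kappa> i) - qinv2 ^ m j * fps_const (\<kappa> j)) * fps_const (1 / (\<kappa> i - \<kappa> j))))"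
    by (intro sum.cong) auto
  also have "\<dots> = 1 - (\<Prod>j\<in>{2..l}. qinv2 ^ m j)"
    using lagrange_partial_fractions[OF _ _ \<kappa>, of "\<lambda>j. qinv2 ^ m j"] l by simp
  finally have "omega * (\<Sum>i\<in>{2..l}. qcoef t l ev m i) = 1 - qinv2 ^ (\<Sum>j\<in>{2..l}. m j)"
    by (simp add: sum_distrib_left power_sum)
  moreover have "omega * qcoef t l ev m 1 = (1 - qinv2 ^ m 1) * qinv2 ^ (\<Sum>j\<in>{2..l}. m j)"
    by (simp only: qcoef_1 omega_qint[symmetric] mult_ac)
  \<comment> \<open>Used with \<open>u\<close> equal to q^(-2 m 1) and \<open>v\<close> equal to
    q^-2 to the power \<open>m 2 + ... + m l\<close>: the first summand is the term
    \<open>i = 1\<close>, the second the sum of all others.\<close>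
  moreover have "(1 - u) * v + (1 - v) = 1 - u * v" for u v :: "complex fps"
    by (simp add: algebra_simps)
  ultimately have "omega * (\<Sum>i\<in>{1..l}. qcoef t l ev m i) = omega * qint (\<Sum>i\<in>{1..l}. m i)"
    unfolding un by (simp add: omega_qint distrib_left power_add)
  then show ?thesis using omega_nz by simp
qed

end

lemma sum_blocksize:
  fixes blk :: "'n::finite \<Rightarrow> nat"
  assumes "range blk = A"
  shows "(\<Sum>i\<in>A. blocksize blk i) = CARD('n)"
proof -
  have "finite A" using assms by auto
  have "CARD('n) = card (\<Union>i\<in>A. {a. blk a = i})"
    using assms by (intro arg_cong[of _ _ card]) auto
  also have "\<dots> = (\<Sum>i\<in>A. blocksize blk i)"
    unfolding blocksize_def using \<open>finite A\<close> by (intro card_UN_disjoint) auto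
  finally show ?thesis by simp
qed

section \<open>Free algebras\<close>

lemma free_algebra_decomp: "(p :: ('x, 'k::ring_1) free_algebra) = (\<Sum>w\<in>Poly_Mapping.keys p. Poly_Mapping.single w (Poly_Mapping.lookup p w))"
  by (rule poly_mapping_eqI) (simp add: lookup_sum lookup_single when_def not_in_keys_iff_lookup_eq_zero)

lemma free_algebra_induct [case_names single add]:
  fixes p :: "('x, 'k::ring_1) free_algebra"
  assumes "\<And>w c. Q (Poly_Mapping.single w c)" "\<And>p q. Q p \<Longrightarrow> Q q \<Longrightarrow> Q (p + q)"
  shows "Q p"
proof -
  have "Q (\<Sum>w\<in>A. Poly_Mapping.single w (Poly_Mapping.lookup p w))" for A
    using assms(1)[of "[]" 0] by (induction A rule: infinite_finite_induct) (auto intro: assms)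
  then show ?thesis using free_algebra_decomp[of p] by metis
qed

lemma list_plus: "(u :: 'x list) + v = u @ v"
  by (simp add: plus_list_def)

lemma scalar_1: "scalar 1 = (1 :: ('x, 'k::ring_1) free_algebra)"
  using single_one[where 'a = "'x list" and 'b = 'k] by (simp add: zero_list_def)

lemma scalar_times_single: "scalar c * Poly_Mapping.single w d = Poly_Mapping.single w (c * d)"
  by (simp add: mult_single list_plus)

lemma rhom_scalar: "rhom (scalar :: 'k::ring_1 \<Rightarrow> ('x, 'k) free_algebra)"
  by (rule rhomI) (simp_all add: scalar_1 single_add scalar_times_single)

lemma central_scalar:
  assumes "central c"
  shows "central (scalar c :: ('x, 'k::ring_1) free_algebra)"
  unfolding central_def
proof
  fix p :: "('x, 'k) free_algebra"
  show "scalar c * p = p * scalar c"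
    by (induction p rule: free_algebra_induct)
       (use assms in \<open>simp_all add: mult_single list_plus central_def algebra_simps\<close>)
qed

lemma central_comm: "central (c :: 'a::comm_ring_1)"
  by (simp add: central_def mult.commute)

lemma single_gens:
  "Poly_Mapping.single w c = scalar c * prod_list (map (gen :: 'x \<Rightarrow> ('x, 'k::ring_1) free_algebra) w)"
proof -
  have "prod_list (map (gen :: 'x \<Rightarrow> ('x, 'k) free_algebra) w) = Poly_Mapping.single w 1"
    by (induction w) (simp_all add: scalar_1 mult_single list_plus)
  then show ?thesis by (simp add: scalar_times_single)
qed

definition fhom :: "('k::ring_1 \<Rightarrow> 'b::ring_1) \<Rightarrow> ('x \<Rightarrow> 'b) \<Rightarrow> ('x, 'k) free_algebra \<Rightarrow> 'b" where
  "fhom \<iota> g p = (\<Sum>w\<in>Poly_Mapping.keys p. \<iota> (Poly_Mapping.lookup p w) * prod_list (map g w))"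

lemma fhom_superset:
  assumes "rhom \<iota>" "finite A" "Poly_Mapping.keys p \<subseteq> A"
  shows "fhom \<iota> g p = (\<Sum>w\<in>A. \<iota> (Poly_Mapping.lookup p w) * prod_list (map g w))"
  unfolding fhom_def using assms
  by (intro sum.mono_neutral_left) (auto simp: rhom_0 not_in_keys_iff_lookup_eq_zero)

lemma fhom_single: "rhom \<iota> \<Longrightarrow> fhom \<iota> g (Poly_Mapping.single w c) = \<iota> c * prod_list (map g w)"
  by (subst fhom_superset[of _ "{w}"]) auto

lemma fhom_add:
  assumes "rhom \<iota>"
  shows "fhom \<iota> g (p + q) = fhom \<iota> g p + fhom \<iota> g q"
  using assms keys_add[of p q]
  by (simp add: fhom_superset[of _ "Poly_Mapping.keys p \<union> Poly_Mapping.keys q"] lookup_add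
      rhom_add distrib_right sum.distrib)

text \<open>Commutation is required only between the images of scalars and of generators. The images
  of scalars need not be central, which matters for \<open>poly_subst_ext\<close>, where the
  coefficients are endomorphisms.\<close>

lemma rhom_fhom_commute:
  assumes \<iota>: "rhom \<iota>" and comm: "\<And>c x. \<iota> c * g x = g x * \<iota> c"
  shows "rhom (fhom \<iota> g)"
proof (rule rhomI)
  have comm': "\<iota> c * prod_list (map g u) = prod_list (map g u) * \<iota> c" for c u
    by (induction u) (use comm in \<open>simp_all, metis mult.assoc\<close>)
  show "fhom \<iota> g 1 = 1"
    using fhom_single[OF \<iota>, of g "[]" 1] \<iota> by (simp add: scalar_1 rhom_1)
  show add: "fhom \<iota> g (p + q) = fhom \<iota> g p + fhom \<iota> g q" for p q
    by (rule fhom_add[OF \<iota>])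
  show "fhom \<iota> g (p * q) = fhom \<iota> g p * fhom \<iota> g q" for p q
  proof (induction p rule: free_algebra_induct)
    case (single u c)
    show ?case
    proof (induction q rule: free_algebra_induct)
      case (single v d)
      have "\<iota> c * (\<iota> d * (prod_list (map g u) * y)) = \<iota> c * (prod_list (map g u) * (\<iota> d * y))" for y
        using comm'[of d u] by (metis mult.assoc)
      then show ?case
        using \<iota> by (simp add: mult_single list_plus fhom_single rhom_mult mult.assoc)
    qed (simp add: distrib_left add)
  qed (simp add: distrib_right add)
qed

lemma rhom_fhom: "rhom \<iota> \<Longrightarrow> (\<And>c. central (\<iota> c)) \<Longrightarrow> rhom (fhom \<iota> g)"
  by (rule rhom_fhom_commute) (auto simp: central_def)

lemma fhom_scalar: "rhom \<iota> \<Longrightarrow> fhom \<iota> g (scalar c) = \<iota> c"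
  by (simp add: fhom_single)

lemma fhom_gen: "rhom \<iota> \<Longrightarrow> fhom \<iota> g (gen x) = g x"
  by (simp add: fhom_single rhom_1)

lemma rhom_free_eq:
  assumes "rhom f" "rhom f'" "\<And>c. f (scalar c) = f' (scalar c)" "\<And>x. f (gen x) = f' (gen x)"
  shows "f p = f' p"
proof (induction p rule: free_algebra_induct)
  case (single w c)
  then show ?case
    using assms by (simp add: single_gens[of w] rhom_mult rhom_prod_list comp_def)
qed (simp add: assms rhom_add)

subsection \<open>Cosets of two-sided ideals\<close>

abbreviation typering :: "'a::ring_1 ring" where "typering \<equiv> ring_of_type_algebra"

lemma rta_simps: "carrier typering = UNIV" "x \<otimes>\<^bsub>typering\<^esub> y = x * y" "x \<oplus>\<^bsub>typering\<^esub> y = x + y"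
  "\<one>\<^bsub>typering\<^esub> = 1" "\<zero>\<^bsub>typering\<^esub> = 0"
  by (simp_all add: ring_of_type_algebra_def)

lemma ring_rta: "ring (typering :: 'a::ring_1 ring)"
proof -
  have "\<exists>y. y + x = 0 \<and> x + y = 0" for x :: 'a by (rule exI[of _ "- x"]) simp
  then show ?thesis
    unfolding ring_of_type_algebra_def
    by unfold_locales (auto simp: algebra_simps Units_def)
qed

lemma a_inv_rta: "\<ominus>\<^bsub>typering\<^esub> x = - (x :: 'a::ring_1)"
proof -
  interpret ring "typering :: 'a ring" by (rule ring_rta)
  show ?thesis by (rule minus_equality) (simp_all add: rta_simps)
qed

lemma ideal_rta_iff: "ideal (I :: 'a::ring_1 set) typering \<longleftrightarrow> two_sided I"
proof
  interpret R: ring "typering :: 'a ring" by (rule ring_rta)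
  show "two_sided I" if "ideal I typering"
  proof -
    interpret ideal I "typering :: 'a ring" by (rule that)
    show ?thesis
      using zero_closed a_closed I_l_closed I_r_closed by (simp add: two_sided_def rta_simps)
  qed
  show "ideal I typering" if I: "two_sided I"
  proof (rule idealI)
    show "subgroup I (add_monoid typering)"
    proof (rule group.subgroupI[OF R.a_group])
      show "I \<noteq> {}" using two_sided_0[OF I] by auto
      show "inv\<^bsub>add_monoid typering\<^esub> a \<in> I" if "a \<in> I" for a
        using two_sided_minus[OF I that] unfolding a_inv_def[symmetric] a_inv_rta .
      show "a \<otimes>\<^bsub>add_monoid typering\<^esub> b \<in> I" if "a \<in> I" "b \<in> I" for a b
        using that two_sided_add[OF I] by (simp add: rta_simps)
    qed (simp add: rta_simps)
  qed (use I ring_rta in \<open>auto simp: rta_simps two_sided_lmult two_sided_rmult\<close>)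
qed

lemma two_sided_Idl: "two_sided (Idl\<^bsub>typering\<^esub> A)"
  using ring.genideal_ideal[OF ring_rta, of A] by (simp add: ideal_rta_iff rta_simps)

lemma Idl_subset_iff: "two_sided J \<Longrightarrow> Idl\<^bsub>typering\<^esub> A \<subseteq> J \<longleftrightarrow> A \<subseteq> J"
  using ring.genideal_minimal[OF ring_rta, of J A] ring.genideal_self[OF ring_rta, of A]
  by (auto simp: ideal_rta_iff rta_simps)

abbreviation coset_of :: "'a::ring_1 set \<Rightarrow> 'a \<Rightarrow> 'a set" where "coset_of I a \<equiv> I +>\<^bsub>typering\<^esub> a"

lemma mem_cls: "two_sided I \<Longrightarrow> x \<in> coset_of I a \<longleftrightarrow> x - a \<in> I"
  by (force simp: a_r_coset_def' rta_simps)

lemma cls_eq_iff: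
  assumes "two_sided I"
  shows "coset_of I a = coset_of I b \<longleftrightarrow> a - b \<in> I"
proof
  assume "coset_of I a = coset_of I b"
  then show "a - b \<in> I" using mem_cls[OF assms] two_sided_0[OF assms] by (metis diff_self)
next
  assume ab: "a - b \<in> I"
  show "coset_of I a = coset_of I b"
  proof (rule Set.set_eqI)
    fix x
    show "x \<in> coset_of I a \<longleftrightarrow> x \<in> coset_of I b"
      using two_sided_add[OF assms, of "x - a" "a - b"] two_sided_diff[OF assms, of "x - b" "a - b"] ab
      by (auto simp: mem_cls[OF assms])
  qed
qed

lemma carrier_Quot: "carrier (typering Quot I) = range (coset_of I)"
  by (auto simp: FactRing_def A_RCOSETS_def' a_r_coset_def' rta_simps)

lemma Quot_simps:
  assumes "two_sided I"
  shows "coset_of I a \<otimes>\<^bsub>typering Quot I\<^esub> coset_of I b = coset_of I (a * b)"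
    "coset_of I a \<oplus>\<^bsub>typering Quot I\<^esub> coset_of I b = coset_of I (a + b)"
    "\<one>\<^bsub>typering Quot I\<^esub> = coset_of I 1"
proof -
  interpret ideal I typering using assms by (simp add: ideal_rta_iff)
  show "coset_of I a \<otimes>\<^bsub>typering Quot I\<^esub> coset_of I b = coset_of I (a * b)"
    "coset_of I a \<oplus>\<^bsub>typering Quot I\<^esub> coset_of I b = coset_of I (a + b)"
    using ring_hom_mult[OF rcos_ring_hom, of a b] ring_hom_add[OF rcos_ring_hom, of a b]
    by (simp_all add: rta_simps)
  show "\<one>\<^bsub>typering Quot I\<^esub> = coset_of I 1" by (simp add: FactRing_def rta_simps)
qed

text \<open>All members of the union are the same coset. This makes \<open>qact\<close>, and the map
  of quotients built in the same way, independent of representatives.\<close>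

lemma UN_cls:
  assumes "two_sided I" "two_sided J" "\<And>x y. f (x - y) = f x - f y" "f ` I \<subseteq> J"
  shows "(\<Union>x\<in>coset_of I a. coset_of J (f x)) = coset_of J (f a)"
proof -
  have "coset_of J (f x) = coset_of J (f a)" if "x \<in> coset_of I a" for x
    using that assms by (auto simp: mem_cls cls_eq_iff simp flip: assms(3))
  moreover have "a \<in> coset_of I a" using assms(1) by (simp add: mem_cls two_sided_0)
  ultimately show ?thesis by (metis (no_types, lifting) SUP_eq_const empty_iff)
qed

lemma two_sided_vimage: "rhom f \<Longrightarrow> two_sided J \<Longrightarrow> two_sided (f -` J)"
  by (simp add: two_sided_def rhom_simps)

subsection \<open>The defining ideals of quantized orbits\<close>

definition gmat :: "(('n::finite \<times> 'n, 'k::ring_1) free_algebra, 'n) sq" where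
  "gmat = sq (\<chi> i j. gen (i, j))"

lemma mx_gmat_nth: "mx gmat $ i $ j = gen (i, j)"
  by (simp add: gmat_def mx_simps)

lemma mx_gmat: "mx gmat = genmat"
  by (simp add: gmat_def genmat_def mx_simps)

definition mtr :: "('a::ring_1, 'n::finite) sq \<Rightarrow> 'a" where "mtr x = trace (mx x)"

lemma mtr_add: "mtr (x + y) = mtr x + mtr y"
  by (simp add: mtr_def trace_def mx_simps sum.distrib)

lemma mtr_scal:
  assumes "central c"
  shows "mtr (y * (scal c * x)) = c * mtr (y * x)"
proof -
  have "mx y $ i $ k * (c * z) = c * (mx y $ i $ k * z)" for i k z
    using assms by (metis central_def mult.assoc)
  then show ?thesis
    by (simp add: mtr_def trace_def mx_times_nth[of y] mx_scal_times_nth sum_distrib_left)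
qed

lemma mtr_rhom: "rhom f \<Longrightarrow> f (mtr x) = mtr (smap f x)"
  by (simp add: mtr_def trace_def mx_smap_nth rhom_simps)

lemma reflection_defect_rdefect:
  "reflection_defect S t = mx (rdefect (smap scalar (sq S)) (scal (scalar (- qpar * t))) (rleg gmat))"
  by (simp add: reflection_defect_def rdefect_def mcomm_def Let_def mx_simps smap_def rleg_def
      mx_gmat scal_def)

lemma foldr_mpoly:
  assumes "rhom \<iota>" "\<And>c. central (\<iota> c)"
  shows "foldr (\<lambda>i M. (mx x - mat (\<iota> (ev i))) ** M) is (mat 1) =
    mx (ring_eval (\<lambda>c. scal (\<iota> c)) (\<Prod>i\<leftarrow>is. [:- ev i, 1:]) x)"
proof -
  have h: "rhom (\<lambda>c. scal (\<iota> c))" "\<And>c. central (scal (\<iota> c))"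
    using assms by (auto intro: rhom_comp rhom_scal central_scal)
  show ?thesis
  proof (induction "is")
    case (Cons i "is")
    have "ring_eval (\<lambda>c. scal (\<iota> c)) [:- ev i, 1:] x = x - scal (\<iota> (ev i))"
      unfolding ring_eval_pCons[OF h] ring_eval_0[OF h(1)] rhom_minus[OF h(1)] rhom_1[OF h(1)] by simp
    then show ?case using Cons
      by (simp only: foldr.simps comp_def list.map prod_list.Cons ring_eval_mult[OF h]) (simp add: mx_simps scal_def)
  qed (simp add: ring_eval_1[OF h(1)] mx_simps)
qed

lemma prod_list_interval: "(\<Prod>i\<leftarrow>[1..<Suc l]. f i) = (\<Prod>i\<in>{1..l}. f i)"
  for f :: "nat \<Rightarrow> 'a::comm_monoid_mult"
  by (subst prod.distinct_set_conv_list[symmetric]) (simp_all add: atLeastLessThanSuc_atLeastAtMost del: upt_Suc)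

lemma rhom_scal_const: "rhom (\<lambda>a. scalar (fps_const a) :: ('x, complex fps) free_algebra)"
  by (rule rhom_comp[OF rhom_scalar]) (simp add: rhom_def)

lemma central_scal_const: "central (scalar (fps_const a) :: ('x, complex fps) free_algebra)"
  by (intro central_scalar central_comm)

lemma orbit_ideal_eq:
  fixes D :: "complex fps^'n::finite^'n"
  shows
  "orbit_ideal S D l ev blk =
     (let t = fps_const (ev 1) * (fps_exp (-2) - 1)
      in Idl\<^bsub>typering\<^esub>
        ({mx (rdefect (smap scalar (sq S)) (scal (scalar (- qpar * t))) (rleg gmat)) $ p $ q | p q. True} \<union>
         {mx (ring_eval (\<lambda>a. scal (scalar (fps_const a))) (\<Prod>i\<in>{1..l}. [:- ev i, 1:]) gmat) $ a $ b | a b. True} \<union>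
         {mtr (smap scalar (sq D) * gmat ^ k) - scalar (qtrace_value t l ev blk k) | k. k \<in> {1..l - 1}}))"
proof -
  have *: "foldr (\<lambda>i M. (genmat - mat (scalar (fps_const (ev i)))) ** M) [1..<Suc l] (mat 1) =
     mx (ring_eval (\<lambda>a. scal (scalar (fps_const a))) (\<Prod>i\<in>{1..l}. [:- ev i, 1:]) (gmat :: ('n qmat, 'n) sq))"
    unfolding prod_list_interval[symmetric]
    by (subst foldr_mpoly[OF rhom_scal_const central_scal_const, symmetric]) (simp add: mx_gmat del: upt_Suc)
  have "qtrace D (mpower genmat k) = mtr (smap scalar (sq D) * gmat ^ k)" for k
    by (simp add: qtrace_def mtr_def mx_simps mx_power smap_def mx_gmat)
  then show ?thesis
    unfolding orbit_ideal_def reflection_defect_rdefect * by (simp only:)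
qed

lemma two_sided_orbit_ideal: "two_sided (orbit_ideal S D l ev blk)"
  by (simp add: orbit_ideal_eq Let_def two_sided_Idl)

text \<open>The preimage of a two-sided ideal is two-sided, so only generators have to be tested,
  and \<open>f\<close> passes through matrix expressions entrywise. Read forwards with
  \<open>f\<close> the identity or the extension of scalars, the criterion supplies the relations of
  the quotient; read backwards, it shows that a homomorphism respects them.\<close>

lemma orbit_ideal_subset_vimage:
  fixes f :: "'n::finite qmat \<Rightarrow> 'a::ring_1"
  assumes f: "rhom f" and J: "two_sided J" and \<iota>: "\<iota> = (\<lambda>c. f (scalar c))" and L: "L = smap f gmat"
    and t: "t = fps_const (ev 1) * (fps_exp (-2) - 1)"
  shows "orbit_ideal S D l ev blk \<subseteq> f -` J \<longleftrightarrow>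
    rdefect (smap \<iota> (sq S)) (scal (\<iota> (- qpar * t))) (rleg L) \<in> mideal J \<and>
    ring_eval (\<lambda>a. scal (\<iota> (fps_const a))) (\<Prod>i\<in>{1..l}. [:- ev i, 1:]) L \<in> mideal J \<and>
    (\<forall>k\<in>{1..l - 1}. mtr (smap \<iota> (sq D) * L ^ k) - \<iota> (qtrace_value t l ev blk k) \<in> J)"
proof -
  have s: "smap f (smap scalar A) = smap \<iota> A" for A :: "(complex fps, 'm::finite) sq"
    by (rule sq_eqI) (simp add: mx_smap_nth \<iota>)
  have 1: "smap f (rdefect (smap scalar (sq S)) (scal (scalar (- qpar * t))) (rleg gmat)) =
     rdefect (smap \<iota> (sq S)) (scal (\<iota> (- qpar * t))) (rleg L)"
    by (simp only: rdefect_rhom[OF rhom_smap[OF f]] s smap_scal[OF f] smap_rleg[OF f] L \<iota>)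
  have 2: "smap f (ring_eval (\<lambda>a. scal (scalar (fps_const a))) (\<Prod>i\<in>{1..l}. [:- ev i, 1:]) gmat) =
     ring_eval (\<lambda>a. scal (\<iota> (fps_const a))) (\<Prod>i\<in>{1..l}. [:- ev i, 1:]) L"
    by (simp only: ring_eval_rhom[OF rhom_smap[OF f]] s smap_scal[OF f] L \<iota>)
  have 3: "f (mtr (smap scalar (sq D) * gmat ^ k) - scalar (qtrace_value t l ev blk k)) =
     mtr (smap \<iota> (sq D) * L ^ k) - \<iota> (qtrace_value t l ev blk k)" for k
    by (simp only: rhom_diff[OF f] mtr_rhom[OF f] rhom_mult[OF rhom_smap[OF f]]
       rhom_power[OF rhom_smap[OF f]] s L \<iota>)
  show ?thesis
    unfolding orbit_ideal_eq Let_def t[symmetric] Idl_subset_iff[OF two_sided_vimage[OF f J]]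
      1[symmetric] 2[symmetric] 3[symmetric] mideal_def mem_Collect_eq mx_smap_nth
    by blast
qed

section \<open>Polynomials of the generating matrix\<close>

lemma sum_mult_poly:
  fixes \<iota> :: "'c::comm_ring_1 \<Rightarrow> 'b::comm_ring_1"
  assumes "rhom \<iota>" "Polynomial.degree P \<le> N"
  shows "(\<Sum>k\<le>N. \<iota> (Polynomial.coeff P k) * (\<Sum>i\<in>A. \<iota> (ev i ^ k) * c i)) =
    (\<Sum>i\<in>A. \<iota> (poly P (ev i)) * c i)"
proof -
  have "\<iota> (poly P x) = (\<Sum>k\<le>N. \<iota> (Polynomial.coeff P k) * \<iota> (x ^ k))" for x
  proof -
    have "poly P x = (\<Sum>k\<le>N. Polynomial.coeff P k * x ^ k)"
      unfolding poly_altdef using assms(2)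
      by (intro sum.mono_neutral_left) (auto simp: coeff_eq_0)
    then show ?thesis using assms(1) by (simp add: rhom_sum rhom_mult)
  qed
  then have "(\<Sum>i\<in>A. \<iota> (poly P (ev i)) * c i) =
      (\<Sum>i\<in>A. \<Sum>k\<le>N. \<iota> (Polynomial.coeff P k) * (\<iota> (ev i ^ k) * c i))"
    by (simp add: sum_distrib_right mult.assoc)
  then show ?thesis by (subst (asm) sum.swap) (simp add: sum_distrib_left)
qed

lemma rhom_fps_const: "rhom (fps_const :: complex \<Rightarrow> complex fps)"
  by (simp add: rhom_def)

definition poly_subst :: "complex poly \<Rightarrow> 'n::finite qmat \<Rightarrow> 'n qmat" where
  "poly_subst P = fhom scalar (\<lambda>(i, j). mpoly_eval (\<lambda>a. scalar (fps_const a)) P genmat $ i $ j)"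

lemma rhom_poly_subst: "rhom (poly_subst P)"
  unfolding poly_subst_def by (intro rhom_fhom rhom_scalar central_scalar central_comm)

lemma poly_subst_scalar: "poly_subst P (scalar c) = scalar c"
  unfolding poly_subst_def by (rule fhom_scalar[OF rhom_scalar])

lemma poly_subst_gen: "poly_subst P (gen (i, j)) = mpoly_eval (\<lambda>a. scalar (fps_const a)) P genmat $ i $ j"
  unfolding poly_subst_def by (subst fhom_gen[OF rhom_scalar]) simp

abbreviation cscalar :: "complex \<Rightarrow> ('n::finite qmat, 'n) sq" where "cscalar \<equiv> \<lambda>a. scal (scalar (fps_const a))"

lemma cscalar: "rhom cscalar" "central (cscalar a)"
  by (auto intro: rhom_comp[OF rhom_scal rhom_scal_const] central_scal central_scal_const)

lemma smap_poly_subst: "smap (poly_subst P) gmat = ring_eval cscalar P gmat"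
proof (rule sq_eqI)
  show "mx (smap (poly_subst P) gmat) $ i $ j = mx (ring_eval cscalar P gmat) $ i $ j" for i j
    unfolding mx_smap_nth mx_gmat_nth poly_subst_gen mx_ring_eval unfolding mx_gmat ..
qed

context
  fixes S :: "complex fps^('n::finite \<times> 'n)^('n \<times> 'n)" and D :: "complex fps^'n^'n"
    and l :: nat and lam mu :: "nat \<Rightarrow> complex" and blk blk' :: "'n \<Rightarrow> nat"
    and Q P :: "complex poly"
  assumes S: "hecke S" and D: "trace D = qint CARD('n)"
    and l: "2 \<le> l" and blk: "range blk = {1..l}" and inj: "inj_on lam {1..l}"
    and blk': "blk' = (\<lambda>a. if blk a = 1 then 1 else 2)" and mu: "mu 1 \<noteq> mu 2"
    and Q: "Q = (\<Prod>i\<in>{2..l}. Polynomial.smult (1 / (lam 1 - lam i)) [:- lam i, 1:])"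
    and P: "P = Polynomial.smult (mu 1 - mu 2) Q + [:mu 2:]"
begin

lemma one_l: "{1..l} = insert 1 {2..l}"
  using l by auto

lemma lam_neq: "i \<in> {2..l} \<Longrightarrow> lam 1 - lam i \<noteq> 0"
  using l by (intro ev_neq[OF l inj refl]) auto

lemma poly_Q_1: "poly Q (lam 1) = 1"
  unfolding Q poly_prod
proof (intro prod.neutral ballI)
  show "poly (Polynomial.smult (1 / (lam 1 - lam i)) [:- lam i, 1:]) (lam 1) = 1" if "i \<in> {2..l}" for i
    using lam_neq[OF that] by (simp add: diff_divide_distrib[symmetric])
qed

lemma poly_Q_i: "i \<in> {2..l} \<Longrightarrow> poly Q (lam i) = 0"
  unfolding Q poly_prod by auto

lemma poly_P: "poly P (lam 1) = mu 1" "i \<in> {2..l} \<Longrightarrow> poly P (lam i) = mu 2"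
  by (simp_all add: P poly_Q_1[simplified] poly_Q_i)

text \<open>The trace relations are imposed for exponents up to \<open>l - 1\<close>; the bound lets
  them, together with exponent 0, determine the quantum trace of \<open>P\<close> at the generating
  matrix.\<close>

lemma degree_P: "Polynomial.degree P \<le> l - 1"
proof -
  have "Polynomial.degree Q \<le> (\<Sum>i\<in>{2..l}. Polynomial.degree (Polynomial.smult (1 / (lam 1 - lam i)) [:- lam i, 1:]))"
    unfolding Q by (rule order.trans[OF degree_prod_sum_le]) simp_all
  also have "\<dots> \<le> (\<Sum>i\<in>{2..l}. 1)" by (intro sum_mono) simp
  also have "\<dots> = l - 1" by simp
  finally show ?thesis unfolding P
    by (intro degree_add_le order.trans[OF degree_smult_le]) simp_all
qed

text \<open>Up to a constant this is the polynomial that annihilates the generating matrix in the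
  quotient, so \<open>(L - lam 1) Q(L)\<close> vanishes there.\<close>

lemma Q_factor:
  "\<exists>c. [:- lam 1, 1:] * Q = Polynomial.smult c (\<Prod>i\<in>{1..l}. [:- lam i, 1:])"
proof -
  have "Q = Polynomial.smult (\<Prod>i\<in>{2..l}. 1 / (lam 1 - lam i)) (\<Prod>i\<in>{2..l}. [:- lam i, 1:])"
    unfolding Q by (rule prod_smult)
  then show ?thesis unfolding one_l by auto
qed

abbreviation "hecke_par \<equiv> qpar - inverse qpar"

text \<open>Puts the coefficient of the linear term into the form \<open>\<alpha> w\<close> of
  \<open>reflection_affine\<close>: the shift is \<open>a\<close> and \<open>w\<close> is the Hecke
  parameter q - q^-1.\<close>

lemma shift_param: "- qpar * (fps_const a * (fps_exp (-2) - 1)) = fps_const a * hecke_par"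
proof -
  have "qpar * inverse qpar = 1"
    by (simp add: qpar_def inverse_mult_eq_1' )
  then have "qpar * fps_exp (-2) = inverse qpar"
    unfolding inverse_qpar_sq[symmetric] by (simp add: power2_eq_square mult.assoc[symmetric])
  then show ?thesis by (simp add: algebra_simps)
qed

lemma hecke_sq: "smap scalar (sq S) * smap scalar (sq S) =
    scal (scalar hecke_par) * smap scalar (sq S) + (1 :: ('n qmat, 'n \<times> 'n) sq)"
proof -
  have "sq S * sq S = scal hecke_par * sq S + 1"
    by (rule sq_eqI)
       (use S in \<open>simp add: hecke_def mx_simps(2,3) mx_scal_times_nth\<close>, simp add: mx_simps)
  then have "smap scalar (sq S * sq S) = smap scalar (scal hecke_par * sq S + (1 :: (complex fps, 'n \<times> 'n) sq))"
    by (rule arg_cong)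
  then show ?thesis
    unfolding rhom_simps[OF rhom_smap[OF rhom_scalar]] smap_scal[OF rhom_scalar] .
qed

lemma blocksizes:
  "blocksize blk' 1 = blocksize blk 1" "blocksize blk' 2 = (\<Sum>j\<in>{2..l}. blocksize blk j)"
  "range blk' = {1..2}"
proof -
  have "{a. blk' a = 1} = {a. blk a = 1}" by (auto simp: blk')
  then show 1: "blocksize blk' 1 = blocksize blk 1" by (simp add: blocksize_def)
  obtain a where a: "blk a = 1" using blk l by (metis atLeastAtMost_iff dual_order.trans one_le_numeral order_refl rangeE)
  obtain b where b: "blk b = 2" using blk l by (metis atLeastAtMost_iff one_le_numeral rangeE)
  have ab: "blk' a = 1" "blk' b = 2" using a b by (auto simp: blk')
  have "{1..2::nat} = {1, 2}" by auto
  moreover have "range blk' = {1, 2}"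
    using ab by (auto simp: blk' image_iff)
  ultimately show r: "range blk' = {1..2}" by simp
  have "blocksize blk' 1 + blocksize blk' 2 = CARD('n)"
    using sum_blocksize[OF r] \<open>{1..2::nat} = {1, 2}\<close> by simp
  moreover have "blocksize blk 1 + (\<Sum>j\<in>{2..l}. blocksize blk j) = CARD('n)"
    using sum_blocksize[OF blk] unfolding one_l by simp
  ultimately show "blocksize blk' 2 = (\<Sum>j\<in>{2..l}. blocksize blk j)"
    using 1 by simp
qed

text \<open>By linearity the left side is the sum of \<open>P (lam i)\<close> times the i-th
  coefficient, that is, \<open>mu 1\<close> times the first coefficient plus \<open>mu 2\<close>
  times the sum of the others. Both orbits have the same first coefficient and the same total
  \<open>qint n\<close>, so that sum is the second coefficient for \<open>mu\<close>.\<close>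

lemma qtrace_value_P:
  assumes t: "t = fps_const (lam 1) * (fps_exp (-2) - 1)" and t': "t' = fps_const (mu 1) * (fps_exp (-2) - 1)"
  defines "V \<equiv> \<lambda>k. if k = 0 then qint CARD('n) else qtrace_value t l lam blk k"
  shows "(\<Sum>k\<le>l - 1. fps_const (Polynomial.coeff P k) * V k) = qtrace_value t' 2 mu blk' 1"
proof -
  define c where "c = qcoef t l lam (blocksize blk)"
  define c' where "c' = qcoef t' 2 mu (blocksize blk')"
  have inj': "inj_on mu {1..2}"
  proof -
    have "{1..2::nat} = {1, 2}" by auto
    then show ?thesis using mu by simp
  qed
  have sum: "(\<Sum>i\<in>{1..l}. c i) = qint CARD('n)" "(\<Sum>i\<in>{1..2}. c' i) = qint CARD('n)"
    unfolding c_def c'_def sum_qcoef[OF l inj t] sum_qcoef[OF order_refl inj' t']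
    by (simp_all only: sum_blocksize[OF blk] sum_blocksize[OF blocksizes(3)])
  have c1: "c 1 = c' 1"
    unfolding c_def c'_def qcoef_1[OF l inj t] qcoef_1[OF order_refl inj' t'] blocksizes(1)
    by (simp add: blocksizes(2))
  have "V k = (\<Sum>i\<in>{1..l}. fps_const (lam i ^ k) * c i)" for k
    using sum(1) by (simp add: V_def qtrace_value_qcoef c_def)
  then have "(\<Sum>k\<le>l - 1. fps_const (Polynomial.coeff P k) * V k) =
      (\<Sum>i\<in>{1..l}. fps_const (poly P (lam i)) * c i)"
    using sum_mult_poly[OF rhom_fps_const degree_P, of lam c "{1..l}"] by simp
  also have "\<dots> = fps_const (mu 1) * c 1 + (\<Sum>i\<in>{2..l}. fps_const (mu 2) * c i)"
    unfolding one_l by (simp add: poly_P poly_P[simplified])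
  also have "(\<Sum>i\<in>{2..l}. fps_const (mu 2) * c i) = fps_const (mu 2) * (qint CARD('n) - c 1)"
    unfolding sum(1)[symmetric] one_l by (simp add: sum_distrib_left)
  also have "qint CARD('n) - c 1 = c' 2"
  proof -
    have "{1..2::nat} = {1, 2}" by auto
    then show ?thesis using sum(2) unfolding c1 by (simp add: algebra_simps)
  qed
  also have "fps_const (mu 1) * c 1 + fps_const (mu 2) * c' 2 = qtrace_value t' 2 mu blk' 1"
  proof -
    have "{1..2::nat} = {1, 2}" by auto
    then show ?thesis unfolding qtrace_value_qcoef c1 c'_def by simp
  qed
  finally show ?thesis .
qed

lemma poly_subst_ideal: "orbit_ideal S D 2 mu blk' \<subseteq> poly_subst P -` orbit_ideal S D l lam blk"
proof -
  define I where "I = orbit_ideal S D l lam blk"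
  have I: "two_sided I" unfolding I_def by (rule two_sided_orbit_ideal)
  note MI = two_sided_mideal[OF I]
  define t where "t = fps_const (lam 1) * (fps_exp (-2) - 1)"
  define t' where "t' = fps_const (mu 1) * (fps_exp (-2) - 1)"
  have id: "rhom (\<lambda>x. x)" by (simp add: rhom_def)
  have gen:
    "rdefect (smap scalar (sq S)) (scal (scalar (- qpar * t))) (rleg gmat) \<in> mideal I"
    "ring_eval cscalar (\<Prod>i\<in>{1..l}. [:- lam i, 1:]) gmat \<in> mideal I"
    "\<And>k. k \<in> {1..l - 1} \<Longrightarrow> mtr (smap scalar (sq D) * gmat ^ k) - scalar (qtrace_value t l lam blk k) \<in> I"
  proof -
    have g: "gmat = smap (\<lambda>x. x) gmat" by (rule sq_eqI) (simp add: mx_smap_nth)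
    \<comment> \<open>Applied to the identity map, the criterion reads off the relations that hold
      modulo the ideal.\<close>
    have "orbit_ideal S D l lam blk \<subseteq> (\<lambda>x. x) -` I" unfolding I_def by simp
    note * = this[unfolded orbit_ideal_subset_vimage[where f = "\<lambda>x. x" and ev = lam, OF id I refl g t_def]]
    then
    show "rdefect (smap scalar (sq S)) (scal (scalar (- qpar * t))) (rleg gmat) \<in> mideal I"
    "ring_eval cscalar (\<Prod>i\<in>{1..l}. [:- lam i, 1:]) gmat \<in> mideal I"
    "\<And>k. k \<in> {1..l - 1} \<Longrightarrow> mtr (smap scalar (sq D) * gmat ^ k) - scalar (qtrace_value t l lam blk k) \<in> I"
      by blast+
  qed
  define w where "w = (scal (scalar hecke_par) :: ('n qmat, 'n \<times> 'n) sq)"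
  have w: "central w" unfolding w_def by (intro central_scal central_scalar central_comm)
  \<comment> \<open>The coefficient of the linear term is split into a constant in the second leg
    and the Hecke parameter, the shape in which \<open>rdefect_polynomial\<close> expects
    it.\<close>
  have par: "scal (scalar (- qpar * (fps_const a * (fps_exp (-2) - 1)))) = rleg (cscalar a) * w" for a
    unfolding shift_param rleg_scal w_def rhom_mult[OF rhom_scalar] rhom_mult[OF rhom_scal] ..
  obtain b where b: "[:- lam 1, 1:] * Q = Polynomial.smult b (\<Prod>i\<in>{1..l}. [:- lam i, 1:])"
    using Q_factor by blast
  have ann: "ring_eval cscalar ([:- lam 1, 1:] * Q) gmat \<in> mideal I"
    unfolding b ring_eval_smult[OF cscalar(1)] by (rule two_sided_lmult[OF MI gen(2)])
  have rcc: "central (rleg (cscalar a))" for a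
    unfolding rleg_scal by (intro central_scal central_scal_const)
  have "rdefect (smap scalar (sq S)) (rleg (cscalar (mu 1)) * w) (rleg (ring_eval cscalar P gmat)) \<in> mideal I"
    unfolding P
    by (rule rdefect_polynomial[OF MI rhom_rleg rleg_mideal[OF I] MI cscalar rcc w
          hecke_sq[folded w_def] gen(1)[unfolded t_def par] ann poly_Q_1])
  moreover have "ring_eval cscalar ([:- mu 1, 1:] * [:- mu 2, 1:]) (ring_eval cscalar P gmat) \<in> mideal I"
    unfolding P by (rule annihilated_polynomial[OF MI cscalar ann poly_Q_1])
  moreover have "mtr (smap scalar (sq D) * ring_eval cscalar P gmat ^ 1) - scalar (qtrace_value t' 2 mu blk' 1) \<in> I"
  proof -
    define V where "V = (\<lambda>k. if k = 0 then qint CARD('n) else qtrace_value t l lam blk k)"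
    have *: "mtr (smap scalar (sq D) * gmat ^ k) - scalar (V k) \<in> I" if "k \<le> l - 1" for k
    \<comment> \<open>Exponent 0 is not among the defining relations; there the normalization of the
      trace of \<open>D\<close> supplies the value.\<close>
    proof (cases "k = 0")
      case True
      have "mtr (smap scalar (sq D) :: ('n qmat, 'n) sq) = scalar (trace D)"
        by (subst mtr_rhom[OF rhom_scalar, symmetric]) (simp add: mtr_def mx_simps)
      then show ?thesis using D True by (simp add: V_def two_sided_0[OF I])
    qed (use gen(3) that in \<open>simp add: V_def\<close>)
    have "mtr (smap scalar (sq D) * ring_eval cscalar P gmat ^ 1) =
       (\<Sum>k\<le>l - 1. scalar (fps_const (Polynomial.coeff P k)) * mtr (smap scalar (sq D) * gmat ^ k))"
    proof -
      have "mtr (sum f A) = (\<Sum>x\<in>A. mtr (f x))" for f :: "nat \<Rightarrow> ('n qmat, 'n) sq" and A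
        by (induction A rule: infinite_finite_induct) (auto simp: mtr_add, auto simp: mtr_def trace_def mx_simps)
      then show ?thesis
        unfolding ring_eval_bound[of cscalar, OF rhom_0[OF cscalar(1)] degree_P]
        by (simp add: sum_distrib_left mtr_scal[OF central_scal_const])
    qed
    moreover have "scalar (qtrace_value t' 2 mu blk' 1) =
       (\<Sum>k\<le>l - 1. scalar (fps_const (Polynomial.coeff P k)) * (scalar (V k) :: 'n qmat))"
      unfolding qtrace_value_P[OF t_def t'_def, symmetric]
      by (simp only: V_def rhom_sum[OF rhom_scalar] rhom_mult[OF rhom_scalar])
    ultimately have "mtr (smap scalar (sq D) * ring_eval cscalar P gmat ^ 1) - scalar (qtrace_value t' 2 mu blk' 1) =
      (\<Sum>k\<le>l - 1. scalar (fps_const (Polynomial.coeff P k)) * (mtr (smap scalar (sq D) * gmat ^ k) - scalar (V k)))"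
      by (simp add: sum_subtractf right_diff_distrib)
    also have "\<dots> \<in> I" by (intro two_sided_sum[OF I] two_sided_lmult[OF I] *) simp
    finally show ?thesis .
  qed
  moreover have "{1..2 - 1::nat} = {1}" "(\<Prod>i\<in>{1..2}. [:- mu i, 1:]) = [:- mu 1, 1:] * [:- mu 2, 1:]"
    by (auto simp: numeral_2_eq_2)
  ultimately show ?thesis
    unfolding I_def[symmetric]
      orbit_ideal_subset_vimage[where ev = mu, OF rhom_poly_subst I refl smap_poly_subst[symmetric] t'_def]
    unfolding poly_subst_scalar t'_def par by auto
qed

end

section \<open>Topologically free modules\<close>

definition tlin :: "('b tfree \<Rightarrow> complex fps) \<Rightarrow> bool" where
  "tlin f \<longleftrightarrow> (\<forall>x y. f (x + y) = f x + f y) \<and> (\<forall>c x. f (tscale c x) = c * f x)"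

definition tmlin :: "('b tfree \<Rightarrow> 'c tfree) \<Rightarrow> bool" where
  "tmlin f \<longleftrightarrow> (\<forall>x y. f (x + y) = f x + f y) \<and> (\<forall>c x. f (tscale c x) = tscale c (f x))"

lemma tlinD: "tlin f \<Longrightarrow> f (x + y) = f x + f y" "tlin f \<Longrightarrow> f (tscale c x) = c * f x"
  by (auto simp: tlin_def)

lemma tmlinD: "tmlin f \<Longrightarrow> f (x + y) = f x + f y" "tmlin f \<Longrightarrow> f (tscale c x) = tscale c (f x)"
  by (auto simp: tmlin_def)

lemma tlin_hom: "module_hom tscale (*) f \<Longrightarrow> tlin f"
  by (simp add: tlin_def module_hom.add module_hom.scale)

lemma tmlin_hom: "module_hom tscale tscale f \<Longrightarrow> tmlin f"
  by (simp add: tmlin_def module_hom.add module_hom.scale)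

lemma tlin_tmlin: "tlin f \<Longrightarrow> tmlin g \<Longrightarrow> tlin (\<lambda>x. f (g x))"
  by (simp add: tlin_def tmlin_def)

lemma tlin_0: "tlin f \<Longrightarrow> f 0 = 0"
  using tlinD(1)[of f 0 0] by simp

lemma tlin_sum: "tlin f \<Longrightarrow> f (sum g A) = (\<Sum>a\<in>A. f (g a))"
  by (induction A rule: infinite_finite_induct) (auto simp: tlin_0 tlinD)

lemma coord_simps: "coord (x + y) b = coord x b + coord y b" "coord (tscale c x) b = c * coord x b"
  "coord 0 b = 0" "coord (tbasis a) b = (if b = a then 1 else 0)"
  "coord (tens x' y') p = coord x' (fst p) * coord y' (snd p)"
  by (transfer, simp)+

lemma tlin_coord: "tlin (\<lambda>x. coord x b)"
  by (simp add: tlin_def coord_simps)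

lemma tfree_eqI: "(\<And>b. coord x b = coord y b) \<Longrightarrow> x = y"
  by (metis coord_inject ext)

lemma fps_mult_nth_low:
  fixes f g :: "complex fps"
  assumes "\<And>k. k \<le> N \<Longrightarrow> fps_nth f k = 0"
  shows "fps_nth (f * g) N = 0"
  using assms by (simp add: fps_mult_nth)

lemma tsum_nth:
  assumes "finite B" "tsupp N (coord x) \<subseteq> B"
  shows "fps_nth (tsum x f) N = (\<Sum>b\<in>B. fps_nth (coord x b * f b) N)"
  unfolding tsum_def fps_nth_Abs_fps using assms
  by (intro sum.mono_neutral_left) (auto simp: tsupp_def intro!: fps_mult_nth_low)

lemma tlin_tsum:
  fixes f :: "'b \<Rightarrow> complex fps"
  shows "tlin (\<lambda>x. tsum x f)"
  unfolding tlin_def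
proof (intro conjI allI fps_ext)
  fix x y :: "'b tfree" and N
  define B where "B = tsupp N (coord x) \<union> tsupp N (coord y) \<union> tsupp N (coord (x + y))"
  have B: "finite B" "tsupp N (coord x) \<subseteq> B" "tsupp N (coord y) \<subseteq> B" "tsupp N (coord (x + y)) \<subseteq> B"
    by (auto simp: B_def finite_tsupp_coord)
  show "fps_nth (tsum (x + y) f) N = fps_nth (tsum x f + tsum y f) N"
    by (simp add: tsum_nth[OF B(1,2)] tsum_nth[OF B(1,3)] tsum_nth[OF B(1,4)] coord_simps
        distrib_right sum.distrib)
next
  fix c and x :: "'b tfree" and N
  define B where "B = tsupp N (coord x)"
  have B: "finite B" "tsupp N (coord (tscale c x)) \<subseteq> B"
    unfolding B_def by (rule finite_tsupp_coord)
      (use tsupp_mult(2) in \<open>fastforce simp: coord_simps tsupp_def\<close>)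
  have "fps_nth (c * tsum x f) N = (\<Sum>i=0..N. \<Sum>b\<in>B. fps_nth c i * fps_nth (coord x b * f b) (N - i))"
    unfolding fps_mult_nth[of c]
  proof (intro sum.cong refl)
    fix i assume "i \<in> {0..N}"
    have "fps_nth (tsum x f) (N - i) = (\<Sum>b\<in>B. fps_nth (coord x b * f b) (N - i))"
      by (rule tsum_nth[OF B(1)]) (simp add: B_def tsupp_mono)
    then show "fps_nth c i * fps_nth (tsum x f) (N - i) =
        (\<Sum>b\<in>B. fps_nth c i * fps_nth (coord x b * f b) (N - i))"
      by (simp add: sum_distrib_left)
  qed
  also have "\<dots> = (\<Sum>b\<in>B. fps_nth (c * (coord x b * f b)) N)"
    by (subst sum.swap) (simp add: fps_mult_nth[of c])
  finally show "fps_nth (tsum (tscale c x) f) N = fps_nth (c * tsum x f) N"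
    by (simp add: tsum_nth[OF B] coord_simps mult.assoc)
qed

lemma tsum_tbasis: "tsum (tbasis b) f = f b"
proof (rule fps_ext)
  fix N
  show "fps_nth (tsum (tbasis b) f) N = fps_nth (f b) N"
    by (subst tsum_nth[of "{b}"]) (auto simp: coord_simps tsupp_def split: if_splits)
qed

text \<open>Every coordinate is divided by the power of the parameter. The finiteness condition for
  the quotient at order \<open>M\<close> follows from that for \<open>x\<close> at order
  \<open>M + Suc N\<close>, so the quotient stays in the module.\<close>

lemma divisible_tfree:
  assumes "\<And>b k. k \<le> N \<Longrightarrow> fps_nth (coord x b) k = 0"
  shows "\<exists>y. x = tscale (fps_X ^ Suc N) y"
proof -
  define g where "g b = fps_shift (Suc N) (coord x b)" for b
  have "tsupp M g \<subseteq> tsupp (M + Suc N) (coord x)" for M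
    by (auto simp: tsupp_def g_def) (use add_le_mono1 in blast)
  then have "\<forall>M. finite (tsupp M g)"
    by (intro allI finite_subset[OF _ finite_tsupp_coord])
  then have g: "coord (Abs_tfree g) = g" by (simp add: Abs_tfree_inverse)
  have "x = tscale (fps_X ^ Suc N) (Abs_tfree g)"
  proof (rule tfree_eqI, rule fps_ext)
    fix b k
    show "fps_nth (coord x b) k = fps_nth (coord (tscale (fps_X ^ Suc N) (Abs_tfree g)) b) k"
      unfolding coord_simps g g_def fps_X_power_mult_nth using assms[of k b] by auto
  qed
  then show ?thesis ..
qed

text \<open>A linear functional preserves divisibility by powers of the parameter, hence is continuous.\<close>

lemma tlin_eq_tsum:
  assumes "tlin \<phi>"
  shows "\<phi> x = tsum x (\<lambda>b. \<phi> (tbasis b))"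
proof (rule fps_ext)
  fix N
  define B where "B = tsupp N (coord x)"
  have B: "finite B" by (simp add: B_def finite_tsupp_coord)
  \<comment> \<open>The truncation of \<open>x\<close> to the finitely many indices visible up to
    order \<open>N\<close>. The remainder is divisible by the power \<open>Suc N\<close> of the
    parameter and cannot contribute at order \<open>N\<close>.\<close>
  define x' where "x' = (\<Sum>b\<in>B. tscale (coord x b) (tbasis b))"
  have x': "coord x' b = (if b \<in> B then coord x b else 0)" for b
  proof -
    have "coord x' b = (\<Sum>a\<in>B. if b = a then coord x a else 0)"
      unfolding x'_def tlin_sum[OF tlin_coord] by (intro sum.cong) (auto simp: coord_simps)
    then show ?thesis using B by simp
  qed
  have "fps_nth (coord (x - x') b) k = 0" if "k \<le> N" for b k
  proof -
    have "coord (x - x') b = coord x b - coord x' b" by transfer simp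
    then show ?thesis using that by (auto simp: x' B_def tsupp_def)
  qed
  from divisible_tfree[OF this] obtain y where "x - x' = tscale (fps_X ^ Suc N) y" ..
  then have "x = x' + tscale (fps_X ^ Suc N) y" by (metis add.commute diff_add_cancel)
  then have "\<phi> x = \<phi> x' + fps_X ^ Suc N * \<phi> y" by (metis tlinD[OF assms])
  then have "fps_nth (\<phi> x) N = fps_nth (\<phi> x') N"
    by (simp add: fps_X_power_mult_nth del: power_Suc)
  also have "\<phi> x' = (\<Sum>b\<in>B. coord x b * \<phi> (tbasis b))"
    by (simp add: x'_def tlin_sum[OF assms] tlinD(2)[OF assms])
  finally show "fps_nth (\<phi> x) N = fps_nth (tsum x (\<lambda>b. \<phi> (tbasis b))) N"
    by (simp add: tsum_nth[OF B] B_def fps_sum_nth)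
qed

lemma tlin_ext: "tlin f \<Longrightarrow> tlin g \<Longrightarrow> (\<And>b. f (tbasis b) = g (tbasis b)) \<Longrightarrow> f x = g x"
  using tlin_eq_tsum[of f x] tlin_eq_tsum[of g x] by simp

lemma tsum_add: "tsum x (\<lambda>b. f b + g b) = tsum x f + tsum x g"
  by (rule tlin_ext[of "\<lambda>x. tsum x (\<lambda>b. f b + g b)"])
     (auto simp: tlin_tsum tsum_tbasis tlin_def tlinD[OF tlin_tsum] algebra_simps)

lemma tsum_mult: "tsum x (\<lambda>b. c * f b) = c * tsum x f"
  by (rule tlin_ext[of "\<lambda>x. tsum x (\<lambda>b. c * f b)"])
     (auto simp: tlin_tsum tsum_tbasis tlin_def tlinD[OF tlin_tsum] algebra_simps)

lemma tsum_0: "tsum x (\<lambda>b. 0) = 0"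
  using tsum_mult[of x 0 "\<lambda>_. 0"] by simp

lemma tsum_sum: "tsum x (\<lambda>b. \<Sum>i\<in>A. f i b) = (\<Sum>i\<in>A. tsum x (f i))"
  by (induction A rule: infinite_finite_induct) (auto simp: tsum_0 tsum_add)

lemma tmlin_textend: "tmlin (textend F)"
  unfolding tmlin_def
  by (intro conjI allI tfree_eqI) (simp_all add: coord_textend coord_simps tlinD[OF tlin_tsum])

lemma textend_tbasis: "textend F (tbasis b) = F b"
  by (rule tfree_eqI) (simp add: coord_textend tsum_tbasis)

lemma tlin_textend: "tlin \<phi> \<Longrightarrow> \<phi> (textend F x) = tsum x (\<lambda>b. \<phi> (F b))"
  using tlin_eq_tsum[OF tlin_tmlin[OF _ tmlin_textend], of \<phi> F x] by (simp add: textend_tbasis)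

lemma tsum_textend: "tsum (textend F x) f = tsum x (\<lambda>b. tsum (F b) f)"
  by (rule tlin_textend[OF tlin_tsum])

lemma tens_tbasis: "tens (tbasis b) (tbasis c) = tbasis (b, c)"
  by (rule tfree_eqI) (auto simp: coord_simps)

lemma tsum_tens: "tsum (tens x y) f = tsum x (\<lambda>b. tsum y (\<lambda>c. f (b, c)))"
proof -
  have l1: "tmlin (\<lambda>x. tens x y)" and l2: "tmlin (tens x)" for x :: "'a tfree" and y :: "'b tfree"
    unfolding tmlin_def by (intro conjI allI tfree_eqI; simp add: coord_simps algebra_simps)+
  have "tsum (tens (tbasis b) y) f = tsum y (\<lambda>c. f (b, c))" for b
    using tlin_eq_tsum[of "\<lambda>y. tsum (tens (tbasis b) y) f" y, OF tlin_tmlin[OF tlin_tsum l2]]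
    by (simp add: tens_tbasis tsum_tbasis)
  then show ?thesis
    using tlin_eq_tsum[of "\<lambda>x. tsum (tens x y) f" x, OF tlin_tmlin[OF tlin_tsum l1]] by simp
qed

lemma tsum_reindex:
  assumes "bij \<pi>" "\<And>a. coord x (\<pi> a) = coord y a"
  shows "tsum x f = tsum y (\<lambda>a. f (\<pi> a))"
proof (rule fps_ext)
  fix N
  have "tsupp N (coord x) = \<pi> ` tsupp N (coord y)"
    using assms unfolding tsupp_def by (auto simp: image_iff) (metis bij_pointE)
  then show "fps_nth (tsum x f) N = fps_nth (tsum y (\<lambda>a. f (\<pi> a))) N"
    using assms by (simp add: tsum_def sum.reindex inj_on_subset[OF bij_is_inj])
qed

lemma case_prod_eta2: "(\<lambda>(b, c). f b c) = (\<lambda>p. f (fst p) (snd p))"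
  by auto

subsection \<open>Linear endomorphisms\<close>

text \<open>Linear endomorphisms carry an evident ring structure. Functionals with their convolution
  product are mapped into this ring below, so that the lemmas on matrices over a ring apply to
  matrix coefficients.\<close>

typedef 'b tend = "{f :: 'b tfree \<Rightarrow> 'b tfree. tmlin f}"
  morphisms tapp Abs_tend
  by (rule exI[of _ id]) (simp add: tmlin_def)

setup_lifting type_definition_tend

lemma tscale_simps: "tscale c 0 = 0" "tscale c (x + y) = tscale c x + tscale c y"
  "tscale c (- x) = - tscale c x" "tscale c (x - y) = tscale c x - tscale c y"
  "tscale c (tscale d x) = tscale (c * d) x" "tscale 1 x = x" "tscale (c + d) x = tscale c x + tscale d x"
  by (transfer; simp add: algebra_simps)+

lemma tmlin_tapp: "tmlin (tapp a)"
  using tapp[of a] by simp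

instantiation tend :: (type) ring_1
begin

lift_definition zero_tend :: "'a tend" is "\<lambda>_. 0"
  by (simp add: tmlin_def tscale_simps)
lift_definition one_tend :: "'a tend" is "\<lambda>x. x"
  by (simp add: tmlin_def)
lift_definition plus_tend :: "'a tend \<Rightarrow> 'a tend \<Rightarrow> 'a tend" is "\<lambda>f g x. f x + g x"
  by (auto simp: tmlin_def tscale_simps algebra_simps)
lift_definition uminus_tend :: "'a tend \<Rightarrow> 'a tend" is "\<lambda>f x. - f x"
  by (auto simp: tmlin_def tscale_simps)
lift_definition minus_tend :: "'a tend \<Rightarrow> 'a tend \<Rightarrow> 'a tend" is "\<lambda>f g x. f x - g x"
  by (auto simp: tmlin_def tscale_simps algebra_simps)
lift_definition times_tend :: "'a tend \<Rightarrow> 'a tend \<Rightarrow> 'a tend" is "\<lambda>f g x. f (g x)"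
  by (auto simp: tmlin_def)

instance
proof
  show "(0 :: 'a tend) \<noteq> 1"
  proof
    assume "(0 :: 'a tend) = 1"
    then have "(\<lambda>_. 0) = (\<lambda>x :: 'a tfree. x)" by transfer
    from fun_cong[OF this, of "tbasis undefined"]
    have "(0 :: 'a tfree) = tbasis undefined" .
    from arg_cong[OF this, of "\<lambda>x. coord x undefined"] show False
      by (simp add: coord_simps)
  qed
qed (transfer; auto simp: tmlin_def algebra_simps fun_eq_iff)+

end

lift_definition kscal :: "complex fps \<Rightarrow> 'b tend" is tscale
  by (simp add: tmlin_def tscale_simps tscale_simps mult.commute)

lemma tapp_simps: "tapp (a + b) x = tapp a x + tapp b x" "tapp (a * b) x = tapp a (tapp b x)"
  "tapp 1 x = x" "tapp 0 x = 0" "tapp (kscal c) x = tscale c x"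
  by (simp_all add: plus_tend.rep_eq times_tend.rep_eq one_tend.rep_eq zero_tend.rep_eq kscal.rep_eq)

lemma tend_eqI: "(\<And>x. tapp a x = tapp b x) \<Longrightarrow> a = b"
  using tapp_inject[of a b] by (auto simp: fun_eq_iff)

lemma rhom_kscal: "rhom kscal"
  by (rule rhomI; rule tend_eqI)
     (simp_all add: tapp_simps tscale_simps tscale_simps
       tscale_simps)

lemma central_kscal: "central (kscal c)"
  unfolding central_def
  by (intro allI tend_eqI) (simp add: tapp_simps tmlinD(2)[OF tmlin_tapp])

definition klin :: "('b tend \<Rightarrow> complex fps) \<Rightarrow> bool" where
  "klin f \<longleftrightarrow> (\<forall>a b. f (a + b) = f a + f b) \<and> (\<forall>c a. f (kscal c * a) = c * f a)"

section \<open>Convolution\<close>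

definition conv :: "'b hopf \<Rightarrow> ('b tfree \<Rightarrow> complex fps) \<Rightarrow> ('b tfree \<Rightarrow> complex fps) \<Rightarrow> 'b tfree \<Rightarrow> complex fps" where
  "conv H \<phi> \<psi> h = tsum (comult H h) (\<lambda>(b, c). \<phi> (tbasis b) * \<psi> (tbasis c))"

text \<open>
  Convolution algebra elements act on the Hopf algebra by \<open>h \<mapsto> h\<^sub>1 \<phi>(h\<^sub>2)\<close>, which turns
  convolution into composition.
\<close>

definition conv_end :: "'b hopf \<Rightarrow> ('b tfree \<Rightarrow> complex fps) \<Rightarrow> 'b tend" where
  "conv_end H \<phi> = Abs_tend (\<lambda>h. textend (\<lambda>(b, c). tscale (\<phi> (tbasis c)) (tbasis b)) (comult H h))"

context
  fixes H :: "'b hopf"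
  assumes H: "topological_hopf_algebra H"
begin

lemma hopf_comult: "tmlin (comult H)" "\<And>x a b c. coord (tmap (comult H) id (comult H x)) ((a, b), c) =
                coord (tmap id (comult H) (comult H x)) (a, (b, c))"
  and hopf_counit: "tlin (counit H)"
    "\<And>x. textend (\<lambda>(b, c). tscale (counit H (tbasis b)) (tbasis c)) (comult H x) = x"
    "\<And>x. textend (\<lambda>(b, c). tscale (counit H (tbasis c)) (tbasis b)) (comult H x) = x"
    "counit H (hunit H) = 1"
  and hopf_antipode: "tmlin (antipode H)"
    "\<And>x. textend (\<lambda>(b, c). hmult H (antipode H (tbasis b)) (tbasis c)) (comult H x) =
            tscale (counit H x) (hunit H)"
    "\<And>x. textend (\<lambda>(b, c). hmult H (tbasis b) (antipode H (tbasis c))) (comult H x) =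
            tscale (counit H x) (hunit H)"
  using H unfolding topological_hopf_algebra_def by (auto intro: tmlin_hom tlin_hom)

lemma tlin_conv: "tlin (conv H \<phi> \<psi>)"
  unfolding conv_def by (rule tlin_tmlin[OF tlin_tsum hopf_comult(1)])

lemma tapp_conv_end: "tapp (conv_end H \<phi>) h = textend (\<lambda>(b, c). tscale (\<phi> (tbasis c)) (tbasis b)) (comult H h)"
proof -
  have "tmlin (\<lambda>h. textend (\<lambda>(b, c). tscale (\<phi> (tbasis c)) (tbasis b)) (comult H h))"
    by (simp add: tmlin_def tmlinD[OF tmlin_textend] tmlinD[OF hopf_comult(1)])
  then show ?thesis by (simp add: conv_end_def Abs_tend_inverse)
qed

lemma tlin_conv_end:
  assumes "tlin \<eta>"
  shows "\<eta> (tapp (conv_end H \<phi>) h) = conv H \<eta> \<phi> h"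
  unfolding tapp_conv_end tlin_textend[OF assms] conv_def
  by (simp add: case_prod_eta2 tlinD(2)[OF assms] mult.commute)

lemma conv_end_eqI:
  assumes "\<And>\<eta> h. tlin \<eta> \<Longrightarrow> \<eta> (tapp a h) = \<eta> (tapp b h)"
  shows "a = b"
  by (intro tend_eqI tfree_eqI assms tlin_coord)

lemma conv_counit: "tlin \<phi> \<Longrightarrow> conv H (counit H) \<phi> h = \<phi> h" "tlin \<phi> \<Longrightarrow> conv H \<phi> (counit H) h = \<phi> h"
  unfolding conv_def
  using tlin_textend[of \<phi> "\<lambda>(b, c). tscale (counit H (tbasis b)) (tbasis c)" "comult H h"]
    tlin_textend[of \<phi> "\<lambda>(b, c). tscale (counit H (tbasis c)) (tbasis b)" "comult H h"]
  by (simp_all add: case_prod_eta2 tlinD(2) mult.commute hopf_counit[unfolded case_prod_eta2])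

lemma conv_assoc:
  assumes "tlin \<eta>" "tlin \<phi>" "tlin \<psi>"
  shows "conv H (conv H \<eta> \<phi>) \<psi> h = conv H \<eta> (conv H \<phi> \<psi>) h"
proof -
  have "conv H (conv H \<eta> \<phi>) \<psi> h = tsum (tmap (comult H) id (comult H h))
      (\<lambda>p. \<eta> (tbasis (fst (fst p))) * \<phi> (tbasis (snd (fst p))) * \<psi> (tbasis (snd p)))"
    by (simp add: conv_def tmap_def tsum_textend case_prod_eta2 tsum_tens tsum_tbasis
        mult.commute[of _ "\<psi> _"] tsum_mult)
  also have "\<dots> = tsum (tmap id (comult H) (comult H h))
      (\<lambda>p. \<eta> (tbasis (fst p)) * \<phi> (tbasis (fst (snd p))) * \<psi> (tbasis (snd (snd p))))"
    \<comment> \<open>The bijection is the rebracketing of triples along which coassociativity is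
      stated coordinatewise.\<close>
    by (subst tsum_reindex[of "\<lambda>p. ((fst p, fst (snd p)), snd (snd p))" _
          "tmap id (comult H) (comult H h)"])
       (auto simp: hopf_comult(2) intro!: bij_betw_byWitness[where f' = "\<lambda>p. (fst (fst p), snd (fst p), snd p)"])
  also have "\<dots> = conv H \<eta> (conv H \<phi> \<psi>) h"
    by (simp add: conv_def tmap_def tsum_textend case_prod_eta2 tsum_tens tsum_tbasis
        mult.assoc tsum_mult)
  finally show ?thesis .
qed

text \<open>Applying first \<open>h \<mapsto> h1 \<psi>(h2)\<close> and then
  \<open>h \<mapsto> h1 \<phi>(h2)\<close> gives \<open>h1 \<phi>(h2) \<psi>(h3)\<close>, so the
  order of the factors is kept. Endomorphisms are compared by testing them against all functionals
  \<open>\<eta>\<close>.\<close>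

lemma conv_end_mult:
  assumes "tlin \<phi>" "tlin \<psi>"
  shows "conv_end H \<phi> * conv_end H \<psi> = conv_end H (conv H \<phi> \<psi>)"
  by (rule conv_end_eqI) (simp add: tapp_simps tlin_conv_end tlin_conv conv_assoc assms)

lemma conv_end_counit: "conv_end H (counit H) = 1"
  by (rule conv_end_eqI) (simp add: tapp_simps tlin_conv_end conv_counit)

lemma conv_end_add: "conv_end H (\<lambda>h. \<phi> h + \<psi> h) = conv_end H \<phi> + conv_end H \<psi>"
  by (rule conv_end_eqI) (simp add: tapp_simps tlin_conv_end conv_def tlinD case_prod_eta2 tsum_add distrib_left)

lemma conv_end_scale: "conv_end H (\<lambda>h. c * \<phi> h) = kscal c * conv_end H \<phi>"
  by (rule conv_end_eqI) (simp add: tapp_simps tlin_conv_end conv_def tlinD case_prod_eta2 mult.left_commute[of _ c] tsum_mult)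

lemma conv_end_0: "conv_end H (\<lambda>h. 0) = 0"
  using conv_end_scale[of 0 "\<lambda>_. 0"] by (simp add: rhom_0[OF rhom_kscal])

lemma conv_end_sum: "conv_end H (\<lambda>h. \<Sum>i\<in>A. \<phi> i h) = (\<Sum>i\<in>A. conv_end H (\<phi> i))"
  by (induction A rule: infinite_finite_induct) (auto simp: conv_end_0 conv_end_add)

text \<open>Recovers a functional from its endomorphism: the counit of \<open>h1 \<phi>(h2)\<close>
  is \<open>\<phi> h\<close>.\<close>

definition evalat :: "'b tfree \<Rightarrow> 'b tend \<Rightarrow> complex fps" where
  "evalat h a = counit H (tapp a h)"

lemma klin_evalat: "klin (evalat h)"
  by (simp add: klin_def evalat_def tapp_simps tlinD[OF hopf_counit(1)])

lemma evalat_conv_end: "tlin \<phi> \<Longrightarrow> evalat h (conv_end H \<phi>) = \<phi> h"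
  by (simp add: evalat_def tlin_conv_end[OF hopf_counit(1)] conv_counit)

end

subsection \<open>The basic representation\<close>

definition rsq :: "'b hopf \<Rightarrow> ('b tfree \<Rightarrow> complex fps^'n^'n) \<Rightarrow> ('b tend, 'n::finite) sq" where
  "rsq H \<rho> = sq (\<chi> i j. conv_end H (\<lambda>h. \<rho> h $ i $ j))"

definition rsq' :: "'b hopf \<Rightarrow> ('b tfree \<Rightarrow> complex fps^'n^'n) \<Rightarrow> ('b tend, 'n::finite) sq" where
  "rsq' H \<rho> = sq (\<chi> i j. conv_end H (\<lambda>h. \<rho> (antipode H h) $ i $ j))"

lemma mflip_mult:
  fixes M :: "'a::semiring_1^('n::finite \<times> 'n)^('n \<times> 'n)"
  shows "(mflip ** M) $ p $ q = M $ (snd p, fst p) $ q"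
  "(M ** mflip) $ p $ q = M $ p $ (snd q, fst q)"
proof -
  have "(if fst p = snd r \<and> snd p = fst r then 1 else 0) * m = (if r = (snd p, fst p) then m else 0)"
    "m * (if fst r = snd q \<and> snd r = fst q then 1 else 0) = (if r = (snd q, fst q) then m else 0)"
    for r :: "'n \<times> 'n" and m :: 'a
    by (auto simp: prod_eq_iff)
  then show "(mflip ** M) $ p $ q = M $ (snd p, fst p) $ q" "(M ** mflip) $ p $ q = M $ p $ (snd q, fst q)"
    by (simp_all add: matrix_matrix_mult_def mflip_def)
qed

lemma mx_rsq_nth: "mx (rsq H \<rho>) $ i $ j = conv_end H (\<lambda>h. \<rho> h $ i $ j)"
  "mx (rsq' H \<rho>) $ i $ j = conv_end H (\<lambda>h. \<rho> (antipode H h) $ i $ j)"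
  by (simp_all add: rsq_def rsq'_def mx_simps)

context
  fixes H :: "'b hopf" and \<rho> :: "'b tfree \<Rightarrow> complex fps^'n::finite^'n"
  assumes H: "topological_hopf_algebra H"
    and \<rho>_lin: "\<And>i j. tlin (\<lambda>h. \<rho> h $ i $ j)" and \<rho>_unit: "\<rho> (hunit H) = mat 1"
    and \<rho>_mult: "\<And>x y. \<rho> (hmult H x y) = \<rho> x ** \<rho> y"
begin

lemma \<rho>'_lin: "tlin (\<lambda>h. \<rho> (antipode H h) $ i $ j)"
  by (rule tlin_tmlin[OF \<rho>_lin hopf_antipode(1)[OF H]])

text \<open>Multiplicativity of the representation turns the two antipode axioms into the two
  statements that these matrices are inverse under convolution.\<close>

lemma rsq_inverse: "rsq' H \<rho> * rsq H \<rho> = 1" "rsq H \<rho> * rsq' H \<rho> = 1"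
proof -
  have conv: "(\<Sum>k\<in>UNIV. conv H (\<lambda>h. \<rho> (f h) $ i $ k) (\<lambda>h. \<rho> (g h) $ k $ j) h) = (if i = j then 1 else 0) * counit H h"
    if "textend (\<lambda>(b, c). hmult H (f (tbasis b)) (g (tbasis c))) (comult H h) = tscale (counit H h) (hunit H)"
    for f g i j h
  proof -
    have "(\<Sum>k\<in>UNIV. conv H (\<lambda>h. \<rho> (f h) $ i $ k) (\<lambda>h. \<rho> (g h) $ k $ j) h) =
      tsum (comult H h) (\<lambda>(b, c). \<rho> (hmult H (f (tbasis b)) (g (tbasis c))) $ i $ j)"
      by (simp add: conv_def \<rho>_mult matrix_matrix_mult_def case_prod_eta2 tsum_sum)
    also have "\<dots> = \<rho> (tscale (counit H h) (hunit H)) $ i $ j"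
      unfolding that[symmetric] tlin_textend[OF \<rho>_lin] by (simp add: case_prod_eta2)
    also have "\<dots> = counit H h * mat 1 $ i $ j"
      unfolding tlinD(2)[OF \<rho>_lin] \<rho>_unit ..
    finally show ?thesis by (simp add: mat_def)
  qed
  have e: "conv_end H (\<lambda>h. (if i = j then 1 else 0) * counit H h) = (if i = j then 1 else 0)" for i j :: 'n
    by (simp add: conv_end_0[OF H] conv_end_counit[OF H])
  show "rsq' H \<rho> * rsq H \<rho> = 1"
  proof (rule sq_eqI)
    fix i j
    have "mx (rsq' H \<rho> * rsq H \<rho>) $ i $ j = (\<Sum>k\<in>UNIV.
        conv_end H (conv H (\<lambda>h. \<rho> (antipode H h) $ i $ k) (\<lambda>h. \<rho> h $ k $ j)))"
      by (simp add: mx_times_nth mx_rsq_nth conv_end_mult[OF H] \<rho>_lin \<rho>'_lin)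
    also have "\<dots> = conv_end H (\<lambda>h. (if i = j then 1 else 0) * counit H h)"
      unfolding conv_end_sum[OF H, symmetric]
      by (rule arg_cong[of _ _ "conv_end H"], rule ext, rule conv[of "antipode H" "\<lambda>h. h"])
         (rule hopf_antipode(2)[OF H])
    finally show "mx (rsq' H \<rho> * rsq H \<rho>) $ i $ j = mx 1 $ i $ j"
      by (simp add: e mx_simps mat_def)
  qed
  show "rsq H \<rho> * rsq' H \<rho> = 1"
  proof (rule sq_eqI)
    fix i j
    have "mx (rsq H \<rho> * rsq' H \<rho>) $ i $ j = (\<Sum>k\<in>UNIV.
        conv_end H (conv H (\<lambda>h. \<rho> h $ i $ k) (\<lambda>h. \<rho> (antipode H h) $ k $ j)))"
      by (simp add: mx_times_nth mx_rsq_nth conv_end_mult[OF H] \<rho>_lin \<rho>'_lin)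
    also have "\<dots> = conv_end H (\<lambda>h. (if i = j then 1 else 0) * counit H h)"
      unfolding conv_end_sum[OF H, symmetric]
      by (rule arg_cong[of _ _ "conv_end H"], rule ext, rule conv[of "\<lambda>h. h" "antipode H"])
         (rule hopf_antipode(3)[OF H])
    finally show "mx (rsq H \<rho> * rsq' H \<rho>) $ i $ j = mx 1 $ i $ j"
      by (simp add: e mx_simps mat_def)
  qed
qed

lemma rep2_nth: "rep2 \<rho> z $ p $ q =
    tsum z (\<lambda>(b, c). \<rho> (tbasis b) $ fst p $ fst q * \<rho> (tbasis c) $ snd p $ snd q)"
  by (simp add: rep2_def mtens_def)

lemma rep2_tens: "rep2 \<rho> (tens x y) $ p $ q = \<rho> x $ fst p $ fst q * \<rho> y $ snd p $ snd q"
proof -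
  have "rep2 \<rho> (tens x y) $ p $ q = \<rho> y $ snd p $ snd q * tsum x (\<lambda>b. \<rho> (tbasis b) $ fst p $ fst q)"
    by (simp add: rep2_nth tsum_tens tsum_mult tlin_eq_tsum[OF \<rho>_lin, symmetric]
        mult.commute[of _ "\<rho> y $ _ $ _"])
  then show ?thesis by (simp add: tlin_eq_tsum[OF \<rho>_lin, symmetric] mult.commute)
qed

lemma rep2_tmult: "rep2 \<rho> (hmult2 H z w) = rep2 \<rho> z ** rep2 \<rho> w"
proof -
  have "rep2 \<rho> (hmult2 H z w) $ p $ q = (rep2 \<rho> z ** rep2 \<rho> w) $ p $ q" for p q
  proof -
    have "rep2 \<rho> (hmult2 H z w) $ p $ q = tsum z (\<lambda>u. tsum w (\<lambda>v.
        rep2 \<rho> (tens (hmult H (tbasis (fst u)) (tbasis (fst v))) (hmult H (tbasis (snd u)) (tbasis (snd v)))) $ p $ q))"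
      by (simp add: tmult_def rep2_def tsum_textend case_prod_eta2)
    also have "\<dots> = tsum z (\<lambda>u. tsum w (\<lambda>v. \<Sum>s\<in>UNIV. \<Sum>t\<in>UNIV.
        (\<rho> (tbasis (fst u)) $ fst p $ s * \<rho> (tbasis (snd u)) $ snd p $ t) *
        (\<rho> (tbasis (fst v)) $ s $ fst q * \<rho> (tbasis (snd v)) $ t $ snd q)))"
      by (simp add: rep2_tens \<rho>_mult matrix_matrix_mult_def sum_product mult_ac)
    also have "\<dots> = (\<Sum>s\<in>UNIV. \<Sum>t\<in>UNIV. rep2 \<rho> z $ p $ (s, t) * rep2 \<rho> w $ (s, t) $ q)"
      by (simp add: tsum_sum tsum_mult rep2_nth case_prod_eta2 mult.commute[of _ "tsum w _"])
    finally show ?thesis by (simp add: matrix_matrix_mult_def sum_UNIV_prod)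
  qed
  then show ?thesis by (simp add: vec_eq_iff)
qed

lemma rep2_tflip: "rep2 \<rho> (tflip z) $ p $ q = rep2 \<rho> z $ (snd p, fst p) $ (snd q, fst q)"
  by (simp add: tflip_def rep2_nth tsum_textend case_prod_eta2 tsum_tens tsum_tbasis mult.commute)

text \<open>The universal R-matrix intertwines the coproduct with its opposite; the flip contained
  in \<open>braid R\<close> undoes the exchange and leaves a commutation relation. The normalizing
  scalar passes through.\<close>

lemma rep2_comult_commute:
  assumes qt: "\<And>x. hmult2 H (tflip (comult H x)) (rmatrix H) = hmult2 H (rmatrix H) (comult H x)"
    and R: "R = map_matrix ((*) c) (rep2 \<rho> (rmatrix H))"
  shows "braid R ** rep2 \<rho> (comult H h) = rep2 \<rho> (comult H h) ** braid R"
proof -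
  have m: "map_matrix ((*) c) A ** B = map_matrix ((*) c) (A ** B)"
    "A ** map_matrix ((*) c) B = map_matrix ((*) c) (A ** B)"
    for A B :: "complex fps^('n \<times> 'n)^('n \<times> 'n)"
    by (simp_all add: vec_eq_iff matrix_matrix_mult_def sum_distrib_left mult_ac)
  have "rep2 \<rho> (tflip (comult H h)) ** rep2 \<rho> (rmatrix H) = rep2 \<rho> (rmatrix H) ** rep2 \<rho> (comult H h)"
    using qt[of h] by (metis rep2_tmult)
  then have R': "R ** rep2 \<rho> (comult H h) = rep2 \<rho> (tflip (comult H h)) ** R"
    unfolding R m by simp
  have fl: "mflip ** rep2 \<rho> (tflip z) = rep2 \<rho> z ** mflip" for z
    by (simp add: vec_eq_iff mflip_mult rep2_tflip)
  show ?thesis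
    unfolding braid_def matrix_mul_assoc[symmetric] R'
    unfolding matrix_mul_assoc fl ..
qed

lemma rsq_rsq_nth: "mx (lleg (rsq H \<rho>) * rleg (rsq H \<rho>)) $ p $ q = conv_end H (\<lambda>h. rep2 \<rho> (comult H h) $ p $ q)"
  unfolding lleg_rleg_nth
  by (simp add: mx_rsq_nth conv_end_mult[OF H] \<rho>_lin)
     (simp add: conv_def[abs_def] rep2_nth)

text \<open>The entries of the product of the two legs are the matrix coefficients of
  \<open>rep2 \<rho> (comult H h)\<close> as functionals of \<open>h\<close>. The relation is
  therefore commutation of \<open>S\<close> with the image of the coproduct, for all
  \<open>h\<close> at once.\<close>

lemma braid_rsq:
  assumes "\<And>h. S ** rep2 \<rho> (comult H h) = rep2 \<rho> (comult H h) ** S"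
  shows "smap kscal (sq S) * (lleg (rsq H \<rho>) * rleg (rsq H \<rho>)) =
    lleg (rsq H \<rho>) * rleg (rsq H \<rho>) * smap kscal (sq S)"
proof (rule sq_eqI)
  fix p q
  have "mx (smap kscal (sq S) * (lleg (rsq H \<rho>) * rleg (rsq H \<rho>))) $ p $ q =
      conv_end H (\<lambda>h. \<Sum>r\<in>UNIV. S $ p $ r * rep2 \<rho> (comult H h) $ r $ q)"
    unfolding mx_times_nth[of "smap _ _"] rsq_rsq_nth mx_smap_nth conv_end_sum[OF H] conv_end_scale[OF H]
    by (simp add: mx_simps)
  also have "(\<lambda>h. \<Sum>r\<in>UNIV. S $ p $ r * rep2 \<rho> (comult H h) $ r $ q) =
      (\<lambda>h. \<Sum>r\<in>UNIV. S $ r $ q * rep2 \<rho> (comult H h) $ p $ r)"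
  proof
    fix h
    have "(S ** rep2 \<rho> (comult H h)) $ p $ q = (rep2 \<rho> (comult H h) ** S) $ p $ q"
      by (simp add: assms)
    then show "(\<Sum>r\<in>UNIV. S $ p $ r * rep2 \<rho> (comult H h) $ r $ q) =
      (\<Sum>r\<in>UNIV. S $ r $ q * rep2 \<rho> (comult H h) $ p $ r)"
      by (simp add: matrix_matrix_mult_def mult.commute)
  qed
  also have "conv_end H \<dots> = mx (lleg (rsq H \<rho>) * rleg (rsq H \<rho>) * smap kscal (sq S)) $ p $ q"
    unfolding mx_times_nth[of _ "smap _ _"] rsq_rsq_nth mx_smap_nth conv_end_sum[OF H] conv_end_scale[OF H]
    by (simp add: mx_simps centralD[OF central_kscal])
  finally show "mx (smap kscal (sq S) * (lleg (rsq H \<rho>) * rleg (rsq H \<rho>))) $ p $ q =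
     mx (lleg (rsq H \<rho>) * rleg (rsq H \<rho>) * smap kscal (sq S)) $ p $ q" .
qed

end

section \<open>Inverses of matrices of power series\<close>

lemma fps_nth_mx_power:
  fixes z :: "(complex fps, 'm::finite) sq"
  assumes "\<And>i j. fps_nth (mx z $ i $ j) 0 = 0" "k < m"
  shows "fps_nth (mx (z ^ m) $ i $ j) k = 0"
  using assms(2)
proof (induction m arbitrary: k i j)
  case (Suc m)
  have "fps_nth (mx z $ i $ s * mx (z ^ m) $ s $ j) k = 0" for s
    unfolding fps_mult_nth
  proof (intro sum.neutral ballI)
    fix a assume "a \<in> {0..k}"
    then show "fps_nth (mx z $ i $ s) a * fps_nth (mx (z ^ m) $ s $ j) (k - a) = 0"
      using Suc assms(1) by (cases "a = 0") auto
  qed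
  then show ?case by (simp add: mx_times_nth fps_sum_nth)
qed simp

text \<open>The inverse of \<open>1 - z\<close> is the geometric series, which is finite at each order.\<close>

lemma fps_matrix_geometric:
  fixes z :: "(complex fps, 'm::finite) sq"
  assumes z: "\<And>i j. fps_nth (mx z $ i $ j) 0 = 0"
  shows "\<exists>v. (1 - z) * v = 1 \<and> v * (1 - z) = 1"
proof -
  define G where "G k = (\<Sum>m\<le>k. z ^ m)" for k
  have G: "(1 - z) * G k = 1 - z ^ Suc k" "G k * (1 - z) = 1 - z ^ Suc k" for k
  proof (induction k)
    case (Suc k)
    have *: "G (Suc k) = G k + z ^ Suc k" by (simp add: G_def)
    have "(1 - z) * G (Suc k) = 1 - z ^ Suc k + (z ^ Suc k - z * z ^ Suc k)"
      by (simp only: * distrib_left Suc) (simp only: left_diff_distrib mult_1_left)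
    then show "(1 - z) * G (Suc k) = 1 - z ^ Suc (Suc k)" by simp
    have "G (Suc k) * (1 - z) = 1 - z ^ Suc k + (z ^ Suc k - z ^ Suc k * z)"
      by (simp only: * distrib_right Suc) (simp only: right_diff_distrib mult_1_right)
    then show "G (Suc k) * (1 - z) = 1 - z ^ Suc (Suc k)"
      unfolding power_Suc2[of z "Suc k"] by simp
  qed (simp_all add: G_def)
  \<comment> \<open>The coefficient of order \<open>k\<close> is taken from the partial sum
    \<open>G k\<close>; all later partial sums agree with it at that order.\<close>
  define v where "v = sq (\<chi> i j. Abs_fps (\<lambda>k. fps_nth (mx (G k) $ i $ j) k))"
  have v: "fps_nth (mx v $ i $ j) a = fps_nth (mx (G k) $ i $ j) a" if "a \<le> k" for i j a k
  proof -
    have "G k = G a + (\<Sum>m\<in>{a<..k}. z ^ m)"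
      unfolding G_def using that by (subst sum.union_disjoint[symmetric]) (auto intro: sum.cong)
    moreover have "fps_nth (mx (\<Sum>m\<in>{a<..k}. z ^ m) $ i $ j) a = 0"
      by (auto simp: mx_sum fps_sum_nth intro!: sum.neutral fps_nth_mx_power[OF z])
    ultimately show ?thesis by (simp add: v_def mx_simps(3,7))
  qed
  have "(1 - z) * v = 1"
  proof (intro sq_eqI fps_ext)
    fix i j k
    have "fps_nth (mx ((1 - z) * v) $ i $ j) k = fps_nth (mx ((1 - z) * G k) $ i $ j) k"
      unfolding mx_times_nth fps_sum_nth fps_mult_nth by (intro sum.cong refl) (simp add: v[of _ k])
    also have "\<dots> = fps_nth (mx 1 $ i $ j) k"
      unfolding G by (simp add: mx_simps(4) fps_nth_mx_power[OF z] del: power_Suc)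
    finally show "fps_nth (mx ((1 - z) * v) $ i $ j) k = fps_nth (mx 1 $ i $ j) k" .
  qed
  moreover have "v * (1 - z) = 1"
  proof (intro sq_eqI fps_ext)
    fix i j k
    have "fps_nth (mx (v * (1 - z)) $ i $ j) k = fps_nth (mx (G k * (1 - z)) $ i $ j) k"
      unfolding mx_times_nth fps_sum_nth fps_mult_nth by (intro sum.cong refl) (simp add: v[of _ k])
    also have "\<dots> = fps_nth (mx 1 $ i $ j) k"
      unfolding G by (simp add: mx_simps(4) fps_nth_mx_power[OF z] del: power_Suc)
    finally show "fps_nth (mx (v * (1 - z)) $ i $ j) k = fps_nth (mx 1 $ i $ j) k" .
  qed
  ultimately show ?thesis by blast
qed

text \<open>Dividing by \<open>c\<close> makes the constant term the identity, so the geometric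
  series applies. The use is for the partial transpose of \<open>R\<close>, where it guarantees that
  \<open>matrix_inv\<close> in \<open>rstar\<close> is a genuine inverse.\<close>

lemma fps_matrix_inverse:
  fixes u :: "(complex fps, 'm::finite) sq"
  assumes u: "smap (\<lambda>f. fps_nth f 0) u = scal c" "c \<noteq> 0"
  shows "\<exists>v. u * v = 1 \<and> v * u = 1"
proof -
  define a where "a = (scal (fps_const (1 / c)) :: (complex fps, 'm) sq)"
  define b where "b = (scal (fps_const c) :: (complex fps, 'm) sq)"
  have ab: "a * b = 1" "b * a = 1" using u(2)
    by (simp_all add: a_def b_def rhom_1[OF rhom_scal] flip: rhom_mult[OF rhom_scal])
  have ca: "central a" by (simp add: a_def central_scal central_comm)
  have "fps_nth (mx (1 - a * u) $ i $ j) 0 = 0" for i j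
  proof -
    have "fps_nth (mx u $ i $ j) 0 = (if i = j then c else 0)"
      using arg_cong[OF u(1), of "\<lambda>x. mx x $ i $ j"] by (simp add: mx_smap_nth mx_scal_nth)
    then show ?thesis using u(2)
      by (simp add: mx_simps(2,4) mat_def a_def mx_scal_times_nth)
  qed
  from fps_matrix_geometric[OF this] obtain v where v: "a * u * v = 1" "v * (a * u) = 1" by auto
  have "u * (a * v) = 1" "(a * v) * u = 1"
    using v ca by (metis central_def mult.assoc)+
  then show ?thesis by blast
qed

lemma invertible_sq: "u * v = 1 \<Longrightarrow> v * u = 1 \<Longrightarrow> sq (matrix_inv (mx u)) = v"
proof -
  assume uv: "u * v = 1" "v * u = 1"
  have "mx u ** mx v = mat 1" "mx v ** mx u = mat 1"
    using arg_cong[OF uv(1), of mx] arg_cong[OF uv(2), of mx] by (simp_all add: mx_simps)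
  then have inv: "invertible (mx u)" unfolding invertible_def by blast
  have "mx u ** matrix_inv (mx u) = mat 1"
    using someI_ex[OF inv[unfolded invertible_def]] unfolding matrix_inv_def by blast
  then have "u * sq (matrix_inv (mx u)) = 1"
    by (intro sq_eqI) (simp add: mx_simps)
  moreover have "v * (u * sq (matrix_inv (mx u))) = sq (matrix_inv (mx u))"
    by (simp add: mult.assoc[symmetric] uv(2))
  ultimately show ?thesis by simp
qed

subsection \<open>Invariance of the quantum trace\<close>

lemma sum_rotate: "(\<Sum>a\<in>A. \<Sum>b\<in>B. \<Sum>s\<in>C. f a b s) = (\<Sum>s\<in>C. \<Sum>a\<in>A. \<Sum>b\<in>B. f a b s)"
proof -
  have "(\<Sum>a\<in>A. \<Sum>b\<in>B. \<Sum>s\<in>C. f a b s) = (\<Sum>a\<in>A. \<Sum>s\<in>C. \<Sum>b\<in>B. f a b s)"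
    by (intro sum.cong refl sum.swap)
  also have "\<dots> = (\<Sum>s\<in>C. \<Sum>a\<in>A. \<Sum>b\<in>B. f a b s)" by (rule sum.swap)
  finally show ?thesis .
qed

context
  fixes T T' :: "('b tend, 'n::finite) sq" and R :: "complex fps^('n \<times> 'n)^('n \<times> 'n)"
    and ui :: "(complex fps, 'n \<times> 'n) sq"
  assumes T: "T' * T = 1" "T * T' = 1"
    and frt: "smap kscal (sq (braid R)) * (lleg T * rleg T) = lleg T * rleg T * smap kscal (sq (braid R))"
    and ui: "sq (transpose1 R) * ui = 1" "ui * sq (transpose1 R) = 1"
begin

abbreviation "kR \<equiv> smap kscal (sq R) :: ('b tend, 'n \<times> 'n) sq"

lemma frt_R: "kR * (lleg T * rleg T) = rleg T * lleg T * kR"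
proof (rule sq_eqI)
  fix p q
  have S: "mx (smap kscal (sq (braid R))) $ (a, b) $ q = mx kR $ (b, a) $ q" for a b q
    by (simp add: mx_smap_nth mx_simps braid_def mflip_mult)
  have "mx (kR * (lleg T * rleg T)) $ p $ q =
      mx (smap kscal (sq (braid R)) * (lleg T * rleg T)) $ (snd p, fst p) $ q"
    unfolding mx_times_nth[of "smap _ _"] S by simp
  also have "\<dots> = (\<Sum>a\<in>UNIV. \<Sum>b\<in>UNIV. mx T $ snd p $ a * mx T $ fst p $ b *
      mx (smap kscal (sq (braid R))) $ (a, b) $ q)"
    unfolding frt mx_times_nth[of _ "smap _ _"] sum_UNIV_prod lleg_rleg_nth by simp
  also have "\<dots> = (\<Sum>a\<in>UNIV. \<Sum>b\<in>UNIV. mx T $ snd p $ a * mx T $ fst p $ b * mx kR $ (b, a) $ q)"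
    by (simp only: S)
  also have "\<dots> = mx (rleg T * lleg T * kR) $ p $ q"
    unfolding mx_times_nth[of _ "smap _ _"] sum_UNIV_prod rleg_lleg_nth by (subst sum.swap) simp
  finally show "mx (kR * (lleg T * rleg T)) $ p $ q = mx (rleg T * lleg T * kR) $ p $ q" .
qed

text \<open>Multiplying by the inverse in the second leg from both sides leaves one matrix on each
  side of \<open>R\<close>, the shape that can be transposed in the first leg alone.\<close>

lemma frt_R': "rleg T' * kR * lleg T = lleg T * kR * rleg T'"
proof -
  have r: "rleg T' * rleg T = 1" "rleg T * rleg T' = 1"
    using T by (simp_all add: rhom_1[OF rhom_rleg] flip: rhom_mult[OF rhom_rleg])
  have "rleg T' * kR * lleg T = rleg T' * (kR * (lleg T * rleg T)) * rleg T'"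
    by (simp add: mult.assoc r)
  also have "\<dots> = (rleg T' * rleg T) * lleg T * kR * rleg T'"
    unfolding frt_R by (simp add: mult.assoc)
  finally show ?thesis by (simp add: r)
qed

text \<open>The second-leg inverse of \<open>T\<close> and the first-leg transpose of
  \<open>T\<close>, with their entries multiplied in this order; \<open>tV\<close> has the opposite
  order. The entries need not commute, so the two are kept apart.\<close>

definition tW :: "('b tend, 'n \<times> 'n) sq" where
  "tW = sq (\<chi> p q. mx T' $ snd p $ snd q * mx T $ fst q $ fst p)"

definition tV :: "('b tend, 'n \<times> 'n) sq" where
  "tV = sq (\<chi> p q. mx T $ fst q $ fst p * mx T' $ snd p $ snd q)"

lemma mx_tW_tV: "mx tW $ p $ q = mx T' $ snd p $ snd q * mx T $ fst q $ fst p"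
  "mx tV $ p $ q = mx T $ fst q $ fst p * mx T' $ snd p $ snd q"
  by (simp_all add: tW_def tV_def mx_simps)

text \<open>Transposition of the first leg of \<open>frt_R'\<close>: the entry at \<open>p\<close>
  and \<open>q\<close> here is the entry there with the first components of \<open>p\<close> and
  \<open>q\<close> exchanged.\<close>

lemma tW_tV: "tW * smap kscal (sq (transpose1 R)) = smap kscal (sq (transpose1 R)) * tV"
proof (rule sq_eqI)
  fix p q :: "'n \<times> 'n"
  have "mx (tW * smap kscal (sq (transpose1 R))) $ p $ q =
     mx (rleg T' * kR * lleg T) $ (fst q, snd p) $ (fst p, snd q)"
    unfolding mult.assoc rleg_times_nth times_lleg_nth
    unfolding mx_times_nth mx_tW_tV mx_simps(7) mx_smap_nth transpose1_def sum_UNIV_prod sum_distrib_left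
    by (subst sum.swap) (simp add: mult.assoc centralD[OF central_kscal])
  also have "\<dots> = mx (lleg T * (kR * rleg T')) $ (fst q, snd p) $ (fst p, snd q)"
    using frt_R' by (simp only: mult.assoc)
  also have "\<dots> = mx (smap kscal (sq (transpose1 R)) * tV) $ p $ q"
    unfolding lleg_times_nth times_rleg_nth
    unfolding mx_times_nth mx_tW_tV mx_simps(7) mx_smap_nth transpose1_def sum_UNIV_prod sum_distrib_left
    by (simp add: mult.assoc[symmetric] centralD[OF central_kscal, symmetric])
  finally show "mx (tW * smap kscal (sq (transpose1 R))) $ p $ q =
     mx (smap kscal (sq (transpose1 R)) * tV) $ p $ q" .
qed

lemma tV_tW: "tV * smap kscal ui = smap kscal ui * tW"
proof -
  define u where "u = (smap kscal (sq (transpose1 R)) :: ('b tend, 'n \<times> 'n) sq)"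
  define v where "v = (smap kscal ui :: ('b tend, 'n \<times> 'n) sq)"
  have uv: "u * v = 1" "v * u = 1"
    using ui unfolding u_def v_def rhom_mult[OF rhom_smap[OF rhom_kscal], symmetric]
    by (simp_all add: rhom_1[OF rhom_smap[OF rhom_kscal]])
  have "tV * v = v * (u * tV) * v" by (simp add: mult.assoc[symmetric] uv)
  also have "\<dots> = v * (tW * u) * v" using tW_tV by (simp add: u_def)
  also have "\<dots> = v * tW" by (simp add: mult.assoc uv)
  finally show ?thesis by (simp add: v_def)
qed

lemma dmatrix_eq: "dmatrix \<nu> R $ i $ j = \<nu> * (\<Sum>s\<in>UNIV. mx ui $ (s, s) $ (i, j))"
proof -
  have "sq (matrix_inv (transpose1 R)) = ui"
    using invertible_sq[OF ui] by (simp add: mx_simps)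
  from arg_cong[OF this, of mx] have "matrix_inv (transpose1 R) = mx ui"
    by (simp add: mx_simps)
  then show ?thesis by (simp add: dmatrix_def rstar_def transpose1_def)
qed

text \<open>In \<open>tV_tW\<close>, take the rows \<open>(s, s)\<close> and sum over
  \<open>s\<close>. On the side of \<open>tW\<close> these rows of \<open>ui\<close> add up to
  \<open>D\<close> without the scalar \<open>\<nu>\<close>. On the side of \<open>tV\<close> the sum
  over \<open>s\<close> of \<open>T a s * T' s b\<close> is an entry of the identity, which leaves
  the same contraction of \<open>ui\<close>. The identity expresses that the quantum trace of a
  matrix with entries commuting with those of \<open>T\<close> and \<open>T'\<close> is unchanged by
  conjugation with \<open>T\<close>.\<close>

lemma dmatrix_invariant:
  "(\<Sum>a\<in>UNIV. \<Sum>b\<in>UNIV. kscal (dmatrix \<nu> R $ a $ b) * (mx T' $ b $ l * mx T $ i $ a)) =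
     kscal (dmatrix \<nu> R $ i $ l)"
proof -
  define d where "d a b = (\<Sum>s\<in>UNIV. kscal (mx ui $ (s, s) $ (a, b)) :: 'b tend)" for a b
  have D: "kscal (dmatrix \<nu> R $ a $ b) = kscal \<nu> * d a b" for a b
    by (simp add: dmatrix_eq d_def rhom_mult[OF rhom_kscal] rhom_sum[OF rhom_kscal])
  have TT': "(\<Sum>s\<in>UNIV. mx T $ a $ s * mx T' $ s $ b) = (if a = b then 1 else 0)" for a b
    using arg_cong[OF T(2), of "\<lambda>x. mx x $ a $ b"] by (simp add: mx_times_nth mx_simps(2) mat_def)
  have "(\<Sum>a\<in>UNIV. \<Sum>b\<in>UNIV. d a b * (mx T' $ b $ l * mx T $ i $ a)) =
      (\<Sum>s\<in>UNIV. mx (smap kscal ui * tW) $ (s, s) $ (i, l))"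
    unfolding mx_times_nth[of "smap _ _"] sum_UNIV_prod mx_smap_nth d_def sum_distrib_right
    by (simp only: mx_tW_tV fst_conv snd_conv) (rule sum_rotate)
  also have "\<dots> = (\<Sum>s\<in>UNIV. \<Sum>a\<in>UNIV. \<Sum>b\<in>UNIV.
      mx T $ a $ s * mx T' $ s $ b * kscal (mx ui $ (a, b) $ (i, l)))"
    unfolding tV_tW[symmetric] mx_times_nth[of _ "smap _ _"] sum_UNIV_prod mx_smap_nth
    by (simp add: mx_tW_tV)
  also have "\<dots> = (\<Sum>a\<in>UNIV. \<Sum>b\<in>UNIV. (\<Sum>s\<in>UNIV. mx T $ a $ s * mx T' $ s $ b) *
      kscal (mx ui $ (a, b) $ (i, l)))"
    unfolding sum_distrib_right by (rule sum_rotate[symmetric])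
  also have "\<dots> = d i l"
    by (simp add: TT' d_def if_distrib[of "\<lambda>a. a * _"] cong: if_cong)
  finally show ?thesis
    by (simp add: D mult.assoc flip: sum_distrib_left)
qed

end

subsection \<open>The coaction\<close>

definition coeffs_map :: "('k::ring_1 \<Rightarrow> 'm::ring_1) \<Rightarrow> ('x, 'k) free_algebra \<Rightarrow> ('x, 'm) free_algebra" where
  "coeffs_map f p = (\<Sum>w\<in>Poly_Mapping.keys p. Poly_Mapping.single w (f (Poly_Mapping.lookup p w)))"

lemma klin_0: "klin f \<Longrightarrow> f 0 = 0"
  unfolding klin_def by (metis add_cancel_left_left)

lemma klinD: "klin f \<Longrightarrow> f (a + b) = f a + f b" "klin f \<Longrightarrow> f (kscal c * a) = c * f a"
  "klin f \<Longrightarrow> f (a * kscal c) = c * f a"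
  by (simp_all add: klin_def centralD[OF central_kscal, symmetric])

lemma lookup_coeffs_map: "klin f \<Longrightarrow> Poly_Mapping.lookup (coeffs_map f p) w = f (Poly_Mapping.lookup p w)"
  by (auto simp: coeffs_map_def lookup_sum lookup_single when_def klin_0 not_in_keys_iff_lookup_eq_zero)

lemma coeffs_map_add: "klin f \<Longrightarrow> coeffs_map f (p + q) = coeffs_map f p + coeffs_map f q"
  by (rule poly_mapping_eqI) (simp add: lookup_coeffs_map lookup_add klinD)

lemma coeffs_map_single: "klin f \<Longrightarrow> coeffs_map f (Poly_Mapping.single w e) = Poly_Mapping.single w (f e)"
  by (rule poly_mapping_eqI) (simp add: lookup_coeffs_map lookup_single when_def klin_0)

lemma coeffs_map_0: "klin f \<Longrightarrow> coeffs_map f 0 = 0"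
  by (simp add: coeffs_map_def)

text \<open>The ideal \<open>I\<close> with extended scalars, tested on the linear functionals of the coefficients.\<close>

definition ext_ideal :: "('x, complex fps) free_algebra set \<Rightarrow> ('x, 'b tend) free_algebra set" where
  "ext_ideal I = {z. \<forall>f. klin f \<longrightarrow> coeffs_map f z \<in> I}"

text \<open>For a monomial factor, the word multiplies inside the free algebra, where
  \<open>I\<close> is an ideal, and the coefficient \<open>e\<close> is absorbed into the test
  functional: \<open>f (e x)\<close> and \<open>f (x e)\<close> are again linear because the ground
  ring acts centrally.\<close>

lemma two_sided_ext_ideal:
  assumes I: "two_sided I"
  shows "two_sided (ext_ideal I :: ('x, 'b tend) free_algebra set)"
proof -
  have add: "y + z \<in> ext_ideal I" if "y \<in> ext_ideal I" "z \<in> ext_ideal I" for y z :: "('x, 'b tend) free_algebra"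
    using that two_sided_add[OF I] by (auto simp: ext_ideal_def coeffs_map_add)
  have single: "a * z \<in> ext_ideal I" "z * a \<in> ext_ideal I"
    if z: "z \<in> ext_ideal I" and a: "a = Poly_Mapping.single v e" for a z :: "('x, 'b tend) free_algebra" and v e
  proof -
    have "coeffs_map f (a * z) = Poly_Mapping.single v 1 * coeffs_map (\<lambda>x. f (e * x)) z \<and> klin (\<lambda>x. f (e * x))"
      "coeffs_map f (z * a) = coeffs_map (\<lambda>x. f (x * e)) z * Poly_Mapping.single v 1 \<and> klin (\<lambda>x. f (x * e))"
      if f: "klin f" for f
    proof -
      have "e * (kscal c * x) = kscal c * (e * x)" for c x
        using centralD[OF central_kscal, of c] by (metis mult.assoc)
      then have l: "klin (\<lambda>x. f (e * x))" "klin (\<lambda>x. f (x * e))"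
        using f by (simp_all add: klin_def distrib_left distrib_right mult.assoc)
      show "coeffs_map f (a * z) = Poly_Mapping.single v 1 * coeffs_map (\<lambda>x. f (e * x)) z \<and> klin (\<lambda>x. f (e * x))"
        unfolding a using f l
        by (induction z rule: free_algebra_induct)
           (simp_all add: mult_single coeffs_map_single distrib_left coeffs_map_add)
      show "coeffs_map f (z * a) = coeffs_map (\<lambda>x. f (x * e)) z * Poly_Mapping.single v 1 \<and> klin (\<lambda>x. f (x * e))"
        unfolding a using f l
        by (induction z rule: free_algebra_induct)
           (simp_all add: mult_single coeffs_map_single distrib_right coeffs_map_add)
    qed
    then show "a * z \<in> ext_ideal I" "z * a \<in> ext_ideal I"
      using z two_sided_lmult[OF I] two_sided_rmult[OF I] by (simp_all add: ext_ideal_def)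
  qed
  have "a * z \<in> ext_ideal I \<and> z * a \<in> ext_ideal I" if "z \<in> ext_ideal I" for a z :: "('x, 'b tend) free_algebra"
    by (induction a rule: free_algebra_induct)
       (use that single add in \<open>auto simp: distrib_left distrib_right\<close>)
  moreover have "0 \<in> (ext_ideal I :: ('x, 'b tend) free_algebra set)"
    by (simp add: ext_ideal_def coeffs_map_0 two_sided_0[OF I])
  ultimately show ?thesis unfolding two_sided_def using add by blast
qed

abbreviation kscalar :: "complex fps \<Rightarrow> ('x, 'b tend) free_algebra" where "kscalar c \<equiv> scalar (kscal c)"

lemma kscalar: "rhom kscalar" "central (kscalar c)"
  by (intro rhom_comp[OF rhom_scalar rhom_kscal]) (intro central_scalar central_kscal)

definition ext_scalars :: "('x, complex fps) free_algebra \<Rightarrow> ('x, 'b tend) free_algebra" where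
  "ext_scalars = fhom kscalar gen"

lemma ext_scalars: "rhom ext_scalars" "ext_scalars (scalar c) = kscalar c" "ext_scalars (gen x) = gen x"
  unfolding ext_scalars_def by (intro rhom_fhom kscalar) (simp_all add: fhom_scalar[OF kscalar(1)] fhom_gen[OF kscalar(1)])

lemma ext_scalars_single: "ext_scalars (Poly_Mapping.single w c) = Poly_Mapping.single w (kscal c)"
  by (simp add: single_gens[of w] ext_scalars rhom_mult[OF ext_scalars(1)] rhom_prod_list[OF ext_scalars(1)] comp_def)

lemma coeffs_map_ext_scalars: "klin f \<Longrightarrow> coeffs_map f (scalar e * ext_scalars p) = scalar (f e) * p"
  by (induction p rule: free_algebra_induct)
     (simp_all add: ext_scalars_single mult_single coeffs_map_single klinD mult.commute list_plus
       rhom_add[OF ext_scalars(1)] distrib_left coeffs_map_add)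

lemma ext_scalars_ideal:
  assumes "two_sided I"
  shows "I \<subseteq> ext_scalars -` ext_ideal I"
  using two_sided_lmult[OF assms]
  by (auto simp: ext_ideal_def coeffs_map_ext_scalars[of _ 1, unfolded scalar_1 mult_1_left])

section \<open>Conjugation of the generating matrix\<close>

lemma gmat_commutes: "(gmat :: (('n::finite \<times> 'n, 'k::ring_1) free_algebra, 'n) sq) * scal (scalar e) = scal (scalar e) * gmat"
  by (rule sq_eqI) (simp add: mx_times_scal_nth mx_scal_times_nth mx_gmat_nth mult_single list_plus)

lemma commutes_scalars_entries:
  assumes "m * scal (scalar e) = scal (scalar e) * m"
  shows "mx m $ i $ j * scalar e = scalar e * mx m $ i $ j"
  using arg_cong[OF assms, of "\<lambda>x. mx x $ i $ j"] by (simp add: mx_times_scal_nth mx_scal_times_nth)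

lemma conj_power:
  fixes t t' x :: "'a::ring_1"
  assumes "t * t' = 1" "t' * t = 1"
  shows "(t' * x * t) ^ k = t' * x ^ k * t"
proof (induction k)
  case (Suc k)
  have "t' * x * t * (t' * x ^ k * t) = t' * x * (t * t') * x ^ k * t" by (simp add: mult.assoc)
  then show ?case using Suc assms by (simp add: mult.assoc)
qed (use assms in simp)

lemma conj_ring_eval:
  fixes t t' x :: "'a::ring_1"
  assumes "t * t' = 1" "t' * t = 1" "\<And>c. central (\<iota> c)"
  shows "ring_eval \<iota> P (t' * x * t) = t' * ring_eval \<iota> P x * t"
proof -
  have "\<iota> c * (t' * y * t) = t' * (\<iota> c * y) * t" for c y
    using assms(3)[of c] by (metis central_def mult.assoc)
  then show ?thesis
    by (simp add: ring_eval_def conj_power[OF assms(1,2)] sum_distrib_left sum_distrib_right)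
qed

text \<open>Put \<open>u = t1 t2\<close>. By assumption \<open>s\<close> commutes with
  \<open>u\<close>, and since \<open>g\<close> commutes with \<open>t1\<close>, conjugating
  \<open>g\<close> by \<open>t2\<close> is the same as conjugating it by \<open>u\<close>. Hence
  every term of the defect is conjugated by \<open>u\<close>.\<close>

lemma conj_rdefect:
  fixes s g t1 t2 t1' t2' c :: "'a::ring_1"
  assumes t: "t1 * t1' = 1" "t1' * t1 = 1" "t2 * t2' = 1" "t2' * t2 = 1"
    and s: "s * (t1 * t2) = t1 * t2 * s" and g: "g * t1 = t1 * g" "g * t1' = t1' * g" and c: "central c"
  shows "rdefect s c (t2' * g * t2) = t2' * t1' * rdefect s c g * (t1 * t2)"
proof -
  define u where "u = t1 * t2"
  define u' where "u' = t2' * t1'"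
  define L where "L = t2' * g * t2"
  have u: "u * u' = 1" "u' * u = 1"
    by (simp_all add: u_def u'_def mult.assoc t) (simp_all add: mult.assoc[symmetric] t)
  have su: "s * u = u * s" using s by (simp add: u_def)
  have "s * u' = u' * (u * s) * u'" by (simp add: mult.assoc[symmetric] u)
  also have "\<dots> = u' * s" by (simp add: su[symmetric] mult.assoc u)
  finally have su': "s * u' = u' * s" .
  \<comment> \<open>Between two copies of \<open>g\<close>, this exchanges \<open>t2\<close> for
    \<open>t1\<close>, which commutes with \<open>g\<close>.\<close>
  have "t2 * s * t2' = t1' * (t1 * t2 * s) * t2'" by (simp add: mult.assoc[symmetric] t)
  also have "\<dots> = t1' * (s * (t1 * t2)) * t2'" by (simp only: s)
  also have "\<dots> = t1' * s * t1" by (simp add: mult.assoc t)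
  finally have ts: "t2 * s * t2' = t1' * s * t1" .
  have L: "L = u' * g * u"
  proof -
    have "u' * g * u = t2' * (t1' * g) * t1 * t2" by (simp add: u_def u'_def mult.assoc)
    also have "\<dots> = t2' * g * (t1' * t1) * t2" by (simp add: g(2)[symmetric] mult.assoc)
    finally show ?thesis by (simp add: t L_def)
  qed
  have LsL: "L * s * L = u' * (g * s * g) * u"
  proof -
    have "L * s * L = t2' * g * (t2 * s * t2') * g * t2" by (simp add: L_def mult.assoc)
    also have "\<dots> = t2' * (g * t1') * s * (t1 * g) * t2" unfolding ts by (simp only: mult.assoc)
    also have "\<dots> = t2' * (t1' * g) * s * (g * t1) * t2" by (simp only: g)
    also have "\<dots> = u' * (g * s * g) * u" by (simp only: u_def u'_def mult.assoc)
    finally show ?thesis .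
  qed
  have "s * L * s * L = (s * u') * (g * s * g) * u" using LsL by (simp add: mult.assoc)
  then have 1: "s * L * s * L = u' * (s * g * s * g) * u" by (simp add: su' mult.assoc)
  have "L * (s * L * s) = (L * s * L) * s" by (simp only: mult.assoc)
  also have "\<dots> = u' * (g * s * g) * (u * s)" unfolding LsL by (simp only: mult.assoc)
  finally have 2: "L * (s * L * s) = u' * (g * (s * g * s)) * u" by (simp add: su[symmetric] mult.assoc)
  have 3: "s * L = u' * (s * g) * u" unfolding L mult.assoc[symmetric] su' by (simp add: mult.assoc)
  have 4: "L * s = u' * (g * s) * u" unfolding L mult.assoc su[symmetric] by (simp add: mult.assoc)
  have cu: "c * (u' * x * u) = u' * (c * x) * u" for x
    using c by (metis central_def mult.assoc)
  show ?thesis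
    unfolding rdefect_def L_def[symmetric] u_def[symmetric] u'_def[symmetric] 1 2
    unfolding 3 4
    by (simp add: right_diff_distrib left_diff_distrib cu)
qed

section \<open>Equivariance\<close>

lemma ext_scalars_commute: "scalar e * ext_scalars p = ext_scalars p * scalar e"
  by (induction p rule: free_algebra_induct)
     (simp_all add: ext_scalars_single mult_single list_plus centralD[OF central_kscal]
       rhom_add[OF ext_scalars(1)] distrib_left distrib_right)

definition poly_subst_ext :: "complex poly \<Rightarrow> ('n::finite \<times> 'n, 'b tend) free_algebra \<Rightarrow> ('n \<times> 'n, 'b tend) free_algebra" where
  "poly_subst_ext P = fhom scalar (\<lambda>x. ext_scalars (poly_subst P (gen x)))"

lemma rhom_poly_subst_ext: "rhom (poly_subst_ext P)"
  unfolding poly_subst_ext_def by (intro rhom_fhom_commute rhom_scalar ext_scalars_commute)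

lemma poly_subst_ext_scalar: "poly_subst_ext P (scalar e) = scalar e"
  unfolding poly_subst_ext_def by (rule fhom_scalar[OF rhom_scalar])

lemma poly_subst_ext_gen: "poly_subst_ext P (gen x) = ext_scalars (poly_subst P (gen x))"
  unfolding poly_subst_ext_def by (simp add: fhom_gen[OF rhom_scalar])

text \<open>Substitution replaces a word by an element with coefficients in the ground ring, and a
  functional linear over that ring passes through it.\<close>

lemma coeffs_map_poly_subst_ext:
  assumes "klin f"
  shows "coeffs_map f (poly_subst_ext P z) = poly_subst P (coeffs_map f z)"
proof (induction z rule: free_algebra_induct)
  case (single w e)
  have "poly_subst_ext P (Poly_Mapping.single w e) = scalar e * ext_scalars (prod_list (map (\<lambda>x. poly_subst P (gen x)) w))"
    by (simp add: poly_subst_ext_def fhom_single[OF rhom_scalar] rhom_prod_list[OF ext_scalars(1)] comp_def)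
  moreover have "poly_subst P (Poly_Mapping.single w c) = scalar c * prod_list (map (\<lambda>x. poly_subst P (gen x)) w)" for c
    by (simp add: single_gens[of w c] rhom_mult[OF rhom_poly_subst] rhom_prod_list[OF rhom_poly_subst] poly_subst_scalar comp_def)
  ultimately show ?case
    using assms by (simp add: coeffs_map_ext_scalars coeffs_map_single)
qed (simp add: coeffs_map_add[OF assms] rhom_add[OF rhom_poly_subst] rhom_add[OF rhom_poly_subst_ext])

lemma sum_words_Suc:
  fixes f :: "'x::finite list \<Rightarrow> 'a::comm_monoid_add"
  shows "(\<Sum>v\<in>{v. length v = Suc n}. f v) = (\<Sum>y\<in>UNIV. \<Sum>v\<in>{v. length v = n}. f (y # v))"
proof -
  have "{v :: 'x list. length v = Suc n} = (\<lambda>(y, v). y # v) ` (UNIV \<times> {v. length v = n})"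
    by (auto simp: image_iff length_Suc_conv)
  moreover have "inj_on (\<lambda>(y, v). y # v) (UNIV \<times> {v :: 'x list. length v = n})"
    by (auto simp: inj_on_def)
  ultimately show ?thesis
    by (simp add: sum.reindex sum.cartesian_product case_prod_unfold)
qed

context
  fixes H :: "'b hopf" and \<rho> :: "'b tfree \<Rightarrow> complex fps^'n::finite^'n"
  assumes H: "topological_hopf_algebra H"
    and \<rho>_lin: "\<And>i j. tlin (\<lambda>h. \<rho> h $ i $ j)" and \<rho>_unit: "\<rho> (hunit H) = mat 1"
    and \<rho>_mult: "\<And>x y. \<rho> (hmult H x y) = \<rho> x ** \<rho> y"
begin

abbreviation TT :: "(('n \<times> 'n, 'b tend) free_algebra, 'n) sq" where "TT \<equiv> smap scalar (rsq H \<rho>)"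
abbreviation TT' :: "(('n \<times> 'n, 'b tend) free_algebra, 'n) sq" where "TT' \<equiv> smap scalar (rsq' H \<rho>)"

definition cmat :: "(('n \<times> 'n, 'b tend) free_algebra, 'n) sq" where "cmat = TT' * gmat * TT"

definition coact :: "'n qmat \<Rightarrow> ('n \<times> 'n, 'b tend) free_algebra" where
  "coact = fhom kscalar (\<lambda>(i, j). mx cmat $ i $ j)"

lemma coact: "rhom coact" "coact (scalar c) = kscalar c" "coact (gen (i, j)) = mx cmat $ i $ j"
  unfolding coact_def by (intro rhom_fhom kscalar) (simp_all add: fhom_scalar[OF kscalar(1)] fhom_gen[OF kscalar(1)])

lemma TT: "TT' * TT = 1" "TT * TT' = 1"
  using rsq_inverse[OF H \<rho>_lin \<rho>_unit \<rho>_mult]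
  by (simp_all add: rhom_1[OF rhom_smap[OF rhom_scalar]] flip: rhom_mult[OF rhom_smap[OF rhom_scalar]])

lemma tlin_act_gen: "tlin (act_gen H \<rho> x y)"
  unfolding act_gen_def by (rule tlin_tmlin[OF tlin_tsum hopf_comult(1)[OF H]])

lemma tlin_act_word: "tlin (act_word H \<rho> u v)"
proof (cases u)
  case Nil
  then show ?thesis
  proof (cases v)
    case Nil
    have "act_word H \<rho> [] [] = counit H" by (rule ext) simp
    then show ?thesis using hopf_counit(1)[OF H] Nil \<open>u = []\<close> by simp
  next
    case (Cons y v')
    then have "act_word H \<rho> u v = (\<lambda>_. 0)" using Nil by (intro ext) simp
    then show ?thesis by (simp add: tlin_def)
  qed
next
  case Cons_u: (Cons x u')
  show ?thesis
  proof (cases v)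
    case Nil
    then have "act_word H \<rho> u v = (\<lambda>_. 0)" using Cons_u by (intro ext) simp
    then show ?thesis by (simp add: tlin_def)
  next
    case (Cons y v')
    have "act_word H \<rho> u v = conv H (act_gen H \<rho> x y) (act_word H \<rho> u' v')"
      using Cons Cons_u by (intro ext) (simp add: conv_def)
    then show ?thesis using tlin_conv[OF H] by simp
  qed
qed

lemma mx_cmat: "mx cmat $ i $ j = (\<Sum>y\<in>UNIV. Poly_Mapping.single [y] (conv_end H (act_gen H \<rho> (i, j) y)))"
proof -
  have g: "act_gen H \<rho> (i, j) (k, m) = conv H (\<lambda>h. \<rho> (antipode H h) $ i $ k) (\<lambda>h. \<rho> h $ m $ j)" for k m
    by (rule ext) (simp add: act_gen_def conv_def)
  have "mx cmat $ i $ j = (\<Sum>m\<in>UNIV. \<Sum>k\<in>UNIV. Poly_Mapping.single [(k, m)]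
      (mx (rsq' H \<rho>) $ i $ k * mx (rsq H \<rho>) $ m $ j))"
    unfolding cmat_def mx_times_nth[of "_ * _"] mx_times_nth mx_smap_nth mx_gmat_nth
    by (simp add: sum_distrib_right mult_single list_plus)
  also have "\<dots> = (\<Sum>k\<in>UNIV. \<Sum>m\<in>UNIV. Poly_Mapping.single [(k, m)] (conv_end H (act_gen H \<rho> (i, j) (k, m))))"
    by (subst sum.swap) (simp add: g mx_rsq_nth conv_end_mult[OF H] \<rho>_lin \<rho>'_lin[OF H \<rho>_lin \<rho>_unit \<rho>_mult])
  finally show ?thesis by (simp add: sum_UNIV_prod)
qed

text \<open>The recursion of \<open>act_word\<close> through the coproduct is a convolution product,
  hence a product of endomorphisms. Multiplying out the coaction of the letters thus records the
  action of all \<open>h\<close> on the word at once.\<close>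

lemma coact_word:
  "prod_list (map (\<lambda>(i, j). mx cmat $ i $ j) u) =
     (\<Sum>v\<in>{v. length v = length u}. Poly_Mapping.single v (conv_end H (act_word H \<rho> u v)))"
proof (induction u)
  case Nil
  have "act_word H \<rho> [] [] = counit H" by (rule ext) simp
  then show ?case by (simp add: conv_end_counit[OF H] scalar_1)
next
  case (Cons x u)
  have w: "conv_end H (act_gen H \<rho> x y) * conv_end H (act_word H \<rho> u v) = conv_end H (act_word H \<rho> (x # u) (y # v))" for y v
    unfolding conv_end_mult[OF H tlin_act_gen tlin_act_word]
    by (rule arg_cong[of _ _ "conv_end H"], rule ext) (simp add: conv_def)
  obtain i j where x: "x = (i, j)" by (cases x)
  show ?case
    unfolding list.map prod_list.Cons Cons.IH unfolding x prod.case mx_cmat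
    by (simp add: sum_words_Suc sum_product mult_single list_plus w[unfolded x] del: act_word.simps)
qed

lemma act_coact: "act H \<rho> h p = coeffs_map (evalat H h) (coact p)"
proof -
  note k = klin_evalat[OF H, of h]
  have s: "coeffs_map (evalat H h) (sum f A) = (\<Sum>x\<in>A. coeffs_map (evalat H h) (f x))"
    for f :: "'c \<Rightarrow> ('n \<times> 'n, 'b tend) free_algebra" and A
    by (induction A rule: infinite_finite_induct) (auto simp: coeffs_map_0[OF k] coeffs_map_add[OF k])
  show ?thesis
    unfolding coact_def fhom_def s coact_word sum_distrib_left mult_single act_def
    by (simp add: coeffs_map_single[OF k] list_plus klinD[OF k] evalat_conv_end[OF H] tlin_act_word)
qed

lemma smap_coact: "smap coact gmat = cmat"
  by (rule sq_eqI) (simp add: mx_smap_nth mx_gmat_nth coact)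

text \<open>Both sides are \<open>P\<close> evaluated at \<open>cmat\<close>: the left one as the
  conjugate of \<open>P\<close> at \<open>gmat\<close>, the right one because \<open>coact\<close>
  is a homomorphism.\<close>

lemma smap_poly_subst_ext: "smap (poly_subst_ext P) cmat = smap coact (smap (poly_subst P) gmat)"
proof -
  define pk where "pk = (\<lambda>x. ring_eval (\<lambda>a. scal (kscalar (fps_const a))) P x :: (('n \<times> 'n, 'b tend) free_algebra, 'n) sq)"
  have "smap (poly_subst_ext P) (smap scalar z) = (smap scalar z :: (('n \<times> 'n, 'b tend) free_algebra, 'n) sq)" for z
    by (rule sq_eqI) (simp add: mx_smap_nth poly_subst_ext_scalar)
  moreover have "smap (poly_subst_ext P) gmat = (pk gmat :: (('n \<times> 'n, 'b tend) free_algebra, 'n) sq)"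
  proof -
    have "smap (poly_subst_ext P) gmat = (smap ext_scalars (smap (poly_subst P) gmat) :: (('n \<times> 'n, 'b tend) free_algebra, 'n) sq)"
      by (rule sq_eqI) (simp add: mx_smap_nth mx_gmat_nth poly_subst_ext_gen)
    also have "\<dots> = pk (smap ext_scalars gmat)"
      unfolding smap_poly_subst ring_eval_rhom[OF rhom_smap[OF ext_scalars(1)]] smap_scal[OF ext_scalars(1)]
        ext_scalars(2) pk_def ..
    also have "smap ext_scalars gmat = (gmat :: (('n \<times> 'n, 'b tend) free_algebra, 'n) sq)"
      by (rule sq_eqI) (simp add: mx_smap_nth mx_gmat_nth ext_scalars)
    finally show ?thesis .
  qed
  ultimately have "smap (poly_subst_ext P) cmat = TT' * pk gmat * TT"
    unfolding cmat_def by (simp add: rhom_mult[OF rhom_smap[OF rhom_poly_subst_ext]])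
  also have "\<dots> = pk cmat"
    unfolding cmat_def pk_def
    by (rule conj_ring_eval[symmetric]) (simp_all add: TT central_scal kscalar(2))
  also have "\<dots> = smap coact (smap (poly_subst P) gmat)"
    unfolding smap_poly_subst ring_eval_rhom[OF rhom_smap[OF coact(1)]] smap_scal[OF coact(1)]
      coact(2) smap_coact pk_def ..
  finally show ?thesis .
qed

lemma coact_poly_subst: "coact (poly_subst P p) = poly_subst_ext P (coact p)"
proof (rule rhom_free_eq[of "\<lambda>p. coact (poly_subst P p)" "\<lambda>p. poly_subst_ext P (coact p)"])
  fix x :: "'n \<times> 'n"
  obtain i j where x: "x = (i, j)" by (cases x)
  show "coact (poly_subst P (gen x)) = poly_subst_ext P (coact (gen x))"
    using arg_cong[OF smap_poly_subst_ext[of P], of "\<lambda>m. mx m $ i $ j"]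
    by (simp add: mx_smap_nth mx_gmat_nth coact x)
qed (simp_all add: rhom_comp coact rhom_poly_subst rhom_poly_subst_ext poly_subst_scalar poly_subst_ext_scalar)

lemma act_poly_subst: "act H \<rho> h (poly_subst P p) = poly_subst P (act H \<rho> h p)"
  unfolding act_coact coact_poly_subst coeffs_map_poly_subst_ext[OF klin_evalat[OF H]] ..

text \<open>The entries of a power of \<open>gmat\<close> commute with the coefficients, so the
  factors from both sides of the conjugation can be gathered next to \<open>D\<close>, where
  \<open>inv\<close> removes them.\<close>

lemma mtr_coact:
  assumes inv: "\<And>i l. (\<Sum>a\<in>UNIV. \<Sum>b\<in>UNIV. kscal (D $ a $ b) * (mx (rsq' H \<rho>) $ b $ l * mx (rsq H \<rho>) $ i $ a)) =
     kscal (D $ i $ l)"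
  shows "mtr (smap kscalar (sq D) * cmat ^ k) = mtr (smap kscalar (sq D) * gmat ^ k)"
proof -
  define m where "m = (gmat :: (('n \<times> 'n, 'b tend) free_algebra, 'n) sq) ^ k"
  have "m * scal (scalar e) = scal (scalar e) * m" for e
    unfolding m_def by (rule power_commuting_commutes[OF gmat_commutes])
  note comm = commutes_scalars_entries[OF this]
  have "cmat ^ k = TT' * m * TT"
    unfolding cmat_def m_def by (rule conj_power[OF TT(2,1)])
  then have "mtr (smap kscalar (sq D) * cmat ^ k) = mtr (smap kscalar (sq D) * (TT' * (m * TT)))"
    by (simp add: mult.assoc)
  also have "\<dots> = (\<Sum>a\<in>UNIV. \<Sum>b\<in>UNIV. \<Sum>l\<in>UNIV. \<Sum>i\<in>UNIV.
      scalar (kscal (D $ a $ b) * (mx (rsq' H \<rho>) $ b $ l * mx (rsq H \<rho>) $ i $ a)) * mx m $ l $ i)"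
    unfolding mtr_def trace_def mx_times_nth mx_smap_nth sum_distrib_left mx_simps(7)
    by (simp add: comm rhom_mult[OF rhom_scalar] mult.assoc)
  also have "\<dots> = (\<Sum>l\<in>UNIV. \<Sum>i\<in>UNIV. (\<Sum>a\<in>UNIV. \<Sum>b\<in>UNIV.
      scalar (kscal (D $ a $ b) * (mx (rsq' H \<rho>) $ b $ l * mx (rsq H \<rho>) $ i $ a))) * mx m $ l $ i)"
    unfolding sum_distrib_right
    by (rule trans[OF sum_rotate]) (intro sum.cong refl sum_rotate)
  also have "\<dots> = (\<Sum>l\<in>UNIV. \<Sum>i\<in>UNIV. scalar (kscal (D $ i $ l)) * mx m $ l $ i)"
    by (simp only: inv flip: rhom_sum[OF rhom_scalar])
  also have "\<dots> = mtr (smap kscalar (sq D) * m)"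
    unfolding mtr_def trace_def mx_times_nth mx_smap_nth mx_simps(7) by (rule sum.swap)
  finally show ?thesis by (simp add: m_def)
qed

text \<open>The coaction maps the ideal into its extension, because conjugation by \<open>TT\<close>
  preserves each of the three families of relations. Evaluating the coefficients at \<open>h\<close>
  then gives the action.\<close>

lemma act_orbit_ideal:
  assumes frt: "smap kscal (sq S) * (lleg (rsq H \<rho>) * rleg (rsq H \<rho>)) =
      lleg (rsq H \<rho>) * rleg (rsq H \<rho>) * smap kscal (sq S)"
    and inv: "\<And>i l. (\<Sum>a\<in>UNIV. \<Sum>b\<in>UNIV. kscal (D $ a $ b) * (mx (rsq' H \<rho>) $ b $ l * mx (rsq H \<rho>) $ i $ a)) =
     kscal (D $ i $ l)"
    and p: "p \<in> orbit_ideal S D l ev blk"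
  shows "act H \<rho> h p \<in> orbit_ideal S D l ev blk"
proof -
  define I where "I = orbit_ideal S D l ev blk"
  have I: "two_sided I" unfolding I_def by (rule two_sided_orbit_ideal)
  define J where "J = (ext_ideal I :: ('n \<times> 'n, 'b tend) free_algebra set)"
  have J: "two_sided J" unfolding J_def by (rule two_sided_ext_ideal[OF I])
  note MJ = two_sided_mideal[OF J]
  define t where "t = fps_const (ev 1) * (fps_exp (-2) - 1)"
  define g where "g = (gmat :: (('n \<times> 'n, 'b tend) free_algebra, 'n) sq)"
  have ext: "kscalar = (\<lambda>c. ext_scalars (scalar c))" "g = smap ext_scalars gmat"
    by (simp add: ext_scalars) (rule sq_eqI, simp add: mx_smap_nth mx_gmat_nth ext_scalars g_def)
  have gen: "rdefect (smap kscalar (sq S)) (scal (kscalar (- qpar * t))) (rleg g) \<in> mideal J"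
     "ring_eval (\<lambda>a. scal (kscalar (fps_const a))) (\<Prod>i\<in>{1..l}. [:- ev i, 1:]) g \<in> mideal J"
     "\<And>k. k \<in> {1..l - 1} \<Longrightarrow> mtr (smap kscalar (sq D) * g ^ k) - kscalar (qtrace_value t l ev blk k) \<in> J"
  proof -
    have "orbit_ideal S D l ev blk \<subseteq> ext_scalars -` J"
      unfolding J_def I_def[symmetric] by (rule ext_scalars_ideal[OF I])
    note * = this[unfolded orbit_ideal_subset_vimage[where ev = ev, OF ext_scalars(1) J ext t_def]]
    then show "rdefect (smap kscalar (sq S)) (scal (kscalar (- qpar * t))) (rleg g) \<in> mideal J"
     "ring_eval (\<lambda>a. scal (kscalar (fps_const a))) (\<Prod>i\<in>{1..l}. [:- ev i, 1:]) g \<in> mideal J"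
     "\<And>k. k \<in> {1..l - 1} \<Longrightarrow> mtr (smap kscalar (sq D) * g ^ k) - kscalar (qtrace_value t l ev blk k) \<in> J"
      by blast+
  qed
  have lr: "smap scalar (lleg x) = lleg (smap scalar x)" "smap scalar (rleg x) = rleg (smap scalar x)"
    for x :: "('b tend, 'n) sq"
    by (rule smap_lleg[OF rhom_scalar] smap_rleg[OF rhom_scalar])+
  have s: "smap kscalar (sq S) * (lleg TT * rleg TT) = lleg TT * rleg TT * smap kscalar (sq S)"
  proof -
    have ks: "smap kscalar (sq S) = smap scalar (smap kscal (sq S))"
      by (rule sq_eqI) (simp add: mx_smap_nth)
    show ?thesis
      using arg_cong[OF frt, of "smap scalar"]
      unfolding rhom_mult[OF rhom_smap[OF rhom_scalar]] lr ks .
  qed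
  have gc: "rleg g * lleg (smap scalar x) = lleg (smap scalar x) * rleg g" for x
    by (rule lleg_rleg_commute[symmetric])
       (simp add: g_def mx_smap_nth mx_gmat_nth mult_single list_plus)
  have inv_legs: "lleg TT * lleg TT' = 1" "lleg TT' * lleg TT = 1" "rleg TT * rleg TT' = 1" "rleg TT' * rleg TT = 1"
    using TT by (simp_all add: rhom_1[OF rhom_lleg] rhom_1[OF rhom_rleg]
        flip: rhom_mult[OF rhom_lleg] rhom_mult[OF rhom_rleg])
  have rl: "rleg cmat = rleg TT' * rleg g * rleg TT"
    unfolding cmat_def g_def by (simp add: rhom_mult[OF rhom_rleg])
  have ck: "central (scal (kscalar c) :: (('n \<times> 'n, 'b tend) free_algebra, 'm::finite) sq)" for c
    by (intro central_scal kscalar)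
  have "rdefect (smap kscalar (sq S)) (scal (kscalar (- qpar * t))) (rleg cmat) \<in> mideal J"
    unfolding rl conj_rdefect[OF inv_legs s gc gc ck]
    by (intro two_sided_rmult[OF MJ] two_sided_lmult[OF MJ] gen(1))
  moreover have "ring_eval (\<lambda>a. scal (kscalar (fps_const a))) (\<Prod>i\<in>{1..l}. [:- ev i, 1:]) cmat \<in> mideal J"
    unfolding cmat_def g_def[symmetric] conj_ring_eval[OF TT(2,1) ck]
    by (intro two_sided_rmult[OF MJ] two_sided_lmult[OF MJ] gen(2))
  moreover have "mtr (smap kscalar (sq D) * cmat ^ k) - kscalar (qtrace_value t l ev blk k) \<in> J" if "k \<in> {1..l - 1}" for k
    using gen(3)[OF that] unfolding g_def mtr_coact[OF inv] .
  moreover have "kscalar = (\<lambda>c. coact (scalar c))" by (simp add: coact)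
  note vimage = orbit_ideal_subset_vimage[where ev = ev, OF coact(1) J this smap_coact[symmetric] t_def]
  ultimately have "I \<subseteq> coact -` J"
    unfolding I_def vimage by blast
  then have "coact p \<in> J" using p unfolding I_def[symmetric] by auto
  then show ?thesis
    unfolding act_coact J_def ext_ideal_def I_def using klin_evalat[OF H] by blast
qed

end

section \<open>Classical limit\<close>

lemma rhom_nth_0: "rhom (\<lambda>f :: complex fps. fps_nth f 0)"
  by (simp add: rhom_def)

lemma tsum_nth_0:
  assumes "tcong 1 x y"
  shows "fps_nth (tsum x f) 0 = fps_nth (tsum y f) 0"
proof -
  define B where "B = tsupp 0 (coord x) \<union> tsupp 0 (coord y)"
  have B: "finite B" "tsupp 0 (coord x) \<subseteq> B" "tsupp 0 (coord y) \<subseteq> B"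
    by (auto simp: B_def finite_tsupp_coord)
  show ?thesis
    using assms by (simp add: tsum_nth[OF B(1,2)] tsum_nth[OF B(1,3)] tcong_def)
qed

lemma tsum_mult_right: "tsum x (\<lambda>b. f b * c) = tsum x f * c"
  using tsum_mult[of x c f] by (simp add: mult.commute)

lemma rmatrix_classical:
  assumes "tcong 2 z (tens u u + tscale fps_X y)" "\<rho> u = mat 1"
    and "\<And>i j. tlin (\<lambda>h. \<rho> h $ i $ j)"
  shows "fps_nth (rep2 \<rho> z $ p $ q) 0 = (if p = q then 1 else 0)"
proof -
  have "tcong 1 z (tens u u)"
    using assms(1) by (simp add: tcong_def coord_simps)
  from tsum_nth_0[OF this] have "fps_nth (rep2 \<rho> z $ p $ q) 0 = fps_nth (rep2 \<rho> (tens u u) $ p $ q) 0"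
    by (simp add: rep2_def)
  also have "rep2 \<rho> (tens u u) $ p $ q = tsum u (\<lambda>b. \<rho> (tbasis b) $ fst p $ fst q) * tsum u (\<lambda>b. \<rho> (tbasis b) $ snd p $ snd q)"
    by (simp add: rep2_def mtens_def tsum_tens tsum_mult tsum_mult_right)
  also have "\<dots> = (if p = q then 1 else 0)"
    by (simp add: tlin_eq_tsum[OF assms(3), symmetric] assms(2) mat_def prod_eq_iff)
  finally show ?thesis by simp
qed

text \<open>At order 0, \<open>S\<close> is \<open>c\<close> times the flip and the Hecke parameter
  vanishes, so the Hecke relation reads \<open>c * c = 1\<close>. The normalization is thus known up
  to a sign.\<close>

lemma hecke_classical:
  fixes R :: "complex fps^('n::finite \<times> 'n)^('n \<times> 'n)"
  assumes R: "\<And>p q. fps_nth (R $ p $ q) 0 = (if p = q then c else 0)" and S: "hecke (braid R)"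
  shows "c * c = 1"
proof -
  define s where "s = smap (\<lambda>f. fps_nth f 0) (sq (braid R))"
  have s: "mx s $ p $ q = (if q = (snd p, fst p) then c else 0)" for p q
    by (auto simp: s_def mx_smap_nth mx_simps(7) braid_def mflip_mult R)
  obtain p :: "'n \<times> 'n" where True by blast
  have w0: "fps_nth (qpar - inverse qpar) 0 = 0" by (simp add: qpar_def)
  have "fps_nth ((braid R ** braid R) $ p $ p) 0 = 1"
    using S w0 by (simp add: hecke_def mat_def)
  moreover have "fps_nth ((braid R ** braid R) $ p $ p) 0 = (\<Sum>r\<in>UNIV. mx s $ p $ r * mx s $ r $ p)"
    by (simp add: matrix_matrix_mult_def fps_sum_nth s_def mx_smap_nth mx_simps(7))
  moreover have "(\<Sum>r\<in>UNIV. mx s $ p $ r * mx s $ r $ p) = (\<Sum>r\<in>UNIV. if r = (snd p, fst p) then c * c else 0)"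
    by (intro sum.cong refl) (auto simp: s)
  ultimately show ?thesis by simp
qed

section \<open>Points of semisimple orbits and evaluation of the free algebra at them\<close>

lemma mx_diag_power: "mx (sq (diagmat ev blk) ^ k) $ a $ b = (if a = b then ev (blk a) ^ k else 0)"
  by (induction k arbitrary: a b)
     (auto simp: mx_simps(2,7) mat_def mx_times_nth diagmat_def if_distrib[of "\<lambda>a. a * _"] cong: if_cong)

lemma mx_diag_ring_eval: "mx (ring_eval scal P (sq (diagmat ev blk))) $ a $ b = (if a = b then poly P (ev (blk a)) else 0)"
  by (simp add: ring_eval_def mx_sum mx_scal_times_nth mx_diag_power poly_altdef)

lemma orbitE:
  assumes "x \<in> orbit y"
  obtains g g' where "sq x = g' * sq y * g" "g * g' = 1" "g' * g = 1"
proof -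
  obtain h where h: "invertible h" "x = matrix_inv h ** y ** h"
    using assms by (auto simp: orbit_def gconj_def)
  have "h ** matrix_inv h = mat 1 \<and> matrix_inv h ** h = mat 1"
    using someI_ex[OF h(1)[unfolded invertible_def]] unfolding matrix_inv_def .
  then have "sq h * sq (matrix_inv h) = 1" "sq (matrix_inv h) * sq h = 1"
    by (auto intro!: sq_eqI simp: mx_simps)
  moreover have "sq x = sq (matrix_inv h) * sq y * sq h"
    by (rule sq_eqI) (simp add: mx_simps h)
  ultimately show ?thesis using that by blast
qed

lemma orbitI:
  assumes "sq x = g' * sq y * g" "g * g' = 1" "g' * g = 1"
  shows "x \<in> orbit y"
proof -
  have "mx g ** mx g' = mat 1" "mx g' ** mx g = mat 1"
    using arg_cong[OF assms(2), of mx] arg_cong[OF assms(3), of mx] by (simp_all add: mx_simps)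
  then have inv: "invertible (mx g)" unfolding invertible_def by blast
  have "sq (matrix_inv (mx g)) = g'" by (rule invertible_sq[OF assms(2,3)])
  from arg_cong[OF this, of mx] have "matrix_inv (mx g) = mx g'" by (simp add: mx_simps)
  moreover have "x = mx g' ** y ** mx g"
    using arg_cong[OF assms(1), of mx] by (simp add: mx_simps)
  ultimately show ?thesis using inv
    by (auto simp: orbit_def gconj_def intro!: exI[of _ "mx g"])
qed

lemma classical_value_fhom: "classical_value p x = fhom (\<lambda>c. fps_nth c 0) (\<lambda>(i, j). x $ i $ j) p"
  by (simp add: classical_value_def fhom_def)

lemma rhom_classical_value: "rhom (\<lambda>p. classical_value p x)"
  unfolding classical_value_fhom[abs_def] by (intro rhom_fhom rhom_nth_0 central_comm)

lemma classical_value_scalar: "classical_value (scalar c) x = fps_nth c 0"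
  unfolding classical_value_fhom by (rule fhom_scalar[OF rhom_nth_0])

lemma classical_value_gen: "classical_value (gen (i, j)) x = x $ i $ j"
  unfolding classical_value_fhom by (simp add: fhom_gen[OF rhom_nth_0])

lemma smap_classical_value: "smap (\<lambda>p. classical_value p x) gmat = sq x"
  by (rule sq_eqI) (simp add: mx_smap_nth mx_gmat_nth classical_value_gen mx_simps(7))

lemma classical_qtrace_value:
  "fps_nth (qtrace_value (fps_const a * (fps_exp (-2) - 1)) l ev blk k) 0 =
    (\<Sum>i\<in>{1..l}. ev i ^ k * of_nat (blocksize blk i))"
proof -
  have prod: "fps_nth (prod f A) 0 = (\<Prod>j\<in>A. fps_nth (f j) 0)" for f :: "nat \<Rightarrow> complex fps" and A
    by (induction A rule: infinite_finite_induct) auto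
  have "fps_nth (qcoef (fps_const a * (fps_exp (-2) - 1)) l ev m i) 0 = of_nat (m i)" for m i
    by (simp add: qcoef_def prod qint_nth_0 omega_alt)
  then show ?thesis by (simp add: qtrace_value_qcoef fps_sum_nth)
qed

lemma two_sided_zero: "two_sided {0}"
  by (simp add: two_sided_def)

text \<open>At order 0, \<open>t\<close> vanishes, \<open>D\<close> is the identity and conjugation
  by \<open>S\<close> exchanges the two legs. The reflection equation becomes commutation of the two
  legs of a numerical matrix, the polynomial relation holds for the diagonal matrix and its
  conjugates, and the trace relation counts eigenvalues with multiplicities.\<close>

lemma classical_orbit_ideal:
  fixes S :: "complex fps^('n::finite \<times> 'n)^('n \<times> 'n)" and D :: "complex fps^'n^'n"
  assumes S: "\<And>p q. fps_nth (S $ p $ q) 0 = (if q = (snd p, fst p) then c else 0)" and c: "c * c = 1"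
    and D: "\<And>i j. fps_nth (D $ i $ j) 0 = (if i = j then 1 else 0)"
    and blk: "range blk = {1..l}" and x: "x \<in> orbit (diagmat ev blk)"
    and p: "p \<in> orbit_ideal S D l ev blk"
  shows "classical_value p x = 0"
proof -
  obtain g g' where g: "sq x = g' * sq (diagmat ev blk) * g" "g * g' = 1" "g' * g = 1"
    using orbitE[OF x] .
  define t where "t = fps_const (ev 1) * (fps_exp (-2) - 1)"
  define s where "s = smap (\<lambda>f. fps_nth f 0) (sq S)"
  have t0: "fps_nth (- qpar * t) 0 = 0" by (simp add: t_def)
  have s: "mx s $ p $ q = (if q = (snd p, fst p) then c else 0)" for p q
    by (simp add: s_def mx_smap_nth mx_simps(7) S)
  have s1: "mx (s * y) $ p $ q = c * mx y $ (snd p, fst p) $ q" for y p q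
    unfolding mx_times_nth s by (simp add: if_distrib[of "\<lambda>a. a * _"] cong: if_cong)
  have sw: "p = (snd q, fst q) \<longleftrightarrow> q = (snd p, fst p)" for p q :: "'n \<times> 'n"
    by (auto simp: prod_eq_iff)
  have s2: "mx (y * s) $ p $ q = mx y $ p $ (snd q, fst q) * c" for y p q
    unfolding mx_times_nth s by (subst sw) (simp add: if_distrib[of "\<lambda>a. _ * a"] cong: if_cong)
  have ss: "s * s = 1"
    by (rule sq_eqI) (auto simp: s1 s mx_simps(2) mat_def c prod_eq_iff)
  have sl: "s * rleg (sq x) = lleg (sq x) * s"
    by (rule sq_eqI) (simp add: s1 s2 mx_rleg_nth mx_lleg_nth mult.commute)
  have srs: "s * rleg (sq x) * s = lleg (sq x)"
    unfolding sl by (simp add: mult.assoc ss)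
  have comm: "lleg (sq x) * rleg (sq x) = rleg (sq x) * lleg (sq x)"
    by (rule lleg_rleg_commute) (rule mult.commute)
  have 1: "rdefect (smap (\<lambda>f. fps_nth f 0) (sq S)) (scal (fps_nth (- qpar * t) 0)) (rleg (sq x)) = 0"
    unfolding s_def[symmetric] rdefect_def srs t0 rhom_0[OF rhom_scal] comm by simp
  have h: "rhom scal" "\<And>a :: complex. central (scal a)"
    by (rule rhom_scal) (intro central_scal central_comm)
  have "ring_eval scal (\<Prod>i\<in>{1..l}. [:- ev i, 1:]) (sq (diagmat ev blk)) = 0"
  proof (rule sq_eqI)
    fix a b
    have "blk a \<in> {1..l}" using blk by auto
    then have "poly (\<Prod>i\<in>{1..l}. [:- ev i, 1:]) (ev (blk a)) = 0"
      unfolding poly_prod by (intro prod_zero) auto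
    then show "mx (ring_eval scal (\<Prod>i\<in>{1..l}. [:- ev i, 1:]) (sq (diagmat ev blk))) $ a $ b = mx 0 $ a $ b"
      unfolding mx_diag_ring_eval mx_simps(1) zero_index by (simp only: if_cancel split: if_split)
  qed
  then have 2: "ring_eval scal (\<Prod>i\<in>{1..l}. [:- ev i, 1:]) (sq x) = 0"
    unfolding g(1) conj_ring_eval[OF g(2,3) h(2)] by simp
  have 3: "mtr (smap (\<lambda>f. fps_nth f 0) (sq D) * sq x ^ k) = fps_nth (qtrace_value t l ev blk k) 0" for k
  proof -
    have "smap (\<lambda>f. fps_nth f 0) (sq D) = 1"
      by (rule sq_eqI) (simp add: mx_smap_nth mx_simps(2,7) D mat_def)
    moreover have "sq x ^ k = g' * sq (diagmat ev blk) ^ k * g"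
      unfolding g(1) by (rule conj_power[OF g(2,3)])
    ultimately have "mtr (smap (\<lambda>f. fps_nth f 0) (sq D) * sq x ^ k) = mtr (g' * (sq (diagmat ev blk) ^ k * g))"
      by (simp add: mult.assoc)
    also have "\<dots> = mtr (sq (diagmat ev blk) ^ k * g * g')"
      unfolding mtr_def mx_simps(6)[of g'] mx_simps(6)[of "_ * g"] by (rule trace_mul_sym)
    also have "\<dots> = mtr (sq (diagmat ev blk) ^ k)"
      by (simp add: mult.assoc g)
    also have "\<dots> = (\<Sum>a\<in>UNIV. ev (blk a) ^ k)"
      by (simp add: mtr_def trace_def mx_diag_power)
    also have "\<dots> = (\<Sum>i\<in>{1..l}. \<Sum>a\<in>{a. a \<in> UNIV \<and> blk a = i}. ev (blk a) ^ k)"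
      using blk by (intro sum.group[symmetric]) auto
    also have "\<dots> = (\<Sum>i\<in>{1..l}. ev i ^ k * of_nat (blocksize blk i))"
      by (intro sum.cong refl) (simp add: blocksize_def)
    finally show ?thesis unfolding t_def classical_qtrace_value .
  qed
  have \<iota>: "(\<lambda>f. fps_nth f 0) = (\<lambda>f. classical_value (scalar f) x)"
    by (simp add: classical_value_scalar)
  have "orbit_ideal S D l ev blk \<subseteq> (\<lambda>p. classical_value p x) -` {0}"
    unfolding orbit_ideal_subset_vimage[where ev = ev, OF rhom_classical_value two_sided_zero \<iota>
        smap_classical_value[symmetric] t_def]
    using 1 2 3 by (simp add: mideal_def mx_simps(1))
  then show ?thesis using p by auto
qed

lemma classical_value_poly_subst: "classical_value (poly_subst P p) x = classical_value p (mpoly_eval (\<lambda>a. a) P x)"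
proof (rule rhom_free_eq[of "\<lambda>p. classical_value (poly_subst P p) x"])
  show "rhom (\<lambda>p. classical_value (poly_subst P p) x)"
    by (rule rhom_comp[of "\<lambda>p. classical_value p x", OF rhom_classical_value rhom_poly_subst])
  fix y :: "'a \<times> 'a"
  obtain i j where y: "y = (i, j)" by (cases y)
  have "smap (\<lambda>p. classical_value p x) (ring_eval cscalar P gmat) = ring_eval scal P (sq x)"
    unfolding ring_eval_rhom[OF rhom_smap[OF rhom_classical_value]] smap_scal[OF rhom_classical_value]
      smap_classical_value classical_value_scalar by simp
  from arg_cong[OF this, of "\<lambda>m. mx m $ i $ j"]
  have "classical_value (mx (ring_eval cscalar P gmat) $ i $ j) x = mpoly_eval (\<lambda>a. a) P x $ i $ j"
    unfolding mx_smap_nth using mx_ring_eval[of "\<lambda>a. a" P "sq x"] by (simp add: mx_simps(7))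
  then show "classical_value (poly_subst P (gen y)) x = classical_value (gen y) (mpoly_eval (\<lambda>a. a) P x)"
    unfolding y poly_subst_gen classical_value_gen mx_ring_eval mx_gmat .
qed (simp_all add: rhom_comp rhom_classical_value rhom_poly_subst poly_subst_scalar classical_value_scalar)

lemma orbit_mpoly:
  assumes x: "x \<in> orbit (diagmat ev blk)" and P: "\<And>a. poly P (ev (blk a)) = ev' (blk' a)"
  shows "mpoly_eval (\<lambda>a. a) P x \<in> orbit (diagmat ev' blk')"
proof -
  obtain g g' where g: "sq x = g' * sq (diagmat ev blk) * g" "g * g' = 1" "g' * g = 1"
    using orbitE[OF x] .
  have "sq (mpoly_eval (\<lambda>a. a) P x) = ring_eval scal P (sq x)"
    using mx_ring_eval[of "\<lambda>a. a" P "sq x"] by (metis mx_simps(7,8))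
  also have "\<dots> = g' * ring_eval scal P (sq (diagmat ev blk)) * g"
    unfolding g(1) by (rule conj_ring_eval[OF g(2,3)]) (intro central_scal central_comm)
  also have "ring_eval scal P (sq (diagmat ev blk)) = sq (diagmat ev' blk')"
    by (rule sq_eqI) (simp add: mx_diag_ring_eval P, simp add: mx_simps(7) diagmat_def)
  finally show ?thesis by (rule orbitI[OF _ g(2,3)])
qed

subsection \<open>Classical limits on cosets\<close>

context
  fixes I :: "'n::finite qmat set" and Z :: "(complex^'n^'n) set"
  assumes I: "two_sided I" and van: "\<And>p x. p \<in> I \<Longrightarrow> x \<in> Z \<Longrightarrow> classical_value p x = 0"
begin

text \<open>The choice of a representative in \<open>classical_limit\<close> is harmless because the
  ideal vanishes on \<open>Z\<close>.\<close>

lemma classical_limit_cls: "classical_limit Z (coset_of I a) = restrict (classical_value a) Z"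
proof -
  have "a \<in> coset_of I a" by (simp add: mem_cls[OF I] two_sided_0[OF I])
  then have "(SOME p. p \<in> coset_of I a) \<in> coset_of I a" by (rule someI)
  then have "(SOME p. p \<in> coset_of I a) - a \<in> I" by (simp add: mem_cls[OF I])
  from van[OF this] have "classical_value (SOME p. p \<in> coset_of I a) x = classical_value a x" if "x \<in> Z" for x
    using that by (simp add: rhom_diff[OF rhom_classical_value])
  then show ?thesis by (auto simp: classical_limit_def restrict_def)
qed

lemma mem_residue_class:
  "C \<in> residue_class I (coset_of I b) \<longleftrightarrow> (\<exists>c. C = coset_of I (scalar fps_X * c + b))"
proof -
  have "C \<in> residue_class I (coset_of I b) \<longleftrightarrow> (\<exists>h\<in>hbar_ideal I. C = h \<oplus>\<^bsub>qalg I\<^esub> coset_of I b)"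
    unfolding residue_class_def a_r_coset_def'[of "qalg I"] by auto
  also have "\<dots> \<longleftrightarrow> (\<exists>c. C = coset_of I (scalar fps_X * c) \<oplus>\<^bsub>qalg I\<^esub> coset_of I b)"
  proof -
    have "hbar_ideal I = range (\<lambda>c. qclass I (scalar fps_X) \<otimes>\<^bsub>qalg I\<^esub> coset_of I c)"
      unfolding hbar_ideal_def carrier_Quot by auto
    then show ?thesis unfolding Quot_simps(1)[OF I] by auto
  qed
  finally show ?thesis unfolding Quot_simps(2)[OF I] .
qed

text \<open>Members of a residue class differ by multiples of the parameter, which have value 0 at
  every point.\<close>

lemma residue_limit_class: "residue_limit Z (residue_class I (coset_of I b)) = classical_limit Z (coset_of I b)"
proof -
  have "\<exists>C. C \<in> residue_class I (coset_of I b)" unfolding mem_residue_class by blast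
  from someI_ex[OF this] obtain c where c: "(SOME C. C \<in> residue_class I (coset_of I b)) = coset_of I (scalar fps_X * c + b)"
    unfolding mem_residue_class by blast
  show ?thesis
    unfolding residue_limit_def c classical_limit_cls
    by (intro restrict_ext)
      (simp add: rhom_add[OF rhom_classical_value] rhom_mult[OF rhom_classical_value] classical_value_scalar)
qed

end

lemma residue_class_carrier: "C \<in> carrier (qalg I) \<Longrightarrow> residue_class I C \<in> carrier (qalg I Quot hbar_ideal I)"
  by (auto simp: residue_class_def FactRing_def A_RCOSETS_def')

lemma act_diff:
  assumes "topological_hopf_algebra H" "\<And>i j. tlin (\<lambda>h. \<rho> h $ i $ j)" "\<rho> (hunit H) = mat 1"
    "\<And>x y. \<rho> (hmult H x y) = \<rho> x ** \<rho> y"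
  shows "act H \<rho> h (p - q) = act H \<rho> h p - act H \<rho> h q"
proof -
  have "act H \<rho> h (p' + q') = act H \<rho> h p' + act H \<rho> h q'" for p' q'
    unfolding act_coact[OF assms] rhom_add[OF coact(1)[OF assms]] coeffs_map_add[OF klin_evalat[OF assms(1)]] ..
  from this[of "p - q" q] show ?thesis by simp
qed

text \<open>Reduction modulo the parameter appears twice: on cosets, through
  \<open>classical_limit\<close>, and in the residue algebras. The latter form relies on their
  identification with the coordinate rings, hence the premise that both algebras are quantizations,
  as the context states.\<close>

theorem theorem3:
  fixes H :: "'b hopf"
    and e :: "'n::{finite,linorder} \<times> 'n \<Rightarrow> 'b tfree"
    and r :: "complex^('n \<times> 'n)^('n \<times> 'n)"
    and \<rho> :: "'b tfree \<Rightarrow> complex fps^('n::{finite,linorder})^('n::{finite,linorder})"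
    and R S :: "complex fps^('n \<times> 'n)^('n \<times> 'n)"
    and D :: "complex fps^('n::{finite,linorder})^('n::{finite,linorder})"
    and c \<nu> :: "complex fps"
    and l :: nat
    and lam mu :: "nat \<Rightarrow> complex"
    and blk blk' :: "'n \<Rightarrow> nat"
    and P :: "complex poly"
    and I_lam I_mu :: "'n qmat set"
    and O_lam O_mu :: "(complex^('n::{finite,linorder})^('n::{finite,linorder})) set"
  assumes quantum_group: "factorizable_quantum_group H e r"
    and representation: "basic_representation H e \<rho>"
    and R: "R = map_matrix ((*) c) (rep2 \<rho> (rmatrix H))"
    and S: "S = braid R" "hecke S"
    and D: "D = dmatrix \<nu> R" "trace D = qint CARD('n)"
    and blocks: "2 \<le> l" "mono blk" "range blk = {1..l}" "inj_on lam {1..l}"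
    and blocks': "blk' = (\<lambda>a. if blk a = 1 then 1 else 2)" "mu 1 \<noteq> mu 2"
    and orbits: "O_lam = orbit (diagmat lam blk)" "O_mu = orbit (diagmat mu blk')"
    and P: "P = Polynomial.smult (mu 1 - mu 2) (\<Prod>i\<in>{2..l}. Polynomial.smult (1 / (lam 1 - lam i)) [:- lam i, 1:]) + [:mu 2:]"
    and I: "I_lam = orbit_ideal S D l lam blk" "I_mu = orbit_ideal S D 2 mu blk'"
  shows "\<exists>\<Phi>. algebra_hom I_mu I_lam \<Phi> \<and>
      (\<forall>i j. \<Phi> (qclass I_mu (genmat $ i $ j)) =
         qclass I_lam (mpoly_eval (\<lambda>a. scalar (fps_const a)) P genmat $ i $ j)) \<and>
      equivariant H \<rho> I_mu I_lam \<Phi> \<and>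
      (\<forall>C\<in>carrier (qalg I_mu). classical_limit O_lam (\<Phi> C) =
         pullback O_lam (mpoly_eval (\<lambda>a. a) P) (classical_limit O_mu C)) \<and>
      (orbit_quantization I_lam O_lam (orbit_poisson r l lam blk) \<and>
       orbit_quantization I_mu O_mu (orbit_poisson r 2 mu blk') \<longrightarrow>
         quantizes_map I_mu O_mu I_lam O_lam (pullback O_lam (mpoly_eval (\<lambda>a. a) P)) \<Phi>)"
proof -
  have hopf: "topological_hopf_algebra H" and
    qt: "\<And>x. hmult2 H (tflip (comult H x)) (rmatrix H) = hmult2 H (rmatrix H) (comult H x)"
    using quantum_group unfolding factorizable_quantum_group_def quasitriangular_def by blast+
  obtain y where rmat: "tcong 2 (rmatrix H) (tens (hunit H) (hunit H) + tscale fps_X y)"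
    using quantum_group unfolding factorizable_quantum_group_def by blast
  have \<rho>_lin: "tlin (\<lambda>h. \<rho> h $ i $ j)" for i j
  proof -
    have "module_hom tscale (\<lambda>c. map_matrix ((*) c)) \<rho>"
      using representation by (simp add: basic_representation_def)
    then show ?thesis by (simp add: tlin_def module_hom.add module_hom.scale)
  qed
  have \<rho>_unit: "\<rho> (hunit H) = mat 1" and \<rho>_mult: "\<And>x y. \<rho> (hmult H x y) = \<rho> x ** \<rho> y"
    using representation by (simp_all add: basic_representation_def)
  note rep = hopf \<rho>_lin \<rho>_unit \<rho>_mult

  \<comment> \<open>The constant term of the normalizing scalar. Its sign stays open and is
    compensated by \<open>\<nu>\<close> in the matrix \<open>D\<close>.\<close>
  define c0 where "c0 = fps_nth c 0"
  have R0: "fps_nth (R $ p $ q) 0 = (if p = q then c0 else 0)" for p q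
    by (simp add: R c0_def rmatrix_classical[OF rmat \<rho>_unit \<rho>_lin])
  have c0: "c0 * c0 = 1"
    using hecke_classical[OF R0] S by simp
  have S0: "fps_nth (S $ p $ q) 0 = (if q = (snd p, fst p) then c0 else 0)" for p q
    by (auto simp: S braid_def mflip_mult R0)
  have "smap (\<lambda>f. fps_nth f 0) (sq (transpose1 R)) = scal c0"
    by (rule sq_eqI) (auto simp: mx_smap_nth mx_simps(7) mx_scal_nth transpose1_def R0 prod_eq_iff)
  moreover have "c0 \<noteq> 0" using c0 by auto
  ultimately obtain ui where ui: "sq (transpose1 R) * ui = 1" "ui * sq (transpose1 R) = 1"
    and u0: "smap (\<lambda>f. fps_nth f 0) (sq (transpose1 R)) = scal c0"
    using fps_matrix_inverse by metis

  note TT = rsq_inverse[OF rep]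
  have frt: "smap kscal (sq S) * (lleg (rsq H \<rho>) * rleg (rsq H \<rho>)) =
      lleg (rsq H \<rho>) * rleg (rsq H \<rho>) * smap kscal (sq S)"
    unfolding S(1) by (rule braid_rsq[OF rep rep2_comult_commute[OF rep qt R]])
  note inv = dmatrix_invariant[OF TT frt[unfolded S(1)] ui, of \<nu>, folded D(1)]
  \<comment> \<open>At order 0, \<open>ui\<close> is \<open>c0\<close> times the identity, because
    \<open>c0\<close> is its own inverse. So \<open>D\<close> is there a scalar matrix with entry
    \<open>\<nu> c0\<close>, and comparing traces, with \<open>qint n\<close> equal to
    \<open>n\<close> at order 0, forces this scalar to be 1.\<close>
  have D0: "fps_nth (D $ i $ j) 0 = (if i = j then 1 else 0)" for i j
  proof -
    have "smap (\<lambda>f. fps_nth f 0) ui * scal c0 = 1"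
      using arg_cong[OF ui(2), of "smap (\<lambda>f. fps_nth f 0)"] unfolding u0[symmetric]
      by (simp add: rhom_mult[OF rhom_smap[OF rhom_nth_0]] rhom_1[OF rhom_smap[OF rhom_nth_0]])
    from arg_cong[OF this, of "\<lambda>x. mx x $ p $ q" for p q]
    have "fps_nth (mx ui $ p $ q) 0 * c0 = (if p = q then 1 else 0)" for p q
      by (simp add: mx_times_scal_nth mx_smap_nth mx_simps(2) mat_def)
    then have ui0: "fps_nth (mx ui $ p $ q) 0 = (if p = q then c0 else 0)" for p q
      using c0 by (metis mult.assoc mult_1 mult_1_right mult_zero_left)
    have D00: "fps_nth (D $ i $ j) 0 = (if i = j then fps_nth \<nu> 0 * c0 else 0)" for i j
    proof -
      have "fps_nth (D $ i $ j) 0 = fps_nth \<nu> 0 * (\<Sum>s\<in>UNIV. fps_nth (mx ui $ (s, s) $ (i, j)) 0)"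
        unfolding D(1) dmatrix_eq[OF TT frt[unfolded S(1)] ui] by (simp add: fps_sum_nth)
      also have "(\<Sum>s\<in>UNIV. fps_nth (mx ui $ (s, s) $ (i, j)) 0) = (\<Sum>s\<in>UNIV. if s = i then (if i = j then c0 else 0) else 0)"
        by (intro sum.cong refl) (auto simp: ui0)
      finally show ?thesis by simp
    qed
    have "fps_nth (trace D) 0 = of_nat CARD('n) * (fps_nth \<nu> 0 * c0)"
      by (simp add: trace_def fps_sum_nth D00)
    then have "fps_nth \<nu> 0 * c0 = 1" by (simp add: D(2) qint_nth_0)
    then show ?thesis by (simp add: D00)
  qed

  define Q where "Q = (\<Prod>i\<in>{2..l}. Polynomial.smult (1 / (lam 1 - lam i)) [:- lam i, 1:])"
  note data = S(2) D(2) blocks(1,3,4) blocks' Q_def P[folded Q_def]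
  have I_lam: "two_sided I_lam" and I_mu: "two_sided I_mu"
    by (simp_all add: I two_sided_orbit_ideal)
  have th: "poly_subst P ` I_mu \<subseteq> I_lam"
    using poly_subst_ideal[OF data] by (auto simp: I)
  have act_lam: "act H \<rho> h ` I_lam \<subseteq> I_lam" and act_mu: "act H \<rho> h ` I_mu \<subseteq> I_mu" for h
    using act_orbit_ideal[OF rep frt inv] by (auto simp: I)

  have van_lam: "classical_value p x = 0" if "p \<in> I_lam" "x \<in> O_lam" for p x
    using that classical_orbit_ideal[OF S0 c0 D0 blocks(3)] by (simp add: I orbits)
  have van_mu: "classical_value p x = 0" if "p \<in> I_mu" "x \<in> O_mu" for p x
    using that classical_orbit_ideal[OF S0 c0 D0 blocksizes(3)[OF data]] by (simp add: I orbits)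
  have lim_lam: "classical_limit O_lam (coset_of I_lam p) = restrict (classical_value p) O_lam" for p
    by (rule classical_limit_cls[OF I_lam van_lam])
  have lim_mu: "classical_limit O_mu (coset_of I_mu p) = restrict (classical_value p) O_mu" for p
    by (rule classical_limit_cls[OF I_mu van_mu])
  have PO: "mpoly_eval (\<lambda>a. a) P x \<in> O_mu" if "x \<in> O_lam" for x
    unfolding orbits
  proof (rule orbit_mpoly[OF that[unfolded orbits]])
    fix a
    have "blk a \<in> {1..l}" using blocks(3) by auto
    then have "blk a = 1 \<or> blk a \<in> {2..l}" by auto
    then show "poly P (lam (blk a)) = mu (blk' a)"
      using poly_P[OF data] by (auto simp: blocks')
  qed

  define \<Phi> where "\<Phi> C = (\<Union>p\<in>C. coset_of I_lam (poly_subst P p))" for C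
  have \<Phi>: "\<Phi> (coset_of I_mu p) = coset_of I_lam (poly_subst P p)" for p
    unfolding \<Phi>_def by (rule UN_cls[OF I_mu I_lam rhom_diff[OF rhom_poly_subst] th])
  have carr: "\<exists>p. C = coset_of I_mu p" if "C \<in> carrier (qalg I_mu)" for C
    using that by (auto simp: carrier_Quot)

  have hom: "algebra_hom I_mu I_lam \<Phi>"
    unfolding algebra_hom_def
  proof (intro conjI allI ring_hom_memI)
    show "\<Phi> C \<in> carrier (qalg I_lam)" if "C \<in> carrier (qalg I_mu)" for C
      using carr[OF that] by (auto simp: \<Phi> carrier_Quot)
    show "\<Phi> (A \<otimes>\<^bsub>qalg I_mu\<^esub> B) = \<Phi> A \<otimes>\<^bsub>qalg I_lam\<^esub> \<Phi> B"
      "\<Phi> (A \<oplus>\<^bsub>qalg I_mu\<^esub> B) = \<Phi> A \<oplus>\<^bsub>qalg I_lam\<^esub> \<Phi> B"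
      if "A \<in> carrier (qalg I_mu)" "B \<in> carrier (qalg I_mu)" for A B
      using carr[OF that(1)] carr[OF that(2)]
      by (auto simp: Quot_simps[OF I_mu] Quot_simps[OF I_lam] \<Phi> rhom_mult[OF rhom_poly_subst] rhom_add[OF rhom_poly_subst])
    show "\<Phi> \<one>\<^bsub>qalg I_mu\<^esub> = \<one>\<^bsub>qalg I_lam\<^esub>"
      by (simp add: Quot_simps[OF I_mu] Quot_simps[OF I_lam] \<Phi> rhom_1[OF rhom_poly_subst])
    show "\<Phi> (qclass I_mu (scalar c)) = qclass I_lam (scalar c)" for c
      by (simp add: \<Phi> poly_subst_scalar)
  qed
  moreover have "\<Phi> (qclass I_mu (genmat $ i $ j)) =
         qclass I_lam (mpoly_eval (\<lambda>a. scalar (fps_const a)) P genmat $ i $ j)" for i j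
    unfolding poly_subst_gen[symmetric] by (simp add: \<Phi> genmat_def)
  moreover have "equivariant H \<rho> I_mu I_lam \<Phi>"
    unfolding equivariant_def
  proof (intro allI ballI)
    fix h C assume "C \<in> carrier (qalg I_mu)"
    then obtain p where p: "C = coset_of I_mu p" using carr by blast
    have "qact H \<rho> I_mu h (coset_of I_mu p) = coset_of I_mu (act H \<rho> h p)"
      unfolding qact_def by (rule UN_cls[OF I_mu I_mu act_diff[OF rep] act_mu])
    moreover have "qact H \<rho> I_lam h (coset_of I_lam p) = coset_of I_lam (act H \<rho> h p)" for p
      unfolding qact_def by (rule UN_cls[OF I_lam I_lam act_diff[OF rep] act_lam])
    ultimately show "\<Phi> (qact H \<rho> I_mu h C) = qact H \<rho> I_lam h (\<Phi> C)"
      by (simp add: p \<Phi> act_poly_subst[OF rep])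
  qed
  moreover have cl: "classical_limit O_lam (\<Phi> C) =
         pullback O_lam (mpoly_eval (\<lambda>a. a) P) (classical_limit O_mu C)"
    if C: "C \<in> carrier (qalg I_mu)" for C
  proof -
    obtain p where p: "C = coset_of I_mu p" using carr[OF C] by blast
    show ?thesis
      unfolding p \<Phi> lim_lam lim_mu pullback_def
      by (intro restrict_ext) (simp add: PO classical_value_poly_subst)
  qed
  moreover have "quantizes_map I_mu O_mu I_lam O_lam (pullback O_lam (mpoly_eval (\<lambda>a. a) P)) \<Phi>"
    if "orbit_quantization I_lam O_lam (orbit_poisson r l lam blk)"
  proof -
    \<comment> \<open>Injectivity upgrades the equality of classical limits to the equality of
      residue classes demanded through \<open>inv_into\<close>.\<close>
    have iso: "inj_on (residue_limit O_lam) (carrier (qalg I_lam Quot hbar_ideal I_lam))"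
      using that by (simp add: orbit_quantization_def ring_iso_def bij_betw_def)
    have "residue_class I_lam (\<Phi> C) =
        inv_into (carrier (qalg I_lam Quot hbar_ideal I_lam)) (residue_limit O_lam)
          (pullback O_lam (mpoly_eval (\<lambda>a. a) P) (residue_limit O_mu (residue_class I_mu C)))"
      if C: "C \<in> carrier (qalg I_mu)" for C
    proof -
      obtain p where p: "C = coset_of I_mu p" using carr[OF C] by blast
      have "residue_limit O_lam (residue_class I_lam (\<Phi> C)) = classical_limit O_lam (\<Phi> C)"
        unfolding p \<Phi> by (rule residue_limit_class[OF I_lam van_lam])
      moreover have "residue_limit O_mu (residue_class I_mu C) = classical_limit O_mu C"
        unfolding p by (rule residue_limit_class[OF I_mu van_mu])
      moreover have "residue_class I_lam (\<Phi> C) \<in> carrier (qalg I_lam Quot hbar_ideal I_lam)"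
        by (intro residue_class_carrier) (simp add: p \<Phi> carrier_Quot)
      ultimately show ?thesis
        using iso cl[OF C] by (metis inv_into_f_f)
    qed
    then show ?thesis using hom by (simp add: quantizes_map_def)
  qed
  ultimately show ?thesis by blast
qed

end
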